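(* Let $r\ge8$, $q_*\ge2$, and let $\Omega_0\subset\mathbb R^2$ be a strictly convex domain with $C^r$ boundary that is $q_*$-rationally integrable. Let $\gamma_0\approx 2.788$ be the number with $\sum_{k=2}^{\infty}k^{-(\gamma_0-1)}=0.9$. Then for every $\gamma$ with $\gamma_0\le\gamma<3$ there exists $q_0=q_0(\Omega_0,\gamma)$ such that for each integer $\bar q\ge q_0$ the linear map $$\mathcal I^{\bar q}:X^\gamma\to h^\gamma,\qquad f\mapsto\Big(a_0,a_1,b_1,\dots,a_{\bar q-1},b_{\bar q-1},\ \mathbb L_{\bar q}(f)\big(\tfrac{3}{4\bar q}\big),\ \mathbb L_{\bar q}(f)(0),\ \dots,\ \mathbb L_{q}(f)\big(\tfrac{3}{4q}\big),\ \mathbb L_{q}(f)(0),\ \dots\Big)$$ (the last entries running over all integers $q\ge\bar q$, and $a_0,a_k,b_k$ being the Fourier coefficients of $f$) is invertible as a linear operator from $X^\gamma$ to $h^\gamma$.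
   Context: $\mathbb T=\mathbb R/\mathbb Z$; functions on $\mathbb T$ are identified with 1-periodic functions. Billiards. For a strictly convex domain $\Omega$ with $C^r$ boundary, the billiard map sends $(x,v)$ ($x\in\partial\Omega$, $v$ inward unit vector) to $(x',v')$, where $x'$ is the next point of $\partial\Omega$ hit by the ray from $x$ in direction $v$ and $v'$ is the reflected velocity (angle of incidence equals angle of reflection). A smooth convex curve in $\Omega$ is a caustic if every trajectory tangent to it remains tangent to it after each reflection; it corresponds to a non-contractible invariant curve of the billiard map and has a rotation number. It is an integrable rational caustic if that invariant curve consists of periodic points. $\Omega$ is $q_*$-rationally integrable ($q_*\ge2$) if it admits integrable rational caustics of rotation number $p/q$ for all $0<p/q<1/q_*$. Lazutkin coordinates. Let $s$ be arc length on $\partial\Omega_0$, $\rho(s)$ the radius of curvature, $x(s)=C_{\Omega_0}\int_0^s\rho^{-2/3}(\tau)d\tau$ with $C_{\Omega_0}^{-1}=\int_0^{|\partial\Omega_0|}\rho^{-2/3}(s)ds$, write $\rho(x)=\rho(s(x))$, and let $\mu(x)=\frac1{2C_{\Omega_0}\rho(x)^{1/3}}$. Put $S_q(x)=\frac{\sin(\mu(x)/q)}{\mu(x)/q}-1$. Known expansions of periodic orbits. There are a constant $C=C(\Omega_0)$ and 1-periodic functions $\alpha,\beta$ and, for each integer $q>q_*$ and $k=0,\dots,q-1$, functions $\gamma_{a,k/q},\gamma_{b,k/q},\gamma_{c,k/q}$ on $\mathbb T$, with $\|\alpha\|_{C^{r-4}},\|\beta\|_{C^{r-4}}\le C$ and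 all $\gamma_{a,\cdot},\gamma_{b,\cdot},\gamma_{c,\cdot}$ bounded by $C$ in $C^{r-6}$, such that the periodic orbits of rotation number $1/q$ are parametrized by $x\in\mathbb T$ as $(x_q^k(x),\varphi_q^k(x))_{k=0,\dots,q-1}$ (collision points in the Lazutkin coordinate, and angles of reflection, i.e. angles between trajectory and tangent line) with $$x_q^k(x)=x+\tfrac kq+\tfrac{\alpha(x+k/q)}{q^2}+\tfrac{1}{q^4}\gamma_{a,k/q}(x),\qquad \varphi_q^k(x)=\tfrac{\mu(x_q^k)}{q}\Big(1+\tfrac{\beta(x+k/q)}{q^2}+\tfrac1{q^4}\gamma_{b,k/q}(x)\Big),$$ $$\frac{\sin\varphi_q^k(x)}{\mu(x_q^k(x))}=\frac1q\Big[1+\tfrac{\beta(x+k/q)}{q^2}+S_q(x+\tfrac kq)+\tfrac1{q^4}\gamma_{c,k/q}(x)\Big].$$ Such functions are fixed. Operators. For $f\in C^1(\mathbb T)$ and $q>q_*$ set $\mathbb L_q(f)=\mathbb L_q^1(f)+\mathbb L_q^2(f)$ with $$\mathbb L_q^1(f)(x)=\frac1{2\pi q^2}\sum_{k=0}^{q-1}f'\Big(x+\tfrac kq+\tfrac{\alpha(x+k/q)}{q^2}+\tfrac{\gamma_{a,k/q}(x)}{q^4}\Big)\Big(1+\tfrac{\alpha'(x+k/q)}{q^2}+\tfrac{\gamma_{a,k/q}'(x)}{q^4}\Big)\Big(1+\tfrac{\beta(x+k/q)}{q^2}+S_q(x+\tfrac kq)+\tfrac{\gamma_{c,k/q}(x)}{q^4}\Big),$$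 $$\mathbb L_q^2(f)(x)=\frac1{2\pi q^2}\sum_{k=0}^{q-1}f\Big(x+\tfrac kq+\tfrac{\alpha(x+k/q)}{q^2}+\tfrac{\gamma_{a,k/q}(x)}{q^4}\Big)\Big(\tfrac{\beta'(x+k/q)}{q^2}+S_q'(x+\tfrac kq)+\tfrac{\gamma_{c,k/q}'(x)}{q^4}\Big).$$ Equivalently $\mathbb L_q(f)(x)=\frac1{2\pi q}\frac{d}{dx}\sum_{k=0}^{q-1}f(x_q^k(x))\frac{\sin\varphi_q^k(x)}{\mu(x_q^k(x))}$. The threshold $q_0(\Omega_0,\gamma)$ is understood to exceed $q_*$ so that all operators are defined. Spaces. Write $f(x)=a_0+\sum_{k\ge1}(a_k\cos2\pi kx+b_k\sin2\pi kx)$. For $2<\gamma<3$, $X^\gamma$ is the Banach space of $f\in C^0(\mathbb T)$ with $\|f\|_{X^\gamma}=\max\{|a_0|,\sup_{j\ge1}j^\gamma\max\{|a_j|,|b_j|\}\}<\infty$ (so $X^\gamma\subset C^1(\mathbb T)$), and $h^\gamma$ is the Banach space of real sequences $c=(c_0,c_1,d_1,c_2,d_2,\dots)$ with $\|c\|_{h^\gamma}=\max\{|c_0|,\sup_{j\ge1}j^\gamma\max\{|c_j|,|d_j|\}\}<\infty$. *)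

theory Defs
  imports "HOL-Analysis.Analysis" "HOL-Library.Periodic_Fun"
begin

section \<open>Functions of class $C^n$ on the line\<close>

definition vderiv :: "nat \<Rightarrow> (real \<Rightarrow> 'a::real_normed_vector) \<Rightarrow> real \<Rightarrow> 'a" where
  "vderiv n f = ((\<lambda>g t. vector_derivative g (at t)) ^^ n) f"

definition Cn :: "nat \<Rightarrow> (real \<Rightarrow> 'a::real_normed_vector) \<Rightarrow> bool" where
  "Cn n f \<longleftrightarrow> (\<forall>i<n. \<forall>t. vderiv i f differentiable at t) \<and> continuous_on UNIV (vderiv n f)"

text \<open>The function \<open>f\<close> is of class $C^n$ with norm
  $\max_{i\le n}\sup_t|f^{(i)}(t)|$ at most \<open>C\<close>.\<close>

definition Cn_norm_le :: "nat \<Rightarrow> (real \<Rightarrow> 'a::real_normed_vector) \<Rightarrow> real \<Rightarrow> bool" where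
  "Cn_norm_le n f C \<longleftrightarrow> Cn n f \<and> (\<forall>i\<le>n. \<forall>t. norm (vderiv i f t) \<le> C)"


section \<open>Strictly convex domains in the plane\<close>

text \<open>Strict convexity is understood, as usual for billiards, to include non-vanishing curvature
  of the boundary (the last conjunct of the second definition), so that the radius of curvature is
  finite.  The boundary is given by an arc-length parametrization \<open>\<sigma>\<close> of period \<open>len\<close>, the
  perimeter; its base point and its orientation are arbitrary.\<close>

definition strictly_convex_domain :: "(real^2) set \<Rightarrow> bool" where
  "strictly_convex_domain \<Omega> \<longleftrightarrow> open \<Omega> \<and> bounded \<Omega> \<and> \<Omega> \<noteq> {} \<and>
     (\<forall>x\<in>closure \<Omega>. \<forall>y\<in>closure \<Omega>. x \<noteq> y \<longrightarrow> open_segment x y \<subseteq> \<Omega>)"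

definition arclength_boundary :: "nat \<Rightarrow> (real^2) set \<Rightarrow> real \<Rightarrow> (real \<Rightarrow> real^2) \<Rightarrow> bool" where
  "arclength_boundary r \<Omega> len \<sigma> \<longleftrightarrow> len > 0 \<and> Cn r \<sigma> \<and> periodic_fun_simple \<sigma> len \<and>
     (\<forall>s. norm (vderiv 1 \<sigma> s) = 1) \<and> inj_on \<sigma> {0..<len} \<and> \<sigma> ` {0..<len} = frontier \<Omega> \<and>
     (\<forall>s. vderiv 2 \<sigma> s \<noteq> 0)"


section \<open>Billiards\<close>

text \<open>Phase points are pairs of a boundary point and an inward unit vector.  For an open strictly
  convex set with $C^1$ boundary, a vector points inward iff it leads into the set.\<close>

definition phase_space :: "(real^2) set \<Rightarrow> ((real^2) \<times> (real^2)) set" where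
  "phase_space \<Omega> = {(p, v). p \<in> frontier \<Omega> \<and> norm v = 1 \<and> (\<exists>t>0. p + t *\<^sub>R v \<in> \<Omega>)}"

definition next_collision :: "(real^2) set \<Rightarrow> (real^2) \<times> (real^2) \<Rightarrow> real^2" where
  "next_collision \<Omega> z =
     fst z + (THE t. t > 0 \<and> fst z + t *\<^sub>R snd z \<in> frontier \<Omega>) *\<^sub>R snd z"

definition unit_tangent :: "real \<Rightarrow> (real \<Rightarrow> real^2) \<Rightarrow> real^2 \<Rightarrow> real^2" where
  "unit_tangent len \<sigma> p = vderiv 1 \<sigma> (the_inv_into {0..<len} \<sigma> p)"

text \<open>The reflection keeps the tangential component of the velocity and reverses the normal one.\<close>

definition billiard_map ::
    "(real^2) set \<Rightarrow> real \<Rightarrow> (real \<Rightarrow> real^2) \<Rightarrow> (real^2) \<times> (real^2) \<Rightarrow> (real^2) \<times> (real^2)" where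
  "billiard_map \<Omega> len \<sigma> z =
     (let p' = next_collision \<Omega> z; T = unit_tangent len \<sigma> p'
      in (p', (2 * (snd z \<bullet> T)) *\<^sub>R T - snd z))"

definition periodic_point ::
    "(real^2) set \<Rightarrow> real \<Rightarrow> (real \<Rightarrow> real^2) \<Rightarrow> (real^2) \<times> (real^2) \<Rightarrow> bool" where
  "periodic_point \<Omega> len \<sigma> z \<longleftrightarrow> z \<in> phase_space \<Omega> \<and> (\<exists>n>0. (billiard_map \<Omega> len \<sigma> ^^ n) z = z)"

text \<open>The arc-length coordinates \<open>s n\<close> of the successive collision points are lifted to the line
  so that each step lies strictly between 0 and the perimeter.\<close>

definition has_rotation_number ::
    "(real^2) set \<Rightarrow> real \<Rightarrow> (real \<Rightarrow> real^2) \<Rightarrow> (real^2) \<times> (real^2) \<Rightarrow> real \<Rightarrow> bool" where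
  "has_rotation_number \<Omega> len \<sigma> z \<omega> \<longleftrightarrow> z \<in> phase_space \<Omega> \<and>
     (\<exists>s :: nat \<Rightarrow> real.
        (\<forall>n. fst ((billiard_map \<Omega> len \<sigma> ^^ n) z) = \<sigma> (s n)) \<and>
        (\<forall>n. s n < s (Suc n) \<and> s (Suc n) < s n + len) \<and>
        (\<lambda>n. (s n - s 0) / (real n * len)) \<longlonglongrightarrow> \<omega>)"

text \<open>A curve is given by a 1-periodic regular parametrization.  It is convex if it is the
  boundary of its convex hull.  Only $C^1$ smoothness is demanded.\<close>

definition smooth_convex_curve :: "(real \<Rightarrow> real^2) \<Rightarrow> bool" where
  "smooth_convex_curve c \<longleftrightarrow> Cn 1 c \<and> periodic_fun_simple c 1 \<and> inj_on c {0..<1} \<and>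
     (\<forall>u. vderiv 1 c u \<noteq> 0) \<and> range c = frontier (convex hull (range c))"

definition tangent_to_curve :: "(real \<Rightarrow> real^2) \<Rightarrow> (real^2) \<times> (real^2) \<Rightarrow> bool" where
  "tangent_to_curve c z \<longleftrightarrow>
     (\<exists>u t a. fst z + t *\<^sub>R snd z = c u \<and> vderiv 1 c u = a *\<^sub>R snd z)"

definition caustic ::
    "(real^2) set \<Rightarrow> real \<Rightarrow> (real \<Rightarrow> real^2) \<Rightarrow> (real \<Rightarrow> real^2) \<Rightarrow> bool" where
  "caustic \<Omega> len \<sigma> c \<longleftrightarrow> smooth_convex_curve c \<and> range c \<subseteq> \<Omega> \<and>
     (\<forall>z\<in>phase_space \<Omega>. tangent_to_curve c z \<longrightarrow> tangent_to_curve c (billiard_map \<Omega> len \<sigma> z))"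

text \<open>A simple closed curve in the phase annulus which winds once around it; \<open>S\<close> is a lift of the
  arc-length coordinate along the curve.\<close>

definition noncontractible_invariant_curve ::
    "(real^2) set \<Rightarrow> real \<Rightarrow> (real \<Rightarrow> real^2) \<Rightarrow> ((real^2) \<times> (real^2)) set \<Rightarrow> bool" where
  "noncontractible_invariant_curve \<Omega> len \<sigma> A \<longleftrightarrow>
     (\<exists>(S :: real \<Rightarrow> real) (V :: real \<Rightarrow> real^2).
        continuous_on UNIV S \<and> continuous_on UNIV V \<and>
        (\<forall>u. S (u + 1) = S u + len) \<and> (\<forall>u. V (u + 1) = V u) \<and>
        inj_on (\<lambda>u. (\<sigma> (S u), V u)) {0..<1} \<and> A = range (\<lambda>u. (\<sigma> (S u), V u))) \<and>
     A \<subseteq> phase_space \<Omega> \<and> billiard_map \<Omega> len \<sigma> ` A = A"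

text \<open>The two directions of travel along the tangent lines of a caustic give two invariant
  curves, with rotation numbers \<open>\<omega>\<close> and \<open>1 - \<omega>\<close>.\<close>

definition integrable_rational_caustic ::
    "(real^2) set \<Rightarrow> real \<Rightarrow> (real \<Rightarrow> real^2) \<Rightarrow> (real \<Rightarrow> real^2) \<Rightarrow> real \<Rightarrow> bool" where
  "integrable_rational_caustic \<Omega> len \<sigma> c \<omega> \<longleftrightarrow> caustic \<Omega> len \<sigma> c \<and>
     (\<exists>A. noncontractible_invariant_curve \<Omega> len \<sigma> A \<and>
        (\<forall>z\<in>A. tangent_to_curve c z \<and> periodic_point \<Omega> len \<sigma> z \<and> has_rotation_number \<Omega> len \<sigma> z \<omega>))"

definition rationally_integrable ::
    "(real^2) set \<Rightarrow> real \<Rightarrow> (real \<Rightarrow> real^2) \<Rightarrow> nat \<Rightarrow> bool" where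
  "rationally_integrable \<Omega> len \<sigma> qs \<longleftrightarrow>
     (\<forall>p q :: nat. 0 < p \<longrightarrow> 0 < q \<longrightarrow> real p / real q < 1 / real qs \<longrightarrow>
        (\<exists>c. integrable_rational_caustic \<Omega> len \<sigma> c (real p / real q)))"


section \<open>Lazutkin coordinates\<close>

definition curvature_radius :: "(real \<Rightarrow> real^2) \<Rightarrow> real \<Rightarrow> real" where
  "curvature_radius \<sigma> s = 1 / norm (vderiv 2 \<sigma> s)"

definition lazutkin_const :: "real \<Rightarrow> (real \<Rightarrow> real^2) \<Rightarrow> real" where
  "lazutkin_const len \<sigma> = 1 / integral {0..len} (\<lambda>s. curvature_radius \<sigma> s powr (- 2/3))"

text \<open>The coordinate is extended to the universal cover, as an increasing bijection of the line
  that maps \<open>s + len\<close> to \<open>x + 1\<close>; the interval integral is oriented.\<close>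

definition lazutkin_coord :: "real \<Rightarrow> (real \<Rightarrow> real^2) \<Rightarrow> real \<Rightarrow> real" where
  "lazutkin_coord len \<sigma> s =
     lazutkin_const len \<sigma> * (LBINT t=ereal 0..ereal s. curvature_radius \<sigma> t powr (- 2/3))"

definition arclength_of :: "real \<Rightarrow> (real \<Rightarrow> real^2) \<Rightarrow> real \<Rightarrow> real" where
  "arclength_of len \<sigma> = inv (lazutkin_coord len \<sigma>)"

definition lazutkin_mu :: "real \<Rightarrow> (real \<Rightarrow> real^2) \<Rightarrow> real \<Rightarrow> real" where
  "lazutkin_mu len \<sigma> x =
     1 / (2 * lazutkin_const len \<sigma> * curvature_radius \<sigma> (arclength_of len \<sigma> x) powr (1/3))"

definition Sq :: "(real \<Rightarrow> real) \<Rightarrow> nat \<Rightarrow> real \<Rightarrow> real" where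
  "Sq \<mu> q x = sin (\<mu> x / real q) / (\<mu> x / real q) - 1"

text \<open>The phase point \<open>z\<close> has Lazutkin coordinate \<open>x\<close> and its velocity makes the angle \<open>\<phi>\<close>
  with the unit tangent.\<close>

definition has_lazutkin_coords ::
    "(real^2) set \<Rightarrow> real \<Rightarrow> (real \<Rightarrow> real^2) \<Rightarrow> (real^2) \<times> (real^2) \<Rightarrow> real \<Rightarrow> real \<Rightarrow> bool" where
  "has_lazutkin_coords \<Omega> len \<sigma> z x \<phi> \<longleftrightarrow> z \<in> phase_space \<Omega> \<and>
     fst z = \<sigma> (arclength_of len \<sigma> x) \<and>
     \<phi> = arccos (snd z \<bullet> vderiv 1 \<sigma> (arclength_of len \<sigma> x))"


section \<open>Expansions of the periodic orbits\<close>

text \<open>The families \<open>ga\<close>, \<open>gb\<close>, \<open>gc\<close> are indexed first by \<open>q\<close> and then by \<open>k\<close>.\<close>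

definition orbit_x ::
    "(real \<Rightarrow> real) \<Rightarrow> (nat \<Rightarrow> nat \<Rightarrow> real \<Rightarrow> real) \<Rightarrow> nat \<Rightarrow> nat \<Rightarrow> real \<Rightarrow> real" where
  "orbit_x \<alpha> ga q k x =
     x + real k / real q + \<alpha> (x + real k / real q) / real q ^ 2 + ga q k x / real q ^ 4"

definition orbit_phi ::
    "(real \<Rightarrow> real) \<Rightarrow> (real \<Rightarrow> real) \<Rightarrow> (real \<Rightarrow> real) \<Rightarrow> (nat \<Rightarrow> nat \<Rightarrow> real \<Rightarrow> real) \<Rightarrow>
     (nat \<Rightarrow> nat \<Rightarrow> real \<Rightarrow> real) \<Rightarrow> nat \<Rightarrow> nat \<Rightarrow> real \<Rightarrow> real" where
  "orbit_phi \<mu> \<alpha> \<beta> ga gb q k x = \<mu> (orbit_x \<alpha> ga q k x) / real q *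
     (1 + \<beta> (x + real k / real q) / real q ^ 2 + gb q k x / real q ^ 4)"

definition periodic_orbit_expansions ::
    "nat \<Rightarrow> (real^2) set \<Rightarrow> real \<Rightarrow> (real \<Rightarrow> real^2) \<Rightarrow> nat \<Rightarrow> real \<Rightarrow>
     (real \<Rightarrow> real) \<Rightarrow> (real \<Rightarrow> real) \<Rightarrow> (nat \<Rightarrow> nat \<Rightarrow> real \<Rightarrow> real) \<Rightarrow>
     (nat \<Rightarrow> nat \<Rightarrow> real \<Rightarrow> real) \<Rightarrow> (nat \<Rightarrow> nat \<Rightarrow> real \<Rightarrow> real) \<Rightarrow> bool" where
  "periodic_orbit_expansions r \<Omega> len \<sigma> qs C \<alpha> \<beta> ga gb gc \<longleftrightarrow>
     (\<forall>f\<in>{\<alpha>, \<beta>}. periodic_fun_simple f 1 \<and> Cn_norm_le (r - 4) f C) \<and>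
     (\<forall>q>qs. \<forall>k<q. \<forall>f\<in>{ga q k, gb q k, gc q k}.
        periodic_fun_simple f 1 \<and> Cn_norm_le (r - 6) f C) \<and>
     (\<forall>q>qs. \<forall>x. \<exists>z :: nat \<Rightarrow> (real^2) \<times> (real^2).
        (\<forall>k<q. has_lazutkin_coords \<Omega> len \<sigma> (z k) (orbit_x \<alpha> ga q k x)
                 (orbit_phi (lazutkin_mu len \<sigma>) \<alpha> \<beta> ga gb q k x) \<and>
               billiard_map \<Omega> len \<sigma> (z k) = z (Suc k mod q)) \<and>
        has_rotation_number \<Omega> len \<sigma> (z 0) (1 / real q)) \<and>
     (\<forall>q>qs. \<forall>z. periodic_point \<Omega> len \<sigma> z \<and> has_rotation_number \<Omega> len \<sigma> z (1 / real q) \<longrightarrow>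
        (\<exists>x. has_lazutkin_coords \<Omega> len \<sigma> z (orbit_x \<alpha> ga q 0 x)
               (orbit_phi (lazutkin_mu len \<sigma>) \<alpha> \<beta> ga gb q 0 x))) \<and>
     (\<forall>q>qs. \<forall>k<q. \<forall>x.
        sin (orbit_phi (lazutkin_mu len \<sigma>) \<alpha> \<beta> ga gb q k x) / lazutkin_mu len \<sigma> (orbit_x \<alpha> ga q k x) =
        1 / real q * (1 + \<beta> (x + real k / real q) / real q ^ 2
          + Sq (lazutkin_mu len \<sigma>) q (x + real k / real q) + gc q k x / real q ^ 4))"


section \<open>The operators\<close>

definition L1_op ::
    "(real \<Rightarrow> real) \<Rightarrow> (real \<Rightarrow> real) \<Rightarrow> (real \<Rightarrow> real) \<Rightarrow> (nat \<Rightarrow> nat \<Rightarrow> real \<Rightarrow> real) \<Rightarrow>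
     (nat \<Rightarrow> nat \<Rightarrow> real \<Rightarrow> real) \<Rightarrow> nat \<Rightarrow> (real \<Rightarrow> real) \<Rightarrow> real \<Rightarrow> real" where
  "L1_op \<mu> \<alpha> \<beta> ga gc q f x = 1 / (2 * pi * real q ^ 2) *
     (\<Sum>k<q. deriv f (orbit_x \<alpha> ga q k x) *
        (1 + deriv \<alpha> (x + real k / real q) / real q ^ 2 + deriv (ga q k) x / real q ^ 4) *
        (1 + \<beta> (x + real k / real q) / real q ^ 2 + Sq \<mu> q (x + real k / real q)
           + gc q k x / real q ^ 4))"

definition L2_op ::
    "(real \<Rightarrow> real) \<Rightarrow> (real \<Rightarrow> real) \<Rightarrow> (real \<Rightarrow> real) \<Rightarrow> (nat \<Rightarrow> nat \<Rightarrow> real \<Rightarrow> real) \<Rightarrow>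
     (nat \<Rightarrow> nat \<Rightarrow> real \<Rightarrow> real) \<Rightarrow> nat \<Rightarrow> (real \<Rightarrow> real) \<Rightarrow> real \<Rightarrow> real" where
  "L2_op \<mu> \<alpha> \<beta> ga gc q f x = 1 / (2 * pi * real q ^ 2) *
     (\<Sum>k<q. f (orbit_x \<alpha> ga q k x) *
        (deriv \<beta> (x + real k / real q) / real q ^ 2 + deriv (Sq \<mu> q) (x + real k / real q)
           + deriv (gc q k) x / real q ^ 4))"

definition L_op ::
    "(real \<Rightarrow> real) \<Rightarrow> (real \<Rightarrow> real) \<Rightarrow> (real \<Rightarrow> real) \<Rightarrow> (nat \<Rightarrow> nat \<Rightarrow> real \<Rightarrow> real) \<Rightarrow>
     (nat \<Rightarrow> nat \<Rightarrow> real \<Rightarrow> real) \<Rightarrow> nat \<Rightarrow> (real \<Rightarrow> real) \<Rightarrow> real \<Rightarrow> real" where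
  "L_op \<mu> \<alpha> \<beta> ga gc q f x = L1_op \<mu> \<alpha> \<beta> ga gc q f x + L2_op \<mu> \<alpha> \<beta> ga gc q f x"


section \<open>The spaces and the operator between them\<close>

definition fourier_a :: "(real \<Rightarrow> real) \<Rightarrow> nat \<Rightarrow> real" where
  "fourier_a f k = (if k = 0 then integral {0..1} f
                    else 2 * integral {0..1} (\<lambda>x. f x * cos (2 * pi * real k * x)))"

definition fourier_b :: "(real \<Rightarrow> real) \<Rightarrow> nat \<Rightarrow> real" where
  "fourier_b f k = 2 * integral {0..1} (\<lambda>x. f x * sin (2 * pi * real k * x))"

definition X_space :: "real \<Rightarrow> (real \<Rightarrow> real) set" where
  "X_space \<gamma> = {f. continuous_on UNIV f \<and> periodic_fun_simple f 1 \<and>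
     bdd_above ((\<lambda>j. real j powr \<gamma> * max \<bar>fourier_a f j\<bar> \<bar>fourier_b f j\<bar>) ` {1..})}"

definition X_norm :: "real \<Rightarrow> (real \<Rightarrow> real) \<Rightarrow> real" where
  "X_norm \<gamma> f = max \<bar>fourier_a f 0\<bar>
     (SUP j\<in>{1..}. real j powr \<gamma> * max \<bar>fourier_a f j\<bar> \<bar>fourier_b f j\<bar>)"

text \<open>A sequence $(c_0,c_1,d_1,c_2,d_2,\dots)$ is a function \<open>c\<close> on the naturals with
  $c_j$ at position \<open>2 * j - 1\<close> and $d_j$ at position \<open>2 * j\<close>, for \<open>j \<ge> 1\<close>.\<close>

definition h_space :: "real \<Rightarrow> (nat \<Rightarrow> real) set" where
  "h_space \<gamma> = {c. bdd_above ((\<lambda>j. real j powr \<gamma> * max \<bar>c (2 * j - 1)\<bar> \<bar>c (2 * j)\<bar>) ` {1..})}"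

definition h_norm :: "real \<Rightarrow> (nat \<Rightarrow> real) \<Rightarrow> real" where
  "h_norm \<gamma> c = max \<bar>c 0\<bar>
     (SUP j\<in>{1..}. real j powr \<gamma> * max \<bar>c (2 * j - 1)\<bar> \<bar>c (2 * j)\<bar>)"

definition I_op ::
    "(real \<Rightarrow> real) \<Rightarrow> (real \<Rightarrow> real) \<Rightarrow> (real \<Rightarrow> real) \<Rightarrow> (nat \<Rightarrow> nat \<Rightarrow> real \<Rightarrow> real) \<Rightarrow>
     (nat \<Rightarrow> nat \<Rightarrow> real \<Rightarrow> real) \<Rightarrow> nat \<Rightarrow> (real \<Rightarrow> real) \<Rightarrow> nat \<Rightarrow> real" where
  "I_op \<mu> \<alpha> \<beta> ga gc qbar f n =
     (if n = 0 then fourier_a f 0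
      else let q = (n + 1) div 2 in
        if odd n then (if q < qbar then fourier_a f q
                       else L_op \<mu> \<alpha> \<beta> ga gc q f (3 / (4 * real q)))
        else (if q < qbar then fourier_b f q else L_op \<mu> \<alpha> \<beta> ga gc q f 0))"

text \<open>Bounded linear maps between normed spaces of real functions given by a carrier and a norm,
  and their invertibility as such.\<close>

definition bounded_linear_map ::
    "('i \<Rightarrow> real) set \<Rightarrow> (('i \<Rightarrow> real) \<Rightarrow> real) \<Rightarrow> ('j \<Rightarrow> real) set \<Rightarrow> (('j \<Rightarrow> real) \<Rightarrow> real) \<Rightarrow>
     (('i \<Rightarrow> real) \<Rightarrow> 'j \<Rightarrow> real) \<Rightarrow> bool" where
  "bounded_linear_map V nV W nW T \<longleftrightarrow>
     (\<forall>f\<in>V. T f \<in> W) \<and>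
     (\<forall>f\<in>V. \<forall>g\<in>V. T (\<lambda>i. f i + g i) = (\<lambda>j. T f j + T g j)) \<and>
     (\<forall>a. \<forall>f\<in>V. T (\<lambda>i. a * f i) = (\<lambda>j. a * T f j)) \<and>
     (\<exists>B. \<forall>f\<in>V. nW (T f) \<le> B * nV f)"

definition invertible_operator ::
    "('i \<Rightarrow> real) set \<Rightarrow> (('i \<Rightarrow> real) \<Rightarrow> real) \<Rightarrow> ('j \<Rightarrow> real) set \<Rightarrow> (('j \<Rightarrow> real) \<Rightarrow> real) \<Rightarrow>
     (('i \<Rightarrow> real) \<Rightarrow> 'j \<Rightarrow> real) \<Rightarrow> bool" where
  "invertible_operator V nV W nW T \<longleftrightarrow> bounded_linear_map V nV W nW T \<and>
     (\<exists>R. bounded_linear_map W nW V nV R \<and> (\<forall>f\<in>V. R (T f) = f) \<and> (\<forall>c\<in>W. T (R c) = c))"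

end

theory Submission
  imports Defs "HOL-Real_Asymp.Real_Asymp"
begin

text \<open>
  The Fourier coefficients identify $X^\gamma$ isometrically with $h^\gamma$, so the operator
  becomes an infinite matrix that acts on sequences with the weighted supremum norm with weight
  $j^\gamma$ at frequency $j$. The claim holds because this matrix differs from the identity by an
  operator of norm at most $19/20$ once the first index is large; a Neumann series then inverts it
  (\<open>near_identity_solvable\<close>, \<open>near_identity_invertible_operator\<close>).

  The rows below that index are rows of the identity. For a row of index $q$, first replace the
  collision points by the equidistant points $x + k/q$ and all weights by 1. The average of a
  trigonometric function over such points vanishes unless its frequency is a multiple of $q$. For
  the frequency $jq$, the points $x = 0$ and $x = 3/(4q)$ have the property that only one of the
  two coefficients enters, with a factor of size $j$, and for $j = 1$ it enters with factor 1 at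
  the diagonal place (\<open>unperturbed_row\<close>). Relative to the weights, the rest of the
  row contributes $\sum_{j \ge 2} j^{1-\gamma}$, which is at most $9/10$ by the choice of
  $\gamma_0$.

  It remains to see that the true row differs little from this one. At the frequency $p$ the error
  is trivially of order $p/q$, whereas the phase of the perturbed exponential moves by an amount
  of order $p/q^2$, which gives $(p/q)(p/q^2)$. This alone is too weak, because the errors have to
  be summed over all $p$ against $p^{-\gamma}$. The missing factor comes from oscillation: the
  leading perturbation is a slowly varying function of $x + k/q$, multiplied by the root of unity
  $e^{2 \pi i p k / q}$, so a single summation by parts divides its contribution by the distance
  $D$ of $p$ from the multiples of $q$. The terms with $\gamma_{a}$ and $\gamma_{c}$ are not
  functions of $x + k/q$, but they carry the factor $q^{-4}$ and are even smaller. Together the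
  error is at most a constant times $(p/q) \min (1, p/(q^2 D))$ (\<open>L_op_trig_approx\<close>).

  The sum of these errors is $o(q^{-\gamma})$ (\<open>osc_err_row_small\<close>). The frequencies
  below $q$ give $O(q^{-3} \log q)$, which is where $\gamma < 3$ enters. The larger ones are
  handled with $\min(1,y) \le y^{3/5}$, which needs $\gamma > 13/5$; this follows from the
  definition of $\gamma_0$ (\<open>gamma0_gt\<close>).

  The geometry of the domain enters through $\mu$, which is positive, bounded and has a bounded
  derivative, so that $S_q$ and its derivative are $O(q^{-2})$ (\<open>lazutkin_mu_bounds\<close>,
  \<open>Sq_bounds\<close>).
\<close>

section \<open>The real trigonometric system\<close>

text \<open>The system is indexed by the positions in the sequence space: the position
  \<open>0\<close> carries the constant 1, \<open>2 * j - 1\<close> carries $\cos 2\pi j x$ and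
  \<open>2 * j\<close> carries $\sin 2\pi j x$. Position 0 is the cosine of frequency 0, so that
  only its normalization is special.\<close>
definition freq :: "nat \<Rightarrow> nat" where
  "freq n = (n + 1) div 2"

definition trig :: "nat \<Rightarrow> real \<Rightarrow> real" where
  "trig n x = (if even n \<and> n \<noteq> 0 then sin (2 * pi * real (freq n) * x)
               else cos (2 * pi * real (freq n) * x))"

definition trig' :: "nat \<Rightarrow> real \<Rightarrow> real" where
  "trig' n x = 2 * pi * real (freq n) * (if even n \<and> n \<noteq> 0 then cos (2 * pi * real (freq n) * x)
               else - sin (2 * pi * real (freq n) * x))"

definition fcoef :: "(real \<Rightarrow> real) \<Rightarrow> nat \<Rightarrow> real" where
  "fcoef f n = (if n = 0 then 1 else 2) * integral {0..1} (\<lambda>x. f x * trig n x)"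

definition weight :: "real \<Rightarrow> nat \<Rightarrow> real" where
  "weight \<gamma> n = (if n = 0 then 1 else real (freq n) powr \<gamma>)"

lemma freq_simps [simp]: "freq 0 = 0" "freq (2 * j) = j" "j \<ge> 1 \<Longrightarrow> freq (2 * j - 1) = j"
  "j \<ge> Suc 0 \<Longrightarrow> freq (2 * j - Suc 0) = j"
  by (auto simp: freq_def)

lemma freq_eq_0 [simp]: "freq n = 0 \<longleftrightarrow> n = 0"
  unfolding freq_def by presburger

lemma freq_ge: "real (freq n) \<ge> real n / 2"
  unfolding freq_def by linarith

lemma weight_pos: "weight \<gamma> n > 0"
  by (simp add: weight_def)

lemma fourier_fcoef:
  "fourier_a f 0 = fcoef f 0"
  "j \<ge> 1 \<Longrightarrow> fourier_a f j = fcoef f (2 * j - 1)"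
  "j \<ge> 1 \<Longrightarrow> fourier_b f j = fcoef f (2 * j)"
  by (auto simp: fourier_a_def fourier_b_def fcoef_def trig_def)

lemma abs_trig_le: "\<bar>trig n x\<bar> \<le> 1"
  by (simp add: trig_def)

lemma abs_trig'_le: "\<bar>trig' n x\<bar> \<le> 2 * pi * real (freq n)"
  unfolding trig'_def abs_mult
  by (rule order_trans[OF mult_left_mono[where b=1]]) auto

lemma trig_has_derivative: "(trig n has_field_derivative trig' n x) (at x)"
proof (cases "even n \<and> n \<noteq> 0")
  case True
  then have "trig n = (\<lambda>x. sin (2 * pi * real (freq n) * x))" by (auto simp: trig_def)
  then show ?thesis using True by (auto intro!: derivative_eq_intros simp: trig'_def)
next
  case False
  then have "trig n = (\<lambda>x. cos (2 * pi * real (freq n) * x))" by (auto simp: trig_def)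
  then show ?thesis using False by (auto intro!: derivative_eq_intros simp: trig'_def)
qed

lemma continuous_on_trig [continuous_intros]: "continuous_on S (trig n)"
  by (meson DERIV_continuous_on has_field_derivative_at_within trig_has_derivative)

lemma trig_periodic: "trig n (x + 1) = trig n x"
proof -
  have "2 * pi * real (freq n) * (x + 1) = 2 * pi * real (freq n) * x + 2 * pi * real (freq n)"
    by (simp add: algebra_simps)
  moreover have "sin (y + 2 * pi * real k) = sin y" "cos (y + 2 * pi * real k) = cos y" for y k
    using sin.plus_of_nat[of y k] cos.plus_of_nat[of y k] by (simp_all add: mult_ac)
  ultimately show ?thesis by (simp add: trig_def)
qed

section \<open>Infinite matrices near the identity\<close>

text \<open>Each row of the matrix is tested against a sequence bounded by \<open>B / w\<close>;
  the weighted row sum is therefore the operator norm on the weighted supremum space.\<close>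
lemma weighted_rows:
  fixes w :: "nat \<Rightarrow> real" and A :: "nat \<Rightarrow> nat \<Rightarrow> real"
  assumes w: "\<And>n. w n > 0"
    and sm: "summable (\<lambda>m. \<bar>A n m\<bar> / w m)"
    and bd: "w n * (\<Sum>m. \<bar>A n m\<bar> / w m) \<le> \<kappa>"
    and c: "\<And>m. w m * \<bar>c m\<bar> \<le> B"
  shows "summable (\<lambda>m. A n m * c m)" and "w n * \<bar>\<Sum>m. A n m * c m\<bar> \<le> \<kappa> * B"
proof -
  have B: "B \<ge> 0" using c[of 0] w[of 0] by (meson abs_ge_zero less_imp_le mult_nonneg_nonneg order_trans)
  have le: "\<bar>A n m * c m\<bar> \<le> B * (\<bar>A n m\<bar> / w m)" for m
  proof -
    have "\<bar>c m\<bar> \<le> B / w m" using c[of m] w[of m] by (simp add: field_simps)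
    then show ?thesis
      using mult_left_mono[of "\<bar>c m\<bar>" "B / w m" "\<bar>A n m\<bar>"] by (simp add: abs_mult field_simps)
  qed
  have sm': "summable (\<lambda>m. \<bar>A n m * c m\<bar>)"
    by (rule summable_comparison_test'[OF summable_mult[OF sm, of B]]) (use le in auto)
  then show "summable (\<lambda>m. A n m * c m)" by (rule summable_rabs_cancel)
  have "\<bar>\<Sum>m. A n m * c m\<bar> \<le> (\<Sum>m. \<bar>A n m * c m\<bar>)" using sm' by (rule summable_rabs)
  also have "\<dots> \<le> (\<Sum>m. B * (\<bar>A n m\<bar> / w m))"
    by (rule suminf_le[OF le sm' summable_mult[OF sm]])
  also have "\<dots> = B * (\<Sum>m. \<bar>A n m\<bar> / w m)" using sm by (rule suminf_mult)
  finally have "w n * \<bar>\<Sum>m. A n m * c m\<bar> \<le> w n * (B * (\<Sum>m. \<bar>A n m\<bar> / w m))"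
    using w[of n] by (simp add: mult_left_mono less_imp_le)
  also have "\<dots> = B * (w n * (\<Sum>m. \<bar>A n m\<bar> / w m))" by simp
  also have "\<dots> \<le> B * \<kappa>" using bd B by (rule mult_left_mono)
  finally show "w n * \<bar>\<Sum>m. A n m * c m\<bar> \<le> \<kappa> * B" by (simp add: mult.commute)
qed

text \<open>The Neumann series, written out with the sequences \<open>e k\<close> that arise from
  \<open>d\<close> by \<open>k\<close>-fold application of \<open>- A\<close>. Their norms decay
  geometrically, so that the series converges in each component with a remainder that is uniform
  in the weighted norm, and the matrix may be applied to the sum termwise.\<close>
lemma near_identity_solvable:
  fixes w :: "nat \<Rightarrow> real" and A :: "nat \<Rightarrow> nat \<Rightarrow> real"
  assumes w: "\<And>n. w n > 0"
    and sm: "\<And>n. summable (\<lambda>m. \<bar>A n m\<bar> / w m)"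
    and bd: "\<And>n. w n * (\<Sum>m. \<bar>A n m\<bar> / w m) \<le> \<kappa>"
    and \<kappa>: "\<kappa> < 1"
    and d: "\<And>n. w n * \<bar>d n\<bar> \<le> N"
  shows "\<exists>c. (\<forall>n. w n * \<bar>c n\<bar> \<le> N / (1 - \<kappa>)) \<and> (\<forall>n. c n + (\<Sum>m. A n m * c m) = d n)"
proof -
  have \<kappa>0: "\<kappa> \<ge> 0"
    by (rule order_trans[OF _ bd[of 0]]) (intro mult_nonneg_nonneg suminf_nonneg sm; simp add: w less_imp_le)
  note rows = weighted_rows[OF w sm bd]
  define e where "e k = ((\<lambda>u n. - (\<Sum>m. A n m * u m)) ^^ k) d" for k
  have e_Suc: "e (Suc k) n = - (\<Sum>m. A n m * e k m)" for k n by (simp add: e_def)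
  have e_le: "w n * \<bar>e k n\<bar> \<le> \<kappa> ^ k * N" for k n
  proof (induction k arbitrary: n)
    case (Suc k)
    have "w n * \<bar>\<Sum>m. A n m * e k m\<bar> \<le> \<kappa> * (\<kappa> ^ k * N)" by (rule rows(2)[OF Suc])
    then show ?case by (simp add: e_Suc)
  qed (simp add: e_def d)
  have geo: "(\<lambda>k. \<kappa> ^ (k + K) * N) sums (\<kappa> ^ K * N / (1 - \<kappa>))" for K
  proof -
    have "(\<lambda>k. \<kappa> ^ k * (\<kappa> ^ K * N)) sums (1 / (1 - \<kappa>) * (\<kappa> ^ K * N))"
      using \<kappa>0 \<kappa> by (intro sums_mult2 geometric_sums) simp
    then show ?thesis by (simp add: power_add mult_ac)
  qed
  have sw: "summable (\<lambda>k. w n * e (k + K) n)" and sw_abs: "summable (\<lambda>k. \<bar>w n * e (k + K) n\<bar>)" for n K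
  proof -
    have "norm (w n * e (k + K) n) \<le> \<kappa> ^ (k + K) * N" for k
      using e_le[of n "k + K"] w[of n] by (simp add: abs_mult)
    then show "summable (\<lambda>k. \<bar>w n * e (k + K) n\<bar>)"
      by (intro summable_comparison_test'[OF sums_summable[OF geo]]) simp
    then show "summable (\<lambda>k. w n * e (k + K) n)" by (rule summable_rabs_cancel)
  qed
  have se: "summable (\<lambda>k. e k n)" for n
    using sw[of n 0] w[of n] by (simp add: summable_cmult_iff)
  define c where "c n = (\<Sum>k. e k n)" for n
  define s where "s K n = (\<Sum>k<K. e k n)" for K n
  have tail: "w n * \<bar>c n - s K n\<bar> \<le> \<kappa> ^ K * N / (1 - \<kappa>)" for K n
  proof -
    have "w n * (c n - s K n) = (\<Sum>k. w n * e (k + K) n)"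
      using suminf_minus_initial_segment[OF se, of K n] summable_iff_shift[of "\<lambda>k. e k n" K] se[of n]
      unfolding c_def s_def by (simp add: suminf_mult)
    then have "w n * \<bar>c n - s K n\<bar> = \<bar>\<Sum>k. w n * e (k + K) n\<bar>"
      using abs_mult[of "w n" "c n - s K n"] w[of n] by simp
    also have "\<dots> \<le> (\<Sum>k. \<bar>w n * e (k + K) n\<bar>)" by (rule summable_rabs[OF sw_abs])
    also have "\<dots> \<le> (\<Sum>k. \<kappa> ^ (k + K) * N)"
      using e_le w by (intro suminf_le sw_abs sums_summable[OF geo]) (auto simp: abs_mult less_imp_le)
    also have "\<dots> = \<kappa> ^ K * N / (1 - \<kappa>)" by (rule sums_unique[OF geo, symmetric])
    finally show ?thesis .
  qed
  have c_le: "w n * \<bar>c n\<bar> \<le> N / (1 - \<kappa>)" for n using tail[of n 0] by (simp add: s_def)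
  have sA: "summable (\<lambda>m. A n m * e k m)" for n k by (rule rows(1)[OF e_le])
  have As: "s K n + (\<Sum>m. A n m * s K m) = d n - e K n" for K n
  proof -
    have "(\<Sum>m. A n m * s K m) = (\<Sum>m. \<Sum>k<K. A n m * e k m)" by (simp add: s_def sum_distrib_left)
    also have "\<dots> = (\<Sum>k<K. \<Sum>m. A n m * e k m)" by (rule suminf_sum) (rule sA)
    also have "\<dots> = - (\<Sum>k<K. e (Suc k) n)" by (simp add: e_Suc sum_negf)
    finally have "s K n + (\<Sum>m. A n m * s K m) = - (\<Sum>k<K. e (Suc k) n - e k n)"
      by (simp add: s_def sum_subtractf)
    also have "\<dots> = d n - e K n" by (subst sum_lessThan_telescope) (simp add: e_def)
    finally show ?thesis .
  qed
  have eq: "c n + (\<Sum>m. A n m * c m) = d n" for n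
  proof -
    let ?r = "c n + (\<Sum>m. A n m * c m) - d n"
    have le: "w n * \<bar>?r\<bar> \<le> \<kappa> ^ K * ((1 + \<kappa>) * (N / (1 - \<kappa>)) + N)" for K
    proof -
      have sAs: "summable (\<lambda>m. A n m * s K m)"
        unfolding s_def sum_distrib_left by (intro summable_sum sA)
      have "(\<Sum>m. A n m * (c m - s K m)) = (\<Sum>m. A n m * c m) - (\<Sum>m. A n m * s K m)"
        by (subst suminf_diff[OF rows(1)[OF c_le] sAs]) (simp add: right_diff_distrib)
      then have "?r = (c n - s K n) + (\<Sum>m. A n m * (c m - s K m)) - e K n"
        using As[of K n] by simp
      then have "\<bar>?r\<bar> \<le> \<bar>c n - s K n\<bar> + \<bar>\<Sum>m. A n m * (c m - s K m)\<bar> + \<bar>e K n\<bar>" by linarith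
      then have "w n * \<bar>?r\<bar> \<le> w n * \<bar>c n - s K n\<bar> + w n * \<bar>\<Sum>m. A n m * (c m - s K m)\<bar> + w n * \<bar>e K n\<bar>"
        unfolding distrib_left[symmetric] by (intro mult_left_mono less_imp_le[OF w])
      also have "\<dots> \<le> \<kappa> ^ K * N / (1 - \<kappa>) + \<kappa> * (\<kappa> ^ K * N / (1 - \<kappa>)) + \<kappa> ^ K * N"
        by (intro add_mono tail e_le rows(2))
      also have "\<dots> = \<kappa> ^ K * ((1 + \<kappa>) * (N / (1 - \<kappa>)) + N)"
        by (simp add: algebra_simps add_divide_distrib)
      finally show ?thesis .
    qed
    have "(\<lambda>K. \<kappa> ^ K * ((1 + \<kappa>) * (N / (1 - \<kappa>)) + N)) \<longlonglongrightarrow> 0 * ((1 + \<kappa>) * (N / (1 - \<kappa>)) + N)"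
      by (intro tendsto_mult LIMSEQ_realpow_zero \<kappa>0 \<kappa> tendsto_const)
    then have "w n * \<bar>?r\<bar> \<le> 0" using LIMSEQ_le_const[of _ _ "w n * \<bar>?r\<bar>"] le by fastforce
    then show ?thesis using w[of n] by (simp add: mult_le_0_iff)
  qed
  from c_le eq show ?thesis by blast
qed

text \<open>A null vector is reproduced by \<open>- A\<close>, so each application of the row
  bound improves its bound by the factor \<open>\<kappa>\<close>.\<close>
lemma near_identity_injective:
  fixes w :: "nat \<Rightarrow> real" and A :: "nat \<Rightarrow> nat \<Rightarrow> real"
  assumes w: "\<And>n. w n > 0"
    and sm: "\<And>n. summable (\<lambda>m. \<bar>A n m\<bar> / w m)"
    and bd: "\<And>n. w n * (\<Sum>m. \<bar>A n m\<bar> / w m) \<le> \<kappa>"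
    and \<kappa>: "\<kappa> < 1"
    and c: "\<And>n. w n * \<bar>c n\<bar> \<le> B"
    and z: "\<And>n. c n + (\<Sum>m. A n m * c m) = 0"
  shows "c n = 0"
proof -
  have \<kappa>0: "\<kappa> \<ge> 0"
    by (rule order_trans[OF _ bd[of 0]]) (intro mult_nonneg_nonneg suminf_nonneg sm; simp add: w less_imp_le)
  have it: "w n * \<bar>c n\<bar> \<le> \<kappa> ^ k * B" for k n
  proof (induction k arbitrary: n)
    case (Suc k)
    have "w n * \<bar>\<Sum>m. A n m * c m\<bar> \<le> \<kappa> * (\<kappa> ^ k * B)"
      by (rule weighted_rows(2)[OF w sm bd Suc.IH])
    moreover have "\<bar>c n\<bar> = \<bar>\<Sum>m. A n m * c m\<bar>" using z[of n] by linarith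
    ultimately show ?case by simp
  qed (use c in simp)
  have "(\<lambda>k. \<kappa> ^ k * B) \<longlonglongrightarrow> 0 * B"
    by (intro tendsto_mult LIMSEQ_realpow_zero \<kappa>0 \<kappa> tendsto_const)
  then have "w n * \<bar>c n\<bar> \<le> 0 * B" by (rule LIMSEQ_le_const) (use it in blast)
  then show ?thesis using w[of n] by (simp add: mult_le_0_iff)
qed

text \<open>Linearity of the inverse follows from injectivity, so only a bounded choice of
  preimages has to be exhibited.\<close>
lemma invertible_operatorI:
  assumes T: "bounded_linear_map V nV W nW T"
    and add: "\<And>f g. f \<in> V \<Longrightarrow> g \<in> V \<Longrightarrow> (\<lambda>i. f i + g i) \<in> V"
    and scale: "\<And>a f. f \<in> V \<Longrightarrow> (\<lambda>i. a * f i) \<in> V"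
    and addW: "\<And>f g. f \<in> W \<Longrightarrow> g \<in> W \<Longrightarrow> (\<lambda>i. f i + g i) \<in> W"
    and scaleW: "\<And>a f. f \<in> W \<Longrightarrow> (\<lambda>i. a * f i) \<in> W"
    and inj: "\<And>f g. f \<in> V \<Longrightarrow> g \<in> V \<Longrightarrow> T f = T g \<Longrightarrow> f = g"
    and surj: "\<And>c. c \<in> W \<Longrightarrow> \<exists>f\<in>V. T f = c \<and> nV f \<le> K * nW c"
  shows "invertible_operator V nV W nW T"
proof -
  define R where "R c = (SOME f. f \<in> V \<and> T f = c \<and> nV f \<le> K * nW c)" for c
  have R: "R c \<in> V" "T (R c) = c" "nV (R c) \<le> K * nW c" if "c \<in> W" for c
    using someI_ex[of "\<lambda>f. f \<in> V \<and> T f = c \<and> nV f \<le> K * nW c"] surj[OF that]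
    unfolding R_def by blast+
  have Ta: "T (\<lambda>i. f i + g i) = (\<lambda>j. T f j + T g j)" if "f \<in> V" "g \<in> V" for f g
    using T that unfolding bounded_linear_map_def by blast
  have Ts: "T (\<lambda>i. a * f i) = (\<lambda>j. a * T f j)" if "f \<in> V" for a f
    using T that unfolding bounded_linear_map_def by blast
  have TW: "T f \<in> W" if "f \<in> V" for f using T that unfolding bounded_linear_map_def by blast
  have "bounded_linear_map W nW V nV R"
    unfolding bounded_linear_map_def
  proof (intro conjI ballI allI exI)
    show "R (\<lambda>i. f i + g i) = (\<lambda>j. R f j + R g j)" if "f \<in> W" "g \<in> W" for f g
      by (rule inj) (simp_all add: R that addW add Ta)
    show "R (\<lambda>i. a * f i) = (\<lambda>j. a * R f j)" if "f \<in> W" for a f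
      by (rule inj) (simp_all add: R that scaleW scale Ts)
  qed (use R in auto)
  moreover have "R (T f) = f" if "f \<in> V" for f
    by (rule inj) (simp_all add: R TW that)
  ultimately show ?thesis using T R unfolding invertible_operator_def by blast
qed

section \<open>Fourier series in the weighted spaces\<close>

lemma integral_cos_sin_int:
  fixes k :: int
  shows "((\<lambda>x. cos (2 * pi * of_int k * x)) has_integral of_bool (k = 0)) {0..1}"
    and "((\<lambda>x. sin (2 * pi * of_int k * x)) has_integral 0) {0..1::real}"
proof -
  have [simp]: "sin (2 * pi * of_int k) = 0" "cos (2 * pi * of_int k) = 1"
    using sin_int_2pin[of k] cos_int_2pin[of k] by simp_all
  show "((\<lambda>x. cos (2 * pi * of_int k * x)) has_integral of_bool (k = 0)) {0..1}"
  proof (cases "k = 0")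
    case True
    then show ?thesis using has_integral_const_real[of "1::real" 0 1] by simp
  next
    case False
    have "((\<lambda>x. cos (2 * pi * of_int k * x)) has_integral
        sin (2 * pi * of_int k * 1) / (2 * pi * of_int k) - sin (2 * pi * of_int k * 0) / (2 * pi * of_int k)) {0..1}"
      by (rule fundamental_theorem_of_calculus)
        (auto intro!: derivative_eq_intros simp: False simp flip: has_real_derivative_iff_has_vector_derivative)
    then show ?thesis using False by simp
  qed
  show "((\<lambda>x. sin (2 * pi * of_int k * x)) has_integral 0) {0..1}"
  proof (cases "k = 0")
    case False
    have "((\<lambda>x. sin (2 * pi * of_int k * x)) has_integral
        (- cos (2 * pi * of_int k * 1) / (2 * pi * of_int k)) - (- cos (2 * pi * of_int k * 0) / (2 * pi * of_int k))) {0..1}"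
      by (rule fundamental_theorem_of_calculus)
        (auto intro!: derivative_eq_intros simp: False simp flip: has_real_derivative_iff_has_vector_derivative)
    then show ?thesis using False by simp
  qed simp
qed

lemma trig_orthogonal:
  "integral {0..1} (\<lambda>x. trig m x * trig n x) = (if m = n then if n = 0 then 1 else 1 / 2 else 0)"
proof -
  note I = integral_cos_sin_int
  have diff: "2 * pi * of_int (int j - int k) * x = 2 * pi * real j * x - 2 * pi * real k * x"
    and add: "2 * pi * of_int (int j + int k) * x = 2 * pi * real j * x + 2 * pi * real k * x"
    for j k x by (simp_all add: algebra_simps)
  have z: "int j - int k = 0 \<longleftrightarrow> j = k" "int j + int k = 0 \<longleftrightarrow> j = 0 \<and> k = 0" for j k
    by auto
  have cc: "integral {0..1} (\<lambda>x. cos (2 * pi * real j * x) * cos (2 * pi * real k * x))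
      = (of_bool (j = k) + of_bool (j = 0 \<and> k = 0)) / 2" for j k
  proof (rule integral_unique)
    have "((\<lambda>x. (cos (2 * pi * of_int (int j - int k) * x) + cos (2 * pi * of_int (int j + int k) * x)) / 2)
        has_integral (of_bool (int j - int k = 0) + of_bool (int j + int k = 0)) / 2) {0..1}"
      by (intro has_integral_divide has_integral_add I)
    then show "((\<lambda>x. cos (2 * pi * real j * x) * cos (2 * pi * real k * x)) has_integral
       (of_bool (j = k) + of_bool (j = 0 \<and> k = 0)) / 2) {0..1}"
      unfolding cos_times_cos diff add z .
  qed
  have ss: "integral {0..1} (\<lambda>x. sin (2 * pi * real j * x) * sin (2 * pi * real k * x))
      = (of_bool (j = k) - of_bool (j = 0 \<and> k = 0)) / 2" for j k
  proof (rule integral_unique)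
    have "((\<lambda>x. (cos (2 * pi * of_int (int j - int k) * x) - cos (2 * pi * of_int (int j + int k) * x)) / 2)
        has_integral (of_bool (int j - int k = 0) - of_bool (int j + int k = 0)) / 2) {0..1}"
      by (intro has_integral_divide has_integral_diff I)
    then show "((\<lambda>x. sin (2 * pi * real j * x) * sin (2 * pi * real k * x)) has_integral
       (of_bool (j = k) - of_bool (j = 0 \<and> k = 0)) / 2) {0..1}"
      unfolding sin_times_sin diff add z .
  qed
  have sc: "integral {0..1} (\<lambda>x. sin (2 * pi * real j * x) * cos (2 * pi * real k * x)) = 0" for j k
  proof (rule integral_unique)
    have "((\<lambda>x. (sin (2 * pi * of_int (int j + int k) * x) + sin (2 * pi * of_int (int j - int k) * x)) / 2)
        has_integral (0 + 0) / 2) {0..1}"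
      by (intro has_integral_divide has_integral_add I)
    then show "((\<lambda>x. sin (2 * pi * real j * x) * cos (2 * pi * real k * x)) has_integral 0) {0..1}"
      unfolding sin_times_cos diff add by simp
  qed
  have inj: "m = n" if "freq m = freq n" "even m \<longleftrightarrow> even n"
    using that unfolding freq_def by presburger
  consider "even m \<and> m \<noteq> 0" "even n \<and> n \<noteq> 0" | "even m \<and> m \<noteq> 0" "\<not> (even n \<and> n \<noteq> 0)"
    | "\<not> (even m \<and> m \<noteq> 0)" "even n \<and> n \<noteq> 0" | "\<not> (even m \<and> m \<noteq> 0)" "\<not> (even n \<and> n \<noteq> 0)" by blast
  then show ?thesis
  proof cases
    case 1 then show ?thesis using inj by (auto simp: trig_def ss)
  next
    case 2 then show ?thesis unfolding trig_def using sc[of "freq m" "freq n"] by auto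
  next
    case 3 then show ?thesis unfolding trig_def
      using sc[of "freq n" "freq m"] by (subst mult.commute) auto
  next
    case 4 
    have "freq m = freq n \<longleftrightarrow> m = n"
    proof
      assume eq: "freq m = freq n"
      then have "m = 0 \<longleftrightarrow> n = 0" using freq_eq_0[of m] freq_eq_0[of n] by simp
      with 4 inj[OF eq] show "m = n" by auto
    qed simp
    moreover have "freq n = 0 \<longleftrightarrow> n = 0" by simp
    ultimately show ?thesis using 4 cc[of "freq m" "freq n"] unfolding trig_def by (auto simp del: freq_eq_0)
  qed
qed

lemma summable_weights:
  assumes "\<gamma> > 2"
  shows "summable (\<lambda>n. (1 + real (freq n)) / weight \<gamma> n)"
proof (rule summable_comparison_test')
  have "summable (\<lambda>n. real n powr (1 - \<gamma>))" using assms by (simp add: summable_real_powr_iff)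
  then show "summable (\<lambda>n. (2 * (1/2) powr (1 - \<gamma>)) * real n powr (1 - \<gamma>))" by (rule summable_mult)
  fix n :: nat assume n: "n \<ge> 1"
  then have f1: "real (freq n) \<ge> 1" using freq_eq_0[of n] by linarith
  then have "(1 + real (freq n)) / weight \<gamma> n \<le> (2 * real (freq n)) / real (freq n) powr \<gamma>"
    using n by (auto simp: weight_def intro!: divide_right_mono)
  also have "\<dots> = 2 * real (freq n) powr (1 - \<gamma>)" using f1 by (simp add: powr_diff)
  also have "\<dots> \<le> 2 * (real n / 2) powr (1 - \<gamma>)"
    using n freq_ge[of n] assms by (intro mult_left_mono powr_mono2') auto
  also have "\<dots> = (2 * (1/2) powr (1 - \<gamma>)) * real n powr (1 - \<gamma>)"
    using powr_mult[of "1/2" "real n" "1 - \<gamma>"] by simp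
  finally show "norm ((1 + real (freq n)) / weight \<gamma> n) \<le> (2 * (1/2) powr (1 - \<gamma>)) * real n powr (1 - \<gamma>)"
    using weight_pos[of \<gamma> n] by simp
qed

text \<open>For $\gamma > 2$ the weights dominate one derivative: the series and its derivative
  both have the summable majorant \<open>M\<close>, and the coefficients of the sum are read off
  termwise by orthogonality.\<close>
lemma trig_series:
  assumes \<gamma>: "\<gamma> > 2" and c: "\<And>n. weight \<gamma> n * \<bar>c n\<bar> \<le> B"
  shows "summable (\<lambda>n. c n * trig n x)" and "summable (\<lambda>n. c n * trig' n x)"
    and "((\<lambda>x. \<Sum>n. c n * trig n x) has_field_derivative (\<Sum>n. c n * trig' n x)) (at x)"
    and "fcoef (\<lambda>x. \<Sum>n. c n * trig n x) k = c k"
proof -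
  define M where "M n = (2 * pi * B) * ((1 + real (freq n)) / weight \<gamma> n)" for n
  have M: "summable M" unfolding M_def by (intro summable_mult summable_weights \<gamma>)
  have B: "B \<ge> 0" using c[of 0] by (simp add: weight_def)
  have le1: "\<bar>c n\<bar> * (1 + real (freq n)) * (2 * pi) \<le> M n" for n
  proof -
    have "\<bar>c n\<bar> \<le> B / weight \<gamma> n" using c[of n] weight_pos[of \<gamma> n] by (simp add: field_simps)
    then have "\<bar>c n\<bar> * ((1 + real (freq n)) * (2 * pi)) \<le> B / weight \<gamma> n * ((1 + real (freq n)) * (2 * pi))"
      by (rule mult_right_mono) simp
    then show ?thesis by (simp add: M_def mult_ac)
  qed
  have le: "\<bar>c n * t\<bar> \<le> M n" if "\<bar>t\<bar> \<le> (1 + real (freq n)) * (2 * pi)" for n t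
    using order_trans[OF mult_left_mono[OF that, of "\<bar>c n\<bar>"], of "M n"] le1[of n] by (simp add: abs_mult mult.assoc)
  have t1: "\<bar>t\<bar> \<le> (1 + real (freq n)) * (2 * pi)" if "\<bar>t\<bar> \<le> 1" for t n
  proof -
    have "1 * 1 \<le> (1 + real (freq n)) * (2 * pi)"
      using pi_gt3 by (intro mult_mono) linarith+
    with that show ?thesis by linarith
  qed
  have le_trig: "norm (c n * trig n x) \<le> M n" for n x
    using le[OF t1[OF abs_trig_le]] by simp
  have le_trig': "norm (c n * trig' n x) \<le> M n" for n x
  proof -
    have "\<bar>trig' n x\<bar> \<le> (1 + real (freq n)) * (2 * pi)"
      by (rule order_trans[OF abs_trig'_le]) (simp add: algebra_simps)
    from le[OF this] show ?thesis by simp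
  qed
  show s: "summable (\<lambda>n. c n * trig n x)" for x
    by (rule summable_comparison_test'[OF M le_trig])
  show "summable (\<lambda>n. c n * trig' n x)"
    by (rule summable_comparison_test'[OF M le_trig'])
  have uc: "uniformly_convergent_on UNIV (\<lambda>n x. \<Sum>i<n. c i * trig' i x)"
    by (rule Weierstrass_m_test'[OF le_trig' M])
  show "((\<lambda>x. \<Sum>n. c n * trig n x) has_field_derivative (\<Sum>n. c n * trig' n x)) (at x)"
    by (rule has_field_derivative_series'(2)[OF convex_UNIV _ uc UNIV_I s])
      (auto intro!: DERIV_cmult trig_has_derivative)
  have "uniform_limit {0..1} (\<lambda>N x. \<Sum>n<N. c n * trig n x * trig k x) (\<lambda>x. \<Sum>n. c n * trig n x * trig k x) sequentially"
  proof (rule Weierstrass_m_test[OF _ M])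
    fix n x
    have "\<bar>trig n x * trig k x\<bar> \<le> 1"
      unfolding abs_mult using mult_mono[OF abs_trig_le abs_trig_le] by (metis abs_ge_zero mult_1 zero_le_one)
    then show "norm (c n * trig n x * trig k x) \<le> M n"
      using le[OF t1] by (simp add: mult.assoc)
  qed
  then obtain I J where I: "\<And>N. ((\<lambda>x. \<Sum>n<N. c n * trig n x * trig k x) has_integral I N) {0..1}"
    and J: "((\<lambda>x. \<Sum>n. c n * trig n x * trig k x) has_integral J) {0..1}" and IJ: "I \<longlonglongrightarrow> J"
    by (rule uniform_limit_integral) (auto intro!: continuous_intros)
  have "I N = (\<Sum>n<N. c n * integral {0..1} (\<lambda>x. trig n x * trig k x))" for N
    using integral_unique[OF I[of N]]
    by (subst (asm) integral_sum)
      (auto intro!: integrable_continuous_real continuous_intros simp: mult.assoc)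
  also have "\<dots> N = (if k < N then c k * (if k = 0 then 1 else 1 / 2) else 0)" for N
    by (simp add: trig_orthogonal if_distrib[of "\<lambda>x. _ * x"] cong: if_cong)
  finally have "I N = (if k < N then c k * (if k = 0 then 1 else 1 / 2) else 0)" for N .
  then have "I \<longlonglongrightarrow> c k * (if k = 0 then 1 else 1 / 2)"
    by (intro tendsto_eventually eventually_sequentiallyI[of "Suc k"]) auto
  then have "J = c k * (if k = 0 then 1 else 1 / 2)" using IJ by (rule LIMSEQ_unique[symmetric])
  moreover have "(\<Sum>n. c n * trig n x) * trig k x = (\<Sum>n. c n * trig n x * trig k x)" for x
    by (rule suminf_mult2[OF s])
  ultimately show "fcoef (\<lambda>x. \<Sum>n. c n * trig n x) k = c k"
    using integral_unique[OF J] by (simp add: fcoef_def)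
qed

text \<open>The even part of \<open>D\<close> is a continuous function of $t = \cos 2\pi x$ on
  $[-1,1]$. By the Weierstrass theorem it is a uniform limit of polynomials in $\cos 2\pi x$, to
  which it is orthogonal; hence it is orthogonal to itself.\<close>
lemma even_part_zero:
  fixes D :: "real \<Rightarrow> real"
  assumes cont: "continuous_on UNIV D" and per: "\<And>x. D (x + 1) = D x"
    and orth: "\<And>k::nat. integral {0..1} (\<lambda>x. D x * cos (2 * pi * real k * x)) = 0"
    and x: "x \<in> {0..1}"
  shows "D x + D (- x) = 0"
proof -
  note cont' [continuous_intros] = continuous_on_compose2[OF cont _ subset_UNIV]
  have int [intro!]: "h integrable_on {0..1}" if "continuous_on {0..1} h" for h :: "real \<Rightarrow> real"
    using that by (rule integrable_continuous_real)
  have pow: "integral {0..1} (\<lambda>x. D x * cos (2 * pi * x) ^ n * cos (2 * pi * real k * x)) = 0" for n k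
  proof (induction n arbitrary: k)
    case 0
    then show ?case using orth by simp
  next
    case (Suc n)
    let ?f = "\<lambda>k x. D x * cos (2 * pi * x) ^ n * cos (2 * pi * real k * x)"
    show ?case
    proof (cases k)
      case 0
      then show ?thesis using Suc[of 1] by (simp add: mult_ac)
    next
      case (Suc j)
      have "D x * cos (2 * pi * x) ^ Suc n * cos (2 * pi * real k * x) = (?f j x + ?f (Suc k) x) / 2" for x
      proof -
        have "cos (2 * pi * x) * cos (2 * pi * real k * x)
            = (cos (2 * pi * real j * x) + cos (2 * pi * real (Suc k) * x)) / 2"
          unfolding mult.commute[of "cos (2 * pi * x)"] cos_times_cos Suc
          by (simp add: algebra_simps)
        then have "D x * cos (2 * pi * x) ^ n * (cos (2 * pi * x) * cos (2 * pi * real k * x))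
            = D x * cos (2 * pi * x) ^ n * ((cos (2 * pi * real j * x) + cos (2 * pi * real (Suc k) * x)) / 2)"
          by (rule arg_cong)
        then show ?thesis by (simp add: algebra_simps add_divide_distrib)
      qed
      then have "integral {0..1} (\<lambda>x. D x * cos (2 * pi * x) ^ Suc n * cos (2 * pi * real k * x))
         = (integral {0..1} (?f j) + integral {0..1} (?f (Suc k))) / 2"
        by (subst integral_add[symmetric])
          (auto intro!: continuous_intros simp only: integral_divide)
      then show ?thesis by (simp only: Suc.IH) simp
    qed
  qed
  define E where "E x = D x + D (- x)" for x
  have contE: "continuous_on S E" for S unfolding E_def by (auto intro!: continuous_intros)
  define g where "g t = E (arccos t / (2 * pi))" for t
  have contg: "continuous_on {-1..1} g"
    unfolding g_def
    by (rule continuous_on_compose2[OF contE[of UNIV]]) (auto intro!: continuous_intros)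
  have gE: "g (cos (2 * pi * x)) = E x" if "x \<in> {0..1}" for x
  proof (cases "x \<le> 1/2")
    case True
    then have "arccos (cos (2 * pi * x)) = 2 * pi * x" using that by (intro arccos_cos) auto
    then show ?thesis by (simp add: g_def)
  next
    case False
    have "cos (2 * pi * x) = cos (2 * pi * (1 - x))"
      using cos_2pi_minus[of "2 * pi * x"] by (simp add: algebra_simps)
    moreover have "arccos (cos (2 * pi * (1 - x))) = 2 * pi * (1 - x)"
      using that False by (intro arccos_cos) (auto simp: mult_le_cancel_left1)
    ultimately have "g (cos (2 * pi * x)) = E (1 - x)" by (simp add: g_def)
    also have "\<dots> = E x" using per[of "- x"] per[of "x - 1"] by (simp add: E_def)
    finally show ?thesis .
  qed
  have orthp: "integral {0..1} (\<lambda>x. E x * p (cos (2 * pi * x))) = 0"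
    if p: "real_polynomial_function p" for p :: "real \<Rightarrow> real"
  proof -
    from p obtain a n where pa: "p = (\<lambda>x. \<Sum>i\<le>n. a i * x ^ i)"
      unfolding real_polynomial_function_iff_sum by blast
    have contp: "continuous_on S p" for S by (simp add: pa continuous_intros)
    have cpc: "continuous_on S (\<lambda>x. p (cos (2 * pi * x)))" for S
      by (rule continuous_on_compose2[OF contp[of UNIV]]) (auto intro!: continuous_intros)
    define h where "h x = D x * p (cos (2 * pi * x))" for x
    have hint: "h integrable_on {0..1}" unfolding h_def by (auto intro!: continuous_intros cpc)
    have "h x = (\<Sum>i\<le>n. a i * (D x * cos (2 * pi * x) ^ i * cos (2 * pi * real 0 * x)))" for x
      by (simp add: h_def pa sum_distrib_left mult_ac)
    then have "integral {0..1} h = (\<Sum>i\<le>n. integral {0..1} (\<lambda>x. a i * (D x * cos (2 * pi * x) ^ i * cos (2 * pi * real 0 * x))))"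
      by (subst ext[of h "\<lambda>x. \<Sum>i\<le>n. a i * (D x * cos (2 * pi * x) ^ i * cos (2 * pi * real 0 * x))"])
        (auto intro!: integral_sum continuous_intros simp only:)
    also have "\<dots> = 0" using pow[of _ 0] by (intro sum.neutral ballI) simp
    finally have h0: "(h has_integral 0) {0..1}" using hint by (metis integrable_integral)
    have "((\<lambda>x. h (- x + 1)) has_integral 0) {0..1}"
      using has_integral_affinity[of h 0 0 1 "-1" 1] h0 by simp
    moreover have "h (- x + 1) = D (- x) * p (cos (2 * pi * x))" for x
      using per[of "- x"] cos_2pi_minus[of "2 * pi * x"] by (simp add: h_def algebra_simps)
    ultimately have "((\<lambda>x. h x + D (- x) * p (cos (2 * pi * x))) has_integral 0 + 0) {0..1}"
      using h0 by (intro has_integral_add) auto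
    then have "((\<lambda>x. E x * p (cos (2 * pi * x))) has_integral 0) {0..1}"
      by (simp add: h_def E_def algebra_simps)
    then show ?thesis by (rule integral_unique)
  qed
  have "compact (E ` {0..1})" by (rule compact_continuous_image[OF contE]) simp
  from compact_imp_bounded[OF this] obtain M where "\<forall>y\<in>E ` {0..1}. norm y \<le> M"
    unfolding bounded_iff by blast
  then have M: "\<bar>E x\<bar> \<le> M" if "x \<in> {0..1}" for x using that by auto
  have M0: "M \<ge> 0" using M[of 0] by simp
  have le: "integral {0..1} (\<lambda>x. E x * E x) \<le> M * e" if e: "e > 0" for e
  proof -
    obtain p where p: "real_polynomial_function p" and ap: "\<And>t. t \<in> {-1..1} \<Longrightarrow> \<bar>g t - p t\<bar> < e"
      using Stone_Weierstrass_real_polynomial_function[OF compact_Icc contg e] by blast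
    have contp: "continuous_on S p" for S using p
      by (auto simp: real_polynomial_function_iff_sum intro!: continuous_intros)
    have cpc: "continuous_on S (\<lambda>x. p (cos (2 * pi * x)))" for S
      by (rule continuous_on_compose2[OF contp[of UNIV]]) (auto intro!: continuous_intros)
    have "integral {0..1} (\<lambda>x. E x * E x)
        = integral {0..1} (\<lambda>x. E x * E x) - integral {0..1} (\<lambda>x. E x * p (cos (2 * pi * x)))"
      by (simp add: orthp[OF p])
    also have "\<dots> = integral {0..1} (\<lambda>x. E x * E x - E x * p (cos (2 * pi * x)))"
      by (intro integral_diff[symmetric]) (auto intro!: continuous_intros contE cpc)
    also have "\<dots> \<le> integral {0..1} (\<lambda>x::real. M * e)"
    proof (rule integral_le)
      fix x :: real assume x: "x \<in> {0..1}"
      have "\<bar>E x - p (cos (2 * pi * x))\<bar> \<le> e"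
        using ap[of "cos (2 * pi * x)"] gE[OF x] by simp
      then have "\<bar>E x\<bar> * \<bar>E x - p (cos (2 * pi * x))\<bar> \<le> M * e"
        using M[OF x] by (intro mult_mono) (auto simp: M0)
      then show "E x * E x - E x * p (cos (2 * pi * x)) \<le> M * e"
        by (simp add: abs_mult[symmetric] right_diff_distrib)
    qed (auto intro!: continuous_intros contE cpc)
    finally show ?thesis by simp
  qed
  have "integral {0..1} (\<lambda>x. E x * E x) \<le> 0"
  proof (rule field_le_epsilon)
    fix e :: real assume "e > 0"
    moreover from this have "M * (e / (M + 1)) \<le> e" using M0 by (simp add: field_simps)
    ultimately show "integral {0..1} (\<lambda>x. E x * E x) \<le> 0 + e"
      using le[of "e / (M + 1)"] M0 by simp
  qed
  moreover have "integral {0..1} (\<lambda>x. E x * E x) \<ge> 0"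
    by (rule integral_nonneg) (auto intro!: continuous_intros contE)
  ultimately have "\<forall>x\<in>{0..1}. E x * E x = 0"
    by (subst integral_eq_0_iff[symmetric]) (auto intro!: continuous_intros contE)
  then show ?thesis using x by (simp add: E_def)
qed

text \<open>Uniqueness of Fourier coefficients. The odd part of \<open>D\<close> is reached by
  applying the statement on even parts to $D(x) \sin 2\pi x$, whose cosine coefficients are
  combinations of sine coefficients of \<open>D\<close>: the two conclusions $D(x) + D(-x) = 0$
  and $\sin (2\pi x)(D(x) - D(-x)) = 0$ leave only the zeros of the sine, where continuity
  decides.\<close>
lemma fcoef_zero_imp_zero:
  fixes D :: "real \<Rightarrow> real"
  assumes cont: "continuous_on UNIV D" and per: "periodic_fun_simple D 1"
    and zero: "\<And>n. fcoef D n = 0"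
  shows "D x = 0"
proof -
  interpret periodic_fun_simple D 1 by (rule per)
  have int [intro!]: "h integrable_on {0..1}" if "continuous_on {0..1} h" for h :: "real \<Rightarrow> real"
    using that by (rule integrable_continuous_real)
  have contD: "continuous_on S D" for S using cont continuous_on_subset by blast
  have cos0: "integral {0..1} (\<lambda>x. D x * cos (2 * pi * real k * x)) = 0" for k
    using zero[of 0] zero[of "2 * k - 1"] fourier_fcoef(1)[of D] fourier_fcoef(2)[of k D]
    by (cases "k = 0") (auto simp: fourier_a_def)
  have sin0: "integral {0..1} (\<lambda>x. D x * sin (2 * pi * real k * x)) = 0" for k
    using zero[of "2 * k"] fourier_fcoef(3)[of k D]
    by (cases "k = 0") (auto simp: fourier_b_def)
  define D2 where "D2 x = D x * sin (2 * pi * x)" for x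
  have D2: "integral {0..1} (\<lambda>x. D2 x * cos (2 * pi * real k * x)) = 0" for k
  proof (cases k)
    case 0
    then show ?thesis using sin0[of 1] by (simp add: D2_def)
  next
    case (Suc j)
    let ?f = "\<lambda>k x. D x * sin (2 * pi * real k * x)"
    have "D2 x * cos (2 * pi * real k * x) = (?f (Suc k) x - ?f j x) / 2" for x
    proof -
      have eq: "2 * pi * x + 2 * pi * real k * x = 2 * pi * real (Suc k) * x"
        "2 * pi * x - 2 * pi * real k * x = - (2 * pi * real j * x)"
        by (simp_all add: Suc algebra_simps)
      have "sin (2 * pi * x) * cos (2 * pi * real k * x)
          = (sin (2 * pi * real (Suc k) * x) - sin (2 * pi * real j * x)) / 2"
        unfolding sin_times_cos eq by simp
      then have "D x * (sin (2 * pi * x) * cos (2 * pi * real k * x))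
          = D x * ((sin (2 * pi * real (Suc k) * x) - sin (2 * pi * real j * x)) / 2)"
        by (rule arg_cong)
      then show ?thesis by (simp add: D2_def algebra_simps diff_divide_distrib)
    qed
    then have "integral {0..1} (\<lambda>x. D2 x * cos (2 * pi * real k * x))
        = (integral {0..1} (?f (Suc k)) - integral {0..1} (?f j)) / 2"
      by (subst integral_diff[symmetric])
        (auto intro!: continuous_intros contD simp only: integral_divide)
    then show ?thesis by (simp only: sin0) simp
  qed
  have sinD: "sin (2 * pi * x) * D x = 0" if x: "x \<in> {0..1}" for x
  proof -
    have "D x + D (- x) = 0" by (rule even_part_zero[OF cont plus_period cos0 x])
    moreover have "D2 x + D2 (- x) = 0"
    proof (rule even_part_zero[OF _ _ D2 x])
      show "D2 (x + 1) = D2 x" for x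
        using sin.plus_1[of "2 * pi * x"] by (simp add: D2_def plus_period distrib_left)
    qed (auto simp: D2_def[abs_def] intro!: continuous_intros contD)
    ultimately show ?thesis by (simp add: D2_def add_eq_0_iff algebra_simps)
  qed
  have sin_ne: "sin (2 * pi * x) \<noteq> 0" if "0 < x" "x < 1/2 \<or> 1/2 < x" "x < 1" for x
  proof
    assume "sin (2 * pi * x) = 0"
    then obtain i :: int where "2 * pi * x = of_int i * pi" unfolding sin_zero_iff_int2 by blast
    then have i: "2 * x = of_int i" by simp
    have "real_of_int i > 0" "real_of_int i < 2" using that i by linarith+
    then have "0 < i" "i < 2" by simp_all
    then have "i = 1" by simp
    with i have "x = 1 / 2" by simp
    with that show False by simp
  qed
  have D0: "D x = 0" if "0 < x" "x < 1/2 \<or> 1/2 < x" "x < 1" for x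
    using sinD[of x] sin_ne[OF that] that by auto
  have "D x = 0" if "x \<in> closure {0<..<1/2}" for x
    by (rule continuous_constant_on_closure[OF contD _ that]) (rule D0, auto)
  moreover have "D x = 0" if "x \<in> closure {1/2<..<1}" for x
    by (rule continuous_constant_on_closure[OF contD _ that]) (rule D0, auto)
  ultimately have "D x = 0" if "x \<in> {0..1}" for x using that by fastforce
  moreover have "frac x \<in> {0..1}" by (simp add: frac_lt_1 less_imp_le)
  ultimately have "D (frac x) = 0" by blast
  moreover have "D x = D (frac x)" using plus_of_int[of "frac x" "\<lfloor>x\<rfloor>"] by (simp add: frac_def)
  ultimately show ?thesis by simp
qed

lemma h_spaceD:
  assumes "c \<in> h_space \<gamma>"
  shows "weight \<gamma> n * \<bar>c n\<bar> \<le> h_norm \<gamma> c"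
proof (cases "n = 0")
  case True
  then show ?thesis by (simp add: weight_def h_norm_def)
next
  case False
  define j where "j = freq n"
  have j: "j \<ge> 1" using False freq_eq_0[of n] unfolding j_def by linarith
  have "n = 2 * j - 1 \<or> n = 2 * j" unfolding j_def freq_def using False by presburger
  then have "weight \<gamma> n * \<bar>c n\<bar> \<le> real j powr \<gamma> * max \<bar>c (2 * j - 1)\<bar> \<bar>c (2 * j)\<bar>"
    using False by (auto simp: weight_def j_def intro!: mult_left_mono)
  also have "\<dots> \<le> (SUP j\<in>{1..}. real j powr \<gamma> * max \<bar>c (2 * j - 1)\<bar> \<bar>c (2 * j)\<bar>)"
    using assms j unfolding h_space_def by (intro cSUP_upper) auto
  finally show ?thesis by (simp add: h_norm_def)
qed

lemma h_spaceI:
  assumes "\<And>n. weight \<gamma> n * \<bar>c n\<bar> \<le> B"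
  shows "c \<in> h_space \<gamma>" and "h_norm \<gamma> c \<le> B"
proof -
  have le: "real j powr \<gamma> * max \<bar>c (2 * j - 1)\<bar> \<bar>c (2 * j)\<bar> \<le> B" if "j \<in> {1..}" for j
    using assms[of "2 * j - 1"] assms[of "2 * j"] that by (auto simp: weight_def max_def)
  then show "c \<in> h_space \<gamma>" unfolding h_space_def by (auto intro!: bdd_aboveI2)
  show "h_norm \<gamma> c \<le> B"
    unfolding h_norm_def using assms[of 0] le by (auto intro!: cSUP_least simp: weight_def)
qed

lemma X_space_iff:
  "f \<in> X_space \<gamma> \<longleftrightarrow> continuous_on UNIV f \<and> periodic_fun_simple f 1 \<and> fcoef f \<in> h_space \<gamma>"
  by (simp add: X_space_def h_space_def fourier_fcoef cong: image_cong_simp)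

lemma X_norm_eq: "X_norm \<gamma> f = h_norm \<gamma> (fcoef f)"
  by (simp add: X_norm_def h_norm_def fourier_fcoef cong: image_cong_simp)

lemma synthesis_in_X_space:
  assumes \<gamma>: "\<gamma> > 2" and c: "c \<in> h_space \<gamma>"
  shows "(\<lambda>x. \<Sum>n. c n * trig n x) \<in> X_space \<gamma>" and "fcoef (\<lambda>x. \<Sum>n. c n * trig n x) = c"
proof -
  note ser = trig_series[OF \<gamma> h_spaceD[OF c]]
  show f: "fcoef (\<lambda>x. \<Sum>n. c n * trig n x) = c" using ser(4) by blast
  have "continuous_on UNIV (\<lambda>x. \<Sum>n. c n * trig n x)"
    using DERIV_isCont[OF ser(3)] by (intro continuous_at_imp_continuous_on) blast
  moreover have "periodic_fun_simple (\<lambda>x. \<Sum>n. c n * trig n x) 1"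
    by unfold_locales (simp add: trig_periodic)
  ultimately show "(\<lambda>x. \<Sum>n. c n * trig n x) \<in> X_space \<gamma>"
    using f c by (simp add: X_space_iff)
qed

text \<open>The sum of the Fourier series of \<open>f\<close> lies in the space and has the same
  coefficients as \<open>f\<close>, so uniqueness identifies them.\<close>
lemma X_space_expansion:
  assumes \<gamma>: "\<gamma> > 2" and f: "f \<in> X_space \<gamma>"
  shows "f = (\<lambda>x. \<Sum>n. fcoef f n * trig n x)"
proof
  fix x
  let ?g = "\<lambda>x. \<Sum>n. fcoef f n * trig n x"
  have fh: "fcoef f \<in> h_space \<gamma>" using f by (simp add: X_space_iff)
  note g = synthesis_in_X_space[OF \<gamma> fh]
  have contf: "continuous_on S f" and contg: "continuous_on S ?g" for S
    using f g(1) continuous_on_subset by (auto simp: X_space_iff)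
  have "f x - ?g x = 0"
  proof (rule fcoef_zero_imp_zero[of "\<lambda>x. f x - ?g x"])
    show "periodic_fun_simple (\<lambda>x. f x - ?g x) 1"
      using f g(1) by (simp add: X_space_iff periodic_fun_simple_def)
    fix n
    have "fcoef (\<lambda>x. f x - ?g x) n = fcoef f n - fcoef ?g n"
    proof -
      have "integral {0..1} (\<lambda>x. (f x - ?g x) * trig n x)
          = integral {0..1} (\<lambda>x. f x * trig n x) - integral {0..1} (\<lambda>x. ?g x * trig n x)"
        unfolding left_diff_distrib
        by (intro integral_diff integrable_continuous_real continuous_on_mult contf contg continuous_on_trig)
      then show ?thesis by (simp only: fcoef_def right_diff_distrib)
    qed
    then show "fcoef (\<lambda>x. f x - ?g x) n = 0" using g(2) by simp
  qed (intro continuous_intros contf contg)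
  then show "f x = ?g x" by simp
qed

section \<open>The function $\mu$ and the correction $S_q$\<close>

lemma vderiv_Suc: "vderiv (Suc n) f t = vector_derivative (vderiv n f) (at t)"
  by (simp add: vderiv_def)

lemma Cn_vderiv:
  assumes "Cn r f" "n < r"
  shows "(vderiv n f has_vector_derivative vderiv (Suc n) f t) (at t)"
  using assms unfolding Cn_def vderiv_Suc by (simp add: vector_derivative_works)

lemma vderiv_periodic:
  assumes f: "Cn r f" and per: "\<And>t. f (t + p) = f t" and "n \<le> r"
  shows "vderiv n f (t + p) = vderiv n f t"
  using \<open>n \<le> r\<close>
proof (induction n arbitrary: t)
  case 0
  then show ?case by (simp add: vderiv_def per)
next
  case (Suc n)
  have "((vderiv n f \<circ> (\<lambda>t. t + p)) has_vector_derivative (1 *\<^sub>R vderiv (Suc n) f (t + p))) (at t)"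
    by (rule vector_diff_chain_at)
      (use Suc in \<open>auto intro!: derivative_eq_intros Cn_vderiv[OF f]\<close>)
  moreover have "vderiv n f \<circ> (\<lambda>t. t + p) = vderiv n f" using Suc by (auto simp: fun_eq_iff)
  ultimately have "(vderiv n f has_vector_derivative vderiv (Suc n) f (t + p)) (at t)" by simp
  moreover have "(vderiv n f has_vector_derivative vderiv (Suc n) f t) (at t)"
    using Suc.prems by (intro Cn_vderiv[OF f]) simp
  ultimately show ?case by (rule vector_derivative_unique_at)
qed

lemma periodic_reduce:
  fixes g :: "real \<Rightarrow> 'a"
  assumes "p > 0" "\<And>t. g (t + p) = g t"
  obtains t' where "t' \<in> {0..p}" "g t' = g t"
proof
  interpret periodic_fun_simple g p by unfold_locales (rule assms(2))
  have "t - of_int \<lfloor>t / p\<rfloor> * p = p * frac (t / p)"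
    using \<open>p > 0\<close> by (simp add: frac_def algebra_simps)
  moreover have "0 \<le> frac (t / p)" "frac (t / p) \<le> 1" by (auto simp: frac_lt_1 less_imp_le)
  ultimately show "t - of_int \<lfloor>t / p\<rfloor> * p \<in> {0..p}"
    using \<open>p > 0\<close> by (simp add: mult_left_le)
  show "g (t - of_int \<lfloor>t / p\<rfloor> * p) = g t" by (rule minus_of_int)
qed

lemma periodic_continuous_bounded:
  fixes g :: "real \<Rightarrow> 'a::real_normed_vector"
  assumes p: "p > 0" "\<And>t. g (t + p) = g t" and cont: "continuous_on UNIV g"
  obtains B where "\<And>t. norm (g t) \<le> B"
proof -
  have "compact (g ` {0..p})"
    by (rule compact_continuous_image[OF continuous_on_subset[OF cont]]) auto
  from compact_imp_bounded[OF this] obtain B where B: "\<forall>y\<in>g ` {0..p}. norm y \<le> B"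
    unfolding bounded_iff by blast
  have "norm (g t) \<le> B" for t
  proof -
    obtain t' where "t' \<in> {0..p}" "g t' = g t" using periodic_reduce[of p g, OF p] .
    then show ?thesis using B by (metis imageI)
  qed
  then show ?thesis by (rule that)
qed

text \<open>The Lazutkin coordinate has a derivative that is bounded below by a positive constant.
  It is therefore a bijection of the line, and its inverse is differentiable.\<close>
lemma lazutkin_coord_inverse:
  fixes w :: "real \<Rightarrow> real"
  assumes cont: "continuous_on UNIV w" and m: "m > 0" "\<And>t. m \<le> w t" and C: "C > 0"
    and X: "X = (\<lambda>s. C * (LBINT t=ereal 0..ereal s. w t))"
  shows "(inv X has_real_derivative inverse (C * w (inv X x))) (at x)"
proof -
  have dX: "(X has_real_derivative C * w s) (at s)" for s
  proof -
    define a where "a = - (\<bar>s\<bar> + 1)"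
    define b where "b = \<bar>s\<bar> + 1"
    have ab: "a \<le> 0" "0 \<le> b" "a < s" "s < b" by (auto simp: a_def b_def)
    have "((\<lambda>u. LBINT y=ereal 0..ereal u. w y) has_vector_derivative w s) (at s within {a..b})"
      using ab by (intro interval_integral_FTC2 continuous_on_subset[OF cont]) auto
    then have "((\<lambda>u. LBINT y=ereal 0..ereal u. w y) has_real_derivative w s) (at s)"
      using ab by (simp add: at_within_Icc_at has_real_derivative_iff_has_vector_derivative)
    then show ?thesis unfolding X by (rule DERIV_cmult)
  qed
  define \<delta> where "\<delta> = C * m"
  have \<delta>: "\<delta> > 0" "\<And>s. \<delta> \<le> C * w s" using m C by (auto simp: \<delta>_def)
  have X0: "X 0 = 0" by (simp add: X)
  have mono: "X s - \<delta> * s \<le> X t - \<delta> * t" if "s \<le> t" for s t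
    by (rule DERIV_nonneg_imp_nondecreasing[OF that])
      (use \<delta>(2) in \<open>fastforce intro!: derivative_eq_intros dX\<close>)
  have strict: "X s < X t" if "s < t" for s t
    using mono[of s t] that mult_strict_left_mono[OF that \<delta>(1)] by simp
  have "inj X" by (rule injI) (metis linorder_neqE_linordered_idom order_less_irrefl strict)
  have "\<exists>s. X s = y" for y
  proof -
    have "X (- \<bar>y\<bar> / \<delta>) \<le> y" "y \<le> X (\<bar>y\<bar> / \<delta>)"
      using mono[of "- \<bar>y\<bar> / \<delta>" 0] mono[of 0 "\<bar>y\<bar> / \<delta>"] \<delta>(1) by (simp_all add: X0)
    moreover have "- \<bar>y\<bar> / \<delta> \<le> \<bar>y\<bar> / \<delta>" using \<delta>(1) by (simp add: divide_right_mono)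
    ultimately show ?thesis using IVT[of X "- \<bar>y\<bar> / \<delta>" y "\<bar>y\<bar> / \<delta>"] DERIV_isCont[OF dX] by blast
  qed
  then have inv: "X (inv X y) = y" for y by (metis surjI surj_f_inv_f surj_def)
  have "isCont (inv X) (X (inv X x))"
    by (rule isCont_inverse_function[where d=1]) (auto simp: \<open>inj X\<close> DERIV_isCont[OF dX])
  then have "isCont (inv X) x" by (simp add: inv)
  moreover have "C * w (inv X x) \<noteq> 0" using \<delta>(1) \<delta>(2)[of "inv X x"] by linarith
  ultimately show ?thesis
    by (intro DERIV_inverse_function[OF dX, where a="x - 1" and b="x + 1"]) (auto simp: inv)
qed

text \<open>In terms of the curvature \<open>k\<close> as a function of arc length and of the
  inverse \<open>S\<close> of the Lazutkin coordinate, $\mu = k(S(x))^{1/3} / (2C)$. The curvature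
  is periodic, positive and continuously differentiable, hence bounded away from zero and infinity
  together with a bound for its derivative; the chain rule carries this over to $\mu$.\<close>
lemma lazutkin_mu_bounds:
  assumes bd: "arclength_boundary r \<Omega> len \<sigma>" and r: "r \<ge> 4"
  obtains M where "\<And>x. 0 < lazutkin_mu len \<sigma> x" "\<And>x. lazutkin_mu len \<sigma> x \<le> M"
    "\<And>x. \<exists>D. (lazutkin_mu len \<sigma> has_real_derivative D) (at x) \<and> \<bar>D\<bar> \<le> M"
proof -
  from bd have len: "len > 0" and Cn: "Cn r \<sigma>" and per: "\<sigma> (t + len) = \<sigma> t"
    and nz: "vderiv 2 \<sigma> t \<noteq> 0" for t
    by (auto simp: arclength_boundary_def periodic_fun_simple_def)
  note vper = vderiv_periodic[OF Cn per]
  have v2: "(vderiv 2 \<sigma> has_vector_derivative vderiv 3 \<sigma> t) (at t)" for t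
    using Cn_vderiv[OF Cn, of 2] r by (simp add: eval_nat_numeral)
  have v3: "(vderiv 3 \<sigma> has_vector_derivative vderiv 4 \<sigma> t) (at t)" for t
    using Cn_vderiv[OF Cn, of 3] r by (simp add: eval_nat_numeral)
  have cont2: "continuous_on UNIV (vderiv 2 \<sigma>)" and cont3: "continuous_on UNIV (vderiv 3 \<sigma>)"
    by (metis continuous_at_imp_continuous_on has_vector_derivative_continuous v2)
      (metis continuous_at_imp_continuous_on has_vector_derivative_continuous v3)
  define k where "k t = norm (vderiv 2 \<sigma> t)" for t
  have kpos: "k t > 0" for t using nz by (simp add: k_def)
  have contk: "continuous_on S k" for S
    unfolding k_def by (intro continuous_on_norm continuous_on_subset[OF cont2]) auto
  have kper: "k (t + len) = k t" for t using vper[of 2] r by (simp add: k_def)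
  obtain K2 where K2: "\<And>t. norm (vderiv 2 \<sigma> t) \<le> K2"
    by (rule periodic_continuous_bounded[OF len _ cont2]) (use vper[of 2] r in auto)
  obtain K where K: "\<And>t. norm (vderiv 3 \<sigma> t) \<le> K"
    by (rule periodic_continuous_bounded[OF len _ cont3]) (use vper[of 3] r in auto)
  obtain t0 where t0: "\<And>t. t \<in> {0..len} \<Longrightarrow> k t0 \<le> k t"
    using continuous_attains_inf[OF compact_Icc _ contk, of 0 len] len by fastforce
  define m where "m = k t0"
  have m0: "m > 0" by (simp add: m_def kpos)
  have m: "m \<le> k t" for t
  proof -
    obtain t' where "t' \<in> {0..len}" "k t' = k t" using periodic_reduce[of len k, OF len kper] .
    then show ?thesis using t0 unfolding m_def by metis
  qed
  define k' where "k' t = vderiv 3 \<sigma> t \<bullet> sgn (vderiv 2 \<sigma> t)" for t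
  have dk: "(k has_real_derivative k' t) (at t)" for t
  proof -
    have "((\<lambda>t. norm (vderiv 2 \<sigma> t)) has_derivative (\<lambda>h. (h *\<^sub>R vderiv 3 \<sigma> t) \<bullet> sgn (vderiv 2 \<sigma> t))) (at t)"
      using v2[of t] unfolding has_vector_derivative_def
      by (rule has_derivative_compose) (rule has_derivative_norm[OF nz])
    then show ?thesis unfolding has_field_derivative_def k_def k'_def by (simp add: mult.commute[of _ "_ \<bullet> _"])
  qed
  have k'_le: "\<bar>k' t\<bar> \<le> K" for t
  proof -
    have "\<bar>k' t\<bar> \<le> norm (vderiv 3 \<sigma> t) * norm (sgn (vderiv 2 \<sigma> t))"
      unfolding k'_def by (rule Cauchy_Schwarz_ineq2)
    then show ?thesis using K[of t] nz[of t] by (simp add: norm_sgn)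
  qed
  define w where "w t = k t powr (2/3)" for t
  have curv: "curvature_radius \<sigma> t powr (- 2/3) = w t" for t
    by (simp add: curvature_radius_def w_def k_def powr_minus powr_divide divide_simps)
  have contw: "continuous_on S w" for S
    unfolding w_def by (intro continuous_intros contk) (metis kpos less_irrefl)
  have wm: "m powr (2/3) \<le> w t" for t unfolding w_def using m m0 by (intro powr_mono2) auto
  have mp: "m powr (2/3) > 0" using m0 by simp
  define C where "C = lazutkin_const len \<sigma>"
  have C: "C > 0"
  proof -
    have "len * m powr (2/3) = integral {0..len} (\<lambda>_. m powr (2/3))" using len by simp
    also have "\<dots> \<le> integral {0..len} w"
      by (intro integral_le integrable_continuous_real contw wm) auto
    finally have "integral {0..len} w > 0" using len mp by (smt (verit) mult_pos_pos)
    then show ?thesis unfolding C_def lazutkin_const_def curv by simp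
  qed
  define S where "S = arclength_of len \<sigma>"
  have "lazutkin_coord len \<sigma> = (\<lambda>s. C * (LBINT t=ereal 0..ereal s. w t))"
    unfolding lazutkin_coord_def[abs_def] curv C_def ..
  from lazutkin_coord_inverse[OF contw mp wm C this]
  have dS: "(S has_real_derivative inverse (C * w (S x))) (at x)" for x
    by (simp add: S_def arclength_of_def)
  have mu: "lazutkin_mu len \<sigma> = (\<lambda>x. k (S x) powr (1/3) / (2 * C))"
    by (auto simp: lazutkin_mu_def curvature_radius_def k_def S_def C_def powr_divide)
  define D where "D x = ((1/3) * k (S x) powr (1/3 - 1) * (k' (S x) * inverse (C * w (S x)))) / (2 * C)" for x
  have dmu: "(lazutkin_mu len \<sigma> has_real_derivative D x) (at x)" for x
  proof -
    have dkS: "((\<lambda>x. k (S x)) has_real_derivative k' (S x) * inverse (C * w (S x))) (at x)"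
      by (rule DERIV_chain2[OF dk dS])
    show ?thesis unfolding mu D_def
      using DERIV_cdivide[OF DERIV_fun_powr[OF dkS kpos, of "1/3"], of "2 * C"] by simp
  qed
  define MD where "MD = ((1/3) * m powr (1/3 - 1) * (K * inverse (C * m powr (2/3)))) / (2 * C)"
  have K0: "K \<ge> 0" using K[of 0] norm_ge_zero order_trans by blast
  have D_le: "\<bar>D x\<bar> \<le> MD" for x
  proof -
    have wS: "w (S x) > 0" for x by (rule less_le_trans[OF mp wm])
    have "\<bar>D x\<bar> = ((1/3) * k (S x) powr (1/3 - 1) * (\<bar>k' (S x)\<bar> * inverse (C * w (S x)))) / (2 * C)"
      unfolding D_def using C less_le_trans[OF mp wm[of "S x"]] kpos[of "S x"] by (simp add: abs_mult)
    also have "\<dots> \<le> MD" unfolding MD_def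
    proof (intro divide_right_mono mult_mono le_imp_inverse_le k'_le wm)
      show "k (S x) powr (1/3 - 1) \<le> m powr (1/3 - 1)"
        using m[of "S x"] m0 by (intro powr_mono2') auto
    qed (use C wS[of x] mp K0 in \<open>auto simp: less_imp_le\<close>)
    finally show ?thesis .
  qed
  define M1 where "M1 = K2 powr (1/3) / (2 * C)"
  have "lazutkin_mu len \<sigma> x \<le> M1" "lazutkin_mu len \<sigma> x > 0" for x
    unfolding mu M1_def using C K2[of "S x"] kpos[of "S x"]
    by (auto intro!: divide_right_mono powr_mono2 simp: k_def)
  then show ?thesis using dmu D_le
    by (intro that[of "max M1 MD"]) (fastforce simp: le_max_iff_disj)+
qed

text \<open>With $t = \mu / q$ these are the estimates $|\sin t / t - 1| \le t^2$ and $|(\sin t /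
  t)'| \le t$, where the inner derivative $\mu' / q$ supplies the second power of $q$.\<close>
lemma Sq_bounds:
  assumes M: "\<And>x. 0 < \<mu> x" "\<And>x. \<mu> x \<le> M"
    "\<And>x. \<exists>D. (\<mu> has_real_derivative D) (at x) \<and> \<bar>D\<bar> \<le> M" and q: "q \<ge> 1"
  shows "\<bar>Sq \<mu> q x\<bar> \<le> M\<^sup>2 / real q ^ 2"
    and "\<exists>D. (Sq \<mu> q has_real_derivative D) (at x) \<and> \<bar>D\<bar> \<le> M\<^sup>2 / real q ^ 2"
proof -
  have sin3: "\<bar>sin t - t\<bar> \<le> t ^ 3 / 6" if "t > 0" for t :: real
  proof -
    have "(\<Sum>m<3. sin_coeff m * t ^ m) = t" by (simp add: eval_nat_numeral sin_coeff_def)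
    then show ?thesis using Maclaurin_sin_bound[of t 3] that by (simp add: eval_nat_numeral)
  qed
  have cos2: "\<bar>cos t - 1\<bar> \<le> t ^ 2 / 2" for t :: real
  proof -
    have "cos t = 1 - 2 * sin (t / 2) ^ 2" using cos_double_sin[of "t / 2"] by simp
    moreover have "sin (t / 2) ^ 2 \<le> (t / 2) ^ 2" by (rule abs_le_square_iff[THEN iffD1, OF abs_sin_x_le_abs_x])
    ultimately show ?thesis by (simp add: power_divide)
  qed
  define t where "t = \<mu> x / real q"
  have t: "t > 0" "t \<le> M / real q" using M q by (auto simp: t_def divide_right_mono)
  have M0: "M > 0" using M(1,2) less_le_trans by blast
  have "\<bar>Sq \<mu> q x\<bar> = \<bar>sin t - t\<bar> / t" using t(1) by (simp add: Sq_def t_def[symmetric] divide_simps)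
  also have "\<dots> \<le> (t ^ 3 / 6) / t" using sin3[OF t(1)] t(1) by (intro divide_right_mono) auto
  also have "\<dots> \<le> t ^ 2" using t(1) by (simp add: eval_nat_numeral)
  also have "\<dots> \<le> (M / real q) ^ 2" using t by (intro power_mono) auto
  finally show "\<bar>Sq \<mu> q x\<bar> \<le> M\<^sup>2 / real q ^ 2" by (simp add: power_divide)
  obtain D where D: "(\<mu> has_real_derivative D) (at x)" "\<bar>D\<bar> \<le> M" using M(3) by blast
  let ?D = "((t * cos t - sin t) / t ^ 2) * (D / real q)"
  have "((\<lambda>t. sin t / t - 1) has_real_derivative (t * cos t - sin t) / t ^ 2) (at (\<mu> x / real q))"
    unfolding t_def[symmetric] using t(1) by (auto intro!: derivative_eq_intros simp: power2_eq_square mult.commute)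
  from DERIV_chain2[OF this DERIV_cdivide[OF D(1)]]
  have der: "(Sq \<mu> q has_real_derivative ?D) (at x)" by (simp add: Sq_def[abs_def])
  have "\<bar>t * cos t - sin t\<bar> \<le> \<bar>t * (cos t - 1)\<bar> + \<bar>sin t - t\<bar>" by (simp add: right_diff_distrib)
  also have "\<dots> \<le> t * (t ^ 2 / 2) + t ^ 3 / 6"
    unfolding abs_mult using cos2[of t] sin3[OF t(1)] t(1) by (intro add_mono mult_mono) auto
  also have "\<dots> \<le> t * t ^ 2" using t(1) by (simp add: eval_nat_numeral field_simps)
  finally have "\<bar>(t * cos t - sin t) / t ^ 2\<bar> \<le> t" using t(1) by (simp add: abs_divide divide_le_eq)
  then have "\<bar>?D\<bar> \<le> (M / real q) * (M / real q)"
    unfolding abs_mult using t D q M0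
    by (intro mult_mono) (auto simp: divide_right_mono)
  then have "\<bar>?D\<bar> \<le> M\<^sup>2 / real q ^ 2" by (simp add: power2_eq_square)
  with der show "\<exists>D. (Sq \<mu> q has_real_derivative D) (at x) \<and> \<bar>D\<bar> \<le> M\<^sup>2 / real q ^ 2" by blast
qed

section \<open>Perturbed exponential sums\<close>

lemma Cn_norm_leD:
  fixes f :: "real \<Rightarrow> real"
  assumes "Cn_norm_le n f C"
  shows "\<bar>f t\<bar> \<le> C"
    and "n \<ge> 1 \<Longrightarrow> \<bar>deriv f t\<bar> \<le> C"
    and "n \<ge> 1 \<Longrightarrow> \<bar>f s - f t\<bar> \<le> C * \<bar>s - t\<bar>"
    and "n \<ge> 2 \<Longrightarrow> \<bar>deriv f s - deriv f t\<bar> \<le> C * \<bar>s - t\<bar>"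
proof -
  have v: "Cn n f" "\<And>i t. i \<le> n \<Longrightarrow> \<bar>vderiv i f t\<bar> \<le> C"
    using assms by (auto simp: Cn_norm_le_def)
  have v0: "vderiv 0 f = f" and v1: "vderiv 1 f = deriv f" and v2: "vderiv 2 f = deriv (deriv f)"
    by (auto simp: vderiv_def numeral_2_eq_2 fun_eq_iff simp flip: field_derivative_eq_vector_derivative)
  have lip: "\<bar>g s - g t\<bar> \<le> C * \<bar>s - t\<bar>"
    if "\<And>t. g differentiable at t" "\<And>t. \<bar>deriv g t\<bar> \<le> C" for g :: "real \<Rightarrow> real" and s t
  proof -
    have "norm (g s - g t) \<le> C * norm (s - t)"
    proof (rule field_differentiable_bound[of UNIV g "deriv g"])
      show "(g has_field_derivative deriv g z) (at z within UNIV)" for z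
        using that(1) by (simp add: DERIV_deriv_iff_real_differentiable)
    qed (use that in auto)
    then show ?thesis by simp
  qed
  show "\<bar>f t\<bar> \<le> C" using v(2)[of 0] v0 by simp
  show "\<bar>deriv f t\<bar> \<le> C" if "n \<ge> 1" using v(2)[of 1] v1 that by simp
  show "\<bar>f s - f t\<bar> \<le> C * \<bar>s - t\<bar>" if "n \<ge> 1"
  proof (rule lip)
    show "f differentiable at t" for t
      using v(1) that v0 unfolding Cn_def by (metis less_le_trans zero_less_one)
    show "\<bar>deriv f t\<bar> \<le> C" for t using v(2)[of 1] v1 that by simp
  qed
  show "\<bar>deriv f s - deriv f t\<bar> \<le> C * \<bar>s - t\<bar>" if "n \<ge> 2"
  proof (rule lip)
    show "deriv f differentiable at t" for t
      using v(1) that v1 unfolding Cn_def by (metis less_le_trans one_less_numeral_iff semiring_norm(76))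
    show "\<bar>deriv (deriv f) t\<bar> \<le> C" for t using v(2)[of 2] v2 that by simp
  qed
qed

text \<open>Each factor of the leading perturbation is bounded, within $O(\delta)$ of 1 and
  Lipschitz with constant $O(\delta)$. The three properties are collected in one predicate with a
  common constant because only together are they stable under products.\<close>
definition near_one :: "real \<Rightarrow> real \<Rightarrow> (real \<Rightarrow> complex) \<Rightarrow> bool" where
  "near_one M \<delta> f \<longleftrightarrow> (\<forall>t. norm (f t) \<le> M \<and> norm (f t - 1) \<le> M * \<delta>) \<and>
     (\<forall>s t. norm (f s - f t) \<le> M * \<delta> * \<bar>s - t\<bar>)"

lemma near_one_mult:
  assumes f: "near_one M \<delta> f" and g: "near_one M' \<delta> g" and M': "M' \<ge> 1" and \<delta>: "\<delta> \<ge> 0"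
  shows "near_one (3 * M * M') \<delta> (\<lambda>t. f t * g t)"
proof -
  have M: "M \<ge> 0" using f norm_ge_zero order_trans unfolding near_one_def by blast
  have MM: "M \<le> M * M'" using M M' by (simp add: mult_le_cancel_left1)
  have nf: "norm (f t) \<le> M" "norm (f t - 1) \<le> M * \<delta>" "norm (f s - f t) \<le> M * \<delta> * \<bar>s - t\<bar>"
    and ng: "norm (g t) \<le> M'" "norm (g t - 1) \<le> M' * \<delta>" "norm (g s - g t) \<le> M' * \<delta> * \<bar>s - t\<bar>" for s t
    using f g by (auto simp: near_one_def)
  have "norm (f t * g t) \<le> 3 * M * M'" for t
  proof -
    have "norm (f t * g t) \<le> M * M'" unfolding norm_mult by (intro mult_mono nf ng M) auto
    moreover have "M * M' \<ge> 0" using M M' by simp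
    ultimately show ?thesis by simp
  qed
  moreover have "norm (f t * g t - 1) \<le> 3 * M * M' * \<delta>" for t
  proof -
    have "f t * g t - 1 = f t * (g t - 1) + (f t - 1)" by (simp add: algebra_simps)
    then have "norm (f t * g t - 1) \<le> norm (f t) * norm (g t - 1) + norm (f t - 1)"
      by (metis norm_mult norm_triangle_ineq)
    also have "\<dots> \<le> M * (M' * \<delta>) + (M * M') * \<delta>"
      using nf(2)[of t] mult_right_mono[OF MM \<delta>] by (intro add_mono mult_mono nf ng M) auto
    also have "\<dots> \<le> 3 * M * M' * \<delta>" using M M' \<delta> by (simp add: mult_ac)
    finally show ?thesis .
  qed
  moreover have "norm (f s * g s - f t * g t) \<le> 3 * M * M' * \<delta> * \<bar>s - t\<bar>" for s t
  proof -
    have "f s * g s - f t * g t = f s * (g s - g t) + (f s - f t) * g t" by (simp add: algebra_simps)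
    then have "norm (f s * g s - f t * g t) \<le> norm (f s) * norm (g s - g t) + norm (f s - f t) * norm (g t)"
      by (metis norm_mult norm_triangle_ineq)
    also have "\<dots> \<le> M * (M' * \<delta> * \<bar>s - t\<bar>) + (M * \<delta> * \<bar>s - t\<bar>) * M'"
      using M M' \<delta> by (intro add_mono mult_mono nf ng) auto
    also have "\<dots> \<le> 3 * M * M' * \<delta> * \<bar>s - t\<bar>" using M M' \<delta> by (simp add: mult_ac)
    finally show ?thesis .
  qed
  ultimately show ?thesis unfolding near_one_def by blast
qed

text \<open>The chord is shorter than the arc.\<close>
lemma norm_cis_diff_le: "norm (cis a - cis b) \<le> \<bar>a - b\<bar>"
proof -
  have "cis a - cis b = cis b * (cis (a - b) - 1)" by (simp add: algebra_simps cis_mult)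
  then have "norm (cis a - cis b) = norm (cis (a - b) - 1)" by (simp add: norm_mult)
  also have "\<dots> = norm (exp (\<i> * of_real (a - b)) - 1)" by (simp add: cis_conv_exp)
  also have "\<dots> = 2 * \<bar>sin ((a - b) / 2)\<bar>" by (rule dist_exp_i_1)
  also have "\<dots> \<le> \<bar>a - b\<bar>" using abs_sin_x_le_abs_x[of "(a - b) / 2"] by simp
  finally show ?thesis .
qed

lemma sin_ge_third:
  assumes "0 \<le> t" "t \<le> pi / 2"
  shows "sin t \<ge> t / 3"
proof -
  define s where "s = t / 2"
  have s: "0 \<le> s" "s \<le> 1" using assms pi_half_less_two by (auto simp: s_def)
  have s2: "s ^ 2 \<le> 1" using s by (simp add: power_le_one)
  have "(\<Sum>m<3. sin_coeff m * s ^ m) = s" by (simp add: eval_nat_numeral sin_coeff_def)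
  then have "\<bar>sin s - s\<bar> \<le> s ^ 3 / 6" using Maclaurin_sin_bound[of s 3] s by (simp add: eval_nat_numeral)
  moreover have "s ^ 3 \<le> s" using mult_left_mono[OF s2 s(1)] by (simp add: eval_nat_numeral)
  ultimately have sin: "sin s \<ge> 5 / 6 * s" by linarith
  have "cos s = 1 - 2 * sin (s / 2) ^ 2" using cos_double_sin[of "s / 2"] by simp
  moreover have "sin (s / 2) ^ 2 \<le> (s / 2) ^ 2" by (rule abs_le_square_iff[THEN iffD1, OF abs_sin_x_le_abs_x])
  ultimately have cos: "cos s \<ge> 1 / 2" using s2 by (simp add: power_divide)
  have "(5 / 6 * s) * (1 / 2) \<le> sin s * cos s" using sin cos s by (intro mult_mono) auto
  moreover have "sin t = 2 * (sin s * cos s)" using sin_double[of s] by (simp add: s_def)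
  ultimately show ?thesis using s by (simp add: s_def)
qed

text \<open>The distance of \<open>p\<close> from the multiples of \<open>q\<close>, replaced by 1
  if it vanishes, so that dividing by it never gains anything at the multiples themselves.\<close>
definition mult_dist :: "nat \<Rightarrow> nat \<Rightarrow> nat" where
  "mult_dist q p = max 1 (min (p mod q) (q - p mod q))"

text \<open>Summation by parts. The boundary terms do not cancel, as \<open>u\<close> is not
  assumed to be periodic, but they differ by at most \<open>q * L\<close>, the same size as the
  sum of the increments.\<close>
lemma abel_bound:
  fixes u :: "nat \<Rightarrow> complex"
  assumes z: "norm z = 1" "z ^ q = 1" "z \<noteq> 1" and L: "\<And>k. Suc k < q \<Longrightarrow> norm (u (Suc k) - u k) \<le> L" and "L \<ge> 0"
  shows "norm (\<Sum>k<q. z ^ k * u k) \<le> 2 * real q * L / norm (1 - z)"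
proof (cases q)
  case (Suc n)
  have id: "(1 - z) * (\<Sum>k<Suc n. z ^ k * u k)
      = u 0 - z ^ Suc n * u n + (\<Sum>k<n. z ^ Suc k * (u (Suc k) - u k))" for n
  proof (induction n)
    case (Suc n)
    have "(1 - z) * (\<Sum>k<Suc (Suc n). z ^ k * u k)
        = (u 0 - z ^ Suc n * u n + (\<Sum>k<n. z ^ Suc k * (u (Suc k) - u k))) + (1 - z) * (z ^ Suc n * u (Suc n))"
      by (simp only: sum.lessThan_Suc[of _ "Suc n"] distrib_left Suc.IH)
    also have "\<dots> = u 0 - z ^ Suc (Suc n) * u (Suc n) + (\<Sum>k<Suc n. z ^ Suc k * (u (Suc k) - u k))"
      by (simp add: algebra_simps)
    finally show ?case .
  qed (simp add: algebra_simps)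
  have tele: "norm (u 0 - u n) \<le> real n * L"
  proof -
    have "u 0 - u n = - (\<Sum>k<n. u (Suc k) - u k)" by (simp add: sum_lessThan_telescope)
    then have "norm (u 0 - u n) = norm (\<Sum>k<n. u (Suc k) - u k)" by simp
    also have "\<dots> \<le> (\<Sum>k<n. L)" by (rule sum_norm_le) (simp add: L Suc)
    finally show ?thesis by simp
  qed
  have "norm (\<Sum>k<n. z ^ Suc k * (u (Suc k) - u k)) \<le> (\<Sum>k<n. L)"
    by (rule sum_norm_le) (simp add: L Suc norm_mult norm_power z)
  then have "norm (\<Sum>k<n. z ^ Suc k * (u (Suc k) - u k)) \<le> real n * L" by simp
  with tele have "norm ((1 - z) * (\<Sum>k<q. z ^ k * u k)) \<le> real n * L + real n * L"
    unfolding Suc id using z(2) Suc by (intro norm_triangle_le add_mono) auto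
  also have "\<dots> \<le> 2 * real q * L" using Suc \<open>L \<ge> 0\<close> by (simp add: algebra_simps)
  finally have "norm (1 - z) * norm (\<Sum>k<q. z ^ k * u k) \<le> 2 * real q * L" by (simp only: norm_mult)
  moreover have "norm (1 - z) > 0" using z(3) by simp
  ultimately show ?thesis by (simp add: pos_le_divide_eq mult.commute)
qed simp

lemma norm_one_minus_cis_ge:
  assumes q: "q \<ge> 1" and nd: "\<not> q dvd p"
  shows "norm (1 - cis (2 * pi * real p / real q)) \<ge> real (mult_dist q p) / real q"
proof -
  define r where "r = p mod q"
  have r: "0 < r" "r < q" using q nd by (auto simp: r_def mod_greater_zero_iff_not_dvd)
  define d where "d = min r (q - r)"
  have d: "mult_dist q p = d" "d \<ge> 1" "2 * d \<le> q" using r by (auto simp: mult_dist_def r_def[symmetric] d_def)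
  have "real p = real q * real (p div q) + real r"
    unfolding r_def by (simp flip: of_nat_mult of_nat_add)
  then have "2 * pi * real p / real q = 2 * pi * real r / real q + 2 * pi * real (p div q)"
    using q by (simp add: field_simps)
  then have "cis (2 * pi * real p / real q) = cis (2 * pi * real r / real q)"
    by (simp add: cis_mult[symmetric] cis_multiple_2pi)
  also have "norm (1 - cis (2 * pi * real r / real q)) = norm (exp (\<i> * of_real (2 * pi * real r / real q)) - 1)"
    by (simp add: cis_conv_exp norm_minus_commute)
  also have "\<dots> = 2 * \<bar>sin (2 * pi * real r / real q / 2)\<bar>" by (rule dist_exp_i_1)
  also have "sin (2 * pi * real r / real q / 2) = sin (pi * real d / real q)"
  proof (cases "r \<le> q - r")
    case True
    then show ?thesis by (simp add: d_def)
  next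
    case False
    then have "real d = real q - real r" using r by (simp add: d_def)
    then have "pi * real d / real q = pi - pi * real r / real q"
      using q by (simp add: diff_divide_distrib right_diff_distrib)
    then show ?thesis by simp
  qed
  finally have "norm (1 - cis (2 * pi * real p / real q)) = 2 * \<bar>sin (pi * real d / real q)\<bar>" .
  moreover have "sin (pi * real d / real q) \<ge> pi * real d / real q / 3"
  proof (rule sin_ge_third)
    have "real d \<le> real q / 2" using d(3) by linarith
    then show "pi * real d / real q \<le> pi / 2" using q by (simp add: field_simps)
  qed simp
  moreover have "real d / real q \<le> pi * real d / real q / 3"
  proof -
    have "3 * real d \<le> pi * real d" using pi_gt3 by (intro mult_right_mono) auto
    then show ?thesis using q by (simp add: field_simps)
  qed
  ultimately show ?thesis unfolding d(1) by linarith
qed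

text \<open>Consecutive points are $1/q$ apart, so the increments of \<open>f\<close> are
  $O(\delta/q)$, while the root of unity, if it is not 1, has distance at least $D/q$ from 1. The
  two factors $q$ cancel, and the saving compared with the trivial bound is $1/D$.\<close>
lemma oscillatory_sum_bound:
  assumes f: "near_one M \<delta> f" and q: "q \<ge> 1" and \<delta>: "\<delta> \<ge> 0"
  shows "norm (\<Sum>k<q. cis (2 * pi * real p / real q) ^ k * (f (x + real k / real q) - 1))
    \<le> 2 * real q * (M + 1) * min 1 (\<delta> / real (mult_dist q p))"
proof -
  let ?z = "cis (2 * pi * real p / real q)"
  let ?u = "\<lambda>k. f (x + real k / real q) - 1"
  have M: "M \<ge> 0" using f norm_ge_zero order_trans unfolding near_one_def by blast
  have nf: "norm (f t) \<le> M" "norm (f t - 1) \<le> M * \<delta>" "norm (f s - f t) \<le> M * \<delta> * \<bar>s - t\<bar>" for s t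
    using f by (auto simp: near_one_def)
  have triv: "norm (\<Sum>k<q. ?z ^ k * ?u k) \<le> real q * B" if "\<And>t. norm (f t - 1) \<le> B" for B
  proof -
    have "norm (\<Sum>k<q. ?z ^ k * ?u k) \<le> (\<Sum>k<q. B)"
      by (rule sum_norm_le) (simp add: norm_mult norm_power that)
    then show ?thesis by simp
  qed
  have le1: "norm (\<Sum>k<q. ?z ^ k * ?u k) \<le> real q * (M + 1)"
    by (rule triv) (rule order_trans[OF norm_triangle_ineq4], simp add: nf)
  have "norm (\<Sum>k<q. ?z ^ k * ?u k) \<le> 2 * real q * (M * (\<delta> / real (mult_dist q p)))"
  proof (cases "q dvd p")
    case True
    then have "mult_dist q p = 1" by (simp add: mult_dist_def dvd_eq_mod_eq_0)
    moreover have "real q * (M * \<delta>) \<ge> 0" using M \<delta> by simp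
    ultimately show ?thesis using triv[OF nf(2)] by simp
  next
    case False
    define d where "d = real (mult_dist q p)"
    have d: "d \<ge> 1" by (simp add: d_def mult_dist_def)
    have nz: "norm (1 - ?z) \<ge> d / real q" unfolding d_def by (rule norm_one_minus_cis_ge[OF q False])
    moreover have "d / real q > 0" using d q by simp
    ultimately have nz0: "norm (1 - ?z) > 0" by linarith
    have "norm (\<Sum>k<q. ?z ^ k * ?u k) \<le> 2 * real q * (M * \<delta> / real q) / norm (1 - ?z)"
    proof (rule abel_bound)
      have "?z ^ q = cis (real q * (2 * pi * real p / real q))" by (rule Complex.DeMoivre)
      also have "\<dots> = cis (2 * pi * real p)" using q by simp
      also have "\<dots> = 1" by (rule cis_multiple_2pi) simp
      finally show "?z ^ q = 1" .
      fix k
      show "norm (?u (Suc k) - ?u k) \<le> M * \<delta> / real q"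
        using nf(3)[of "x + real (Suc k) / real q" "x + real k / real q"] q
        by (simp add: diff_divide_distrib[symmetric])
    qed (use nz0 M \<delta> in auto)
    also have "\<dots> \<le> 2 * real q * (M * \<delta> / real q) / (d / real q)"
      using nz d q M \<delta> by (intro divide_left_mono) (auto intro!: mult_pos_pos simp: nz0[simplified])
    also have "\<dots> = 2 * real q * (M * (\<delta> / d))" using q d by (simp add: field_simps)
    finally show ?thesis by (simp add: d_def)
  qed
  also have "\<dots> \<le> 2 * real q * ((M + 1) * (\<delta> / real (mult_dist q p)))"
    using \<delta> by (intro mult_left_mono mult_right_mono) auto
  finally have le2: "norm (\<Sum>k<q. ?z ^ k * ?u k) \<le> 2 * real q * (M + 1) * (\<delta> / real (mult_dist q p))"
    by (simp only: mult.assoc)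
  have "real q * (M + 1) \<le> 2 * real q * (M + 1)" using M by simp
  with le1 le2 show ?thesis by (auto simp: min_def)
qed

text \<open>The size, up to a constant, of the error at the frequency \<open>p\<close> in the row
  \<open>q\<close>.\<close>
definition osc_err :: "nat \<Rightarrow> nat \<Rightarrow> real" where
  "osc_err q p = real p / real q * min 1 (real p / (real q ^ 2 * real (mult_dist q p)))"

text \<open>The functional is $\mathrm{Re}$ or $-\mathrm{Im}$. It reduces estimates for sums of
  sines and cosines to exponential sums.\<close>
lemma trig'_cis:
  obtains \<phi> :: "complex \<Rightarrow> real" where "linear \<phi>" "\<And>z. \<bar>\<phi> z\<bar> \<le> norm z"
    "\<And>y. trig' m y = 2 * pi * real (freq m) * \<phi> (cis (2 * pi * real (freq m) * y))"
proof (cases "even m \<and> m \<noteq> 0")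
  case True
  show ?thesis by (rule that[of Re]) (use True abs_Re_le_cmod in \<open>auto simp: trig'_def linear_iff\<close>)
next
  case False
  show ?thesis
    by (rule that[of "\<lambda>z. - Im z"]) (use False abs_Im_le_cmod in \<open>auto simp: trig'_def linear_iff\<close>)
qed

lemma product_perturbation:
  fixes a b c a' b' c' :: complex
  assumes "norm (a - a') \<le> A" "norm (b - b') \<le> B" "norm (c - c') \<le> E"
    and "norm a' \<le> 1" "norm b \<le> Mb" "norm b' \<le> Mb" "norm c \<le> Mc"
  shows "norm (a * b * c - a' * b' * c') \<le> A * Mb * Mc + B * Mc + Mb * E"
proof -
  have nn: "0 \<le> A" "0 \<le> B" "0 \<le> E" "0 \<le> Mb" "0 \<le> Mc"
    using assms norm_ge_zero order_trans by blast+
  have "a * b * c - a' * b' * c' = (a - a') * b * c + a' * (b - b') * c + a' * b' * (c - c')"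
    by (simp add: algebra_simps)
  then have "norm (a * b * c - a' * b' * c')
      \<le> norm ((a - a') * b * c) + norm (a' * (b - b') * c) + norm (a' * b' * (c - c'))"
    by (metis norm_triangle_ineq norm_triangle_le add_right_mono)
  also have "\<dots> \<le> A * Mb * Mc + 1 * B * Mc + 1 * Mb * E"
    unfolding norm_mult by (intro add_mono mult_mono assms mult_nonneg_nonneg nn norm_ge_zero) (auto simp: nn)
  finally show ?thesis by simp
qed

text \<open>Writing $e(t) = e^{2 \pi i p t}$ and $y_k = x + k/q$, the summands of the first
  operator, applied to the exponential, are $2\pi i p\, e(y_k)$ times a product of a phase factor
  and two weights. The factors \<open>f1\<close>, \<open>f2\<close>, \<open>f3\<close> are these
  with the terms of order $q^{-4}$ omitted; they depend on $k$ through $y_k$ only, which makes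
  \<open>oscillatory_sum_bound\<close> applicable with $\delta = p/q^2$. The omitted terms change
  the product by $O(\min (1, p/q^4))$, which is at most $\min (1, p/(q^2 D))$ as $D \le q$. The
  second operator, which does not differentiate the function, is trivially $O(q^{-3})$, and this
  too is dominated by the claimed error, because $D \le p$.\<close>
lemma L_op_trig_approx:
  assumes q: "q \<ge> 1" and C: "C \<ge> 1"
    and \<alpha>: "\<And>t. \<bar>\<alpha> t\<bar> \<le> C" "\<And>t. \<bar>deriv \<alpha> t\<bar> \<le> C"
      "\<And>s t. \<bar>\<alpha> s - \<alpha> t\<bar> \<le> C * \<bar>s - t\<bar>" "\<And>s t. \<bar>deriv \<alpha> s - deriv \<alpha> t\<bar> \<le> C * \<bar>s - t\<bar>"
    and \<beta>: "\<And>t. \<bar>\<beta> t\<bar> \<le> C" "\<And>t. \<bar>deriv \<beta> t\<bar> \<le> C" "\<And>s t. \<bar>\<beta> s - \<beta> t\<bar> \<le> C * \<bar>s - t\<bar>"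
    and S: "\<And>t. \<bar>Sq \<mu> q t\<bar> \<le> C / real q ^ 2" "\<And>t. \<bar>deriv (Sq \<mu> q) t\<bar> \<le> C / real q ^ 2"
      "\<And>s t. \<bar>Sq \<mu> q s - Sq \<mu> q t\<bar> \<le> C / real q ^ 2 * \<bar>s - t\<bar>"
    and ga: "\<And>k t. k < q \<Longrightarrow> \<bar>ga q k t\<bar> \<le> C" "\<And>k t. k < q \<Longrightarrow> \<bar>deriv (ga q k) t\<bar> \<le> C"
    and gc: "\<And>k t. k < q \<Longrightarrow> \<bar>gc q k t\<bar> \<le> C" "\<And>k t. k < q \<Longrightarrow> \<bar>deriv (gc q k) t\<bar> \<le> C"
  shows "\<bar>L_op \<mu> \<alpha> \<beta> ga gc q (trig 0) x\<bar> \<le> C / real q ^ 3"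
    and "m \<ge> 1 \<Longrightarrow> \<bar>L_op \<mu> \<alpha> \<beta> ga gc q (trig m) x
           - 1 / (2 * pi * real q ^ 2) * (\<Sum>k<q. trig' m (x + real k / real q))\<bar>
         \<le> 970 * C ^ 3 * osc_err q (freq m)"
proof -
  have derivtrig: "deriv (trig m) = trig' m" for m
    by (rule ext, rule DERIV_imp_deriv, rule trig_has_derivative)
  have q2: "real q ^ 2 \<ge> 1" "real q ^ 4 \<ge> 1" "real q ^ 4 \<ge> real q ^ 2"
    using q by (auto simp: power_increasing)
  have L2: "\<bar>L2_op \<mu> \<alpha> \<beta> ga gc q (trig m) x\<bar> \<le> C / real q ^ 3" for m
  proof -
    have "\<bar>\<Sum>k<q. trig m (orbit_x \<alpha> ga q k x) *
        (deriv \<beta> (x + real k / real q) / real q ^ 2 + deriv (Sq \<mu> q) (x + real k / real q)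
           + deriv (gc q k) x / real q ^ 4)\<bar> \<le> (\<Sum>k<q. 3 * C / real q ^ 2)"
    proof (rule order_trans[OF sum_abs sum_mono])
      fix k assume "k \<in> {..<q}"
      then have k: "k < q" by simp
      have "\<bar>deriv \<beta> (x + real k / real q) / real q ^ 2\<bar> \<le> C / real q ^ 2"
        using \<beta>(2) by (simp add: divide_right_mono)
      moreover have "\<bar>deriv (gc q k) x / real q ^ 4\<bar> \<le> C / real q ^ 2"
        using gc(2)[OF k, of x] q q2 C by (auto intro!: frac_le)
      ultimately have "\<bar>deriv \<beta> (x + real k / real q) / real q ^ 2 + deriv (Sq \<mu> q) (x + real k / real q)
           + deriv (gc q k) x / real q ^ 4\<bar> \<le> 3 * C / real q ^ 2"
        using S(2)[of "x + real k / real q"]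
          add_divide_distrib[of "C + C" C "real q ^ 2"] add_divide_distrib[of C C "real q ^ 2"] by linarith
      then show "\<bar>trig m (orbit_x \<alpha> ga q k x) * (deriv \<beta> (x + real k / real q) / real q ^ 2
            + deriv (Sq \<mu> q) (x + real k / real q) + deriv (gc q k) x / real q ^ 4)\<bar> \<le> 3 * C / real q ^ 2"
        unfolding abs_mult using mult_mono[OF abs_trig_le] by (metis abs_ge_zero mult_1 zero_le_one)
    qed
    also have "\<dots> = 3 * C / real q" using q by (simp add: power2_eq_square)
    finally have "\<bar>L2_op \<mu> \<alpha> \<beta> ga gc q (trig m) x\<bar> \<le> 1 / (2 * pi * real q ^ 2) * (3 * C / real q)"
      unfolding L2_op_def abs_mult by (intro mult_mono) auto
    also have "\<dots> \<le> 1 / (3 * real q ^ 2) * (3 * C / real q)"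
      using pi_gt3 q C by (intro mult_right_mono divide_left_mono) auto
    also have "\<dots> = C / real q ^ 3" using q by (simp add: power2_eq_square power3_eq_cube)
    finally show ?thesis .
  qed
  show "\<bar>L_op \<mu> \<alpha> \<beta> ga gc q (trig 0) x\<bar> \<le> C / real q ^ 3"
    using L2[of 0] by (simp add: L_op_def L1_op_def derivtrig trig'_def)
  assume m: "m \<ge> 1"
  define p where "p = freq m"
  have p: "p \<ge> 1" using m freq_eq_0[of m] unfolding p_def by linarith
  define \<delta> where "\<delta> = real p / real q ^ 2"
  have \<delta>: "\<delta> \<ge> 0" "1 / real q ^ 2 \<le> \<delta>" using p by (auto simp: \<delta>_def divide_right_mono)
  have leC\<delta>: "C / real q ^ 2 \<le> C * \<delta>" using mult_left_mono[OF \<delta>(2), of C] C by simp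
  define D where "D = real (mult_dist q p)"
  have D1: "D \<ge> 1" and Dq: "D \<le> real q" and Dp: "D \<le> real p"
    using q p mod_less_eq_dividend[of p q] by (auto simp: D_def mult_dist_def min_le_iff_disj)
  define \<eta> where "\<eta> = min 1 (\<delta> / D)"
  have \<eta>0: "\<eta> \<ge> 0" using \<delta> D1 by (simp add: \<eta>_def)
  have err: "osc_err q p = real p / real q * \<eta>"
    by (simp add: osc_err_def \<eta>_def \<delta>_def D_def)
  define \<epsilon> where "\<epsilon> = min 1 (real p / real q ^ 4)"
  have \<epsilon>\<eta>: "\<epsilon> \<le> \<eta>"
  proof -
    have "real q ^ 2 * D \<le> real q ^ 2 * real q ^ 2"
      using Dq q by (intro mult_left_mono) (auto simp: power2_eq_square intro: order_trans[OF _ mult_left_mono[of 1]])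
    also have "\<dots> = real q ^ 4" by (simp flip: power_add)
    finally have "real p / real q ^ 4 \<le> real p / (real q ^ 2 * D)"
      using q D1 by (intro divide_left_mono) auto
    then show ?thesis unfolding \<epsilon>_def \<eta>_def \<delta>_def by (simp add: min_le_iff_disj)
  qed
  have \<epsilon>1: "1 / real q ^ 4 \<le> \<epsilon>" using p q q2 by (auto simp: \<epsilon>_def divide_right_mono divide_le_eq)
  have leC\<epsilon>: "C / real q ^ 4 \<le> C * \<epsilon>" using mult_left_mono[OF \<epsilon>1, of C] C by simp
  have CC: "C \<le> C * C" "C * C \<le> C ^ 3" "1 \<le> C ^ 3"
    using C power_increasing[of 1 2 C] power_increasing[of 2 3 C] by (auto simp: power2_eq_square one_le_power)

  (* smooth part *)
  \<comment> \<open>The factors that depend on \<open>k\<close> only through the equidistant points.\<close>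
  define f1 where "f1 t = cis (2 * pi * real p * (\<alpha> t / real q ^ 2))" for t
  define f2 where "f2 t = complex_of_real (1 + deriv \<alpha> t / real q ^ 2)" for t
  define f3 where "f3 t = complex_of_real (1 + \<beta> t / real q ^ 2 + Sq \<mu> q t)" for t
  have ph: "\<bar>2 * pi * real p * (a / real q ^ 2)\<bar> \<le> 8 * C * \<delta> * h" if "\<bar>a\<bar> \<le> C * h" for a h
  proof -
    have "\<bar>2 * pi * real p * (a / real q ^ 2)\<bar> = (2 * pi) * (\<delta> * \<bar>a\<bar>)"
      by (simp add: \<delta>_def abs_mult)
    also have "\<dots> \<le> 8 * (\<delta> * (C * h))" using pi_less_4 \<delta> that by (intro mult_mono) auto
    finally show ?thesis by (simp add: mult_ac)
  qed
  have n1: "near_one (8 * C) \<delta> f1"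
    unfolding near_one_def
  proof (intro conjI allI)
    fix s t
    show "norm (f1 t) \<le> 8 * C" using C by (simp add: f1_def)
    show "norm (f1 t - 1) \<le> 8 * C * \<delta>"
      using order_trans[OF norm_cis_diff_le[of "2 * pi * real p * (\<alpha> t / real q ^ 2)" 0]] ph[of "\<alpha> t" 1] \<alpha>(1)[of t]
      unfolding f1_def by simp
    have "2 * pi * real p * (\<alpha> s / real q ^ 2) - 2 * pi * real p * (\<alpha> t / real q ^ 2)
        = 2 * pi * real p * ((\<alpha> s - \<alpha> t) / real q ^ 2)"
      by (simp add: diff_divide_distrib right_diff_distrib)
    then show "norm (f1 s - f1 t) \<le> 8 * C * \<delta> * \<bar>s - t\<bar>"
      unfolding f1_def
      using order_trans[OF norm_cis_diff_le] ph[OF \<alpha>(3)] by metis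
  qed
  have divle: "\<bar>a / real q ^ 2\<bar> \<le> C * \<delta> * h" if "\<bar>a\<bar> \<le> C * h" "h \<ge> 0" for a h
  proof -
    have "\<bar>a / real q ^ 2\<bar> \<le> C / real q ^ 2 * h" using that(1) by (simp add: divide_right_mono)
    also have "\<dots> \<le> C * \<delta> * h" by (rule mult_right_mono[OF leC\<delta> that(2)])
    finally show ?thesis .
  qed
  have div1: "\<bar>a / real q ^ 2\<bar> \<le> C" if "\<bar>a\<bar> \<le> C" for a
    using that q2 frac_le[of C "\<bar>a\<bar>" 1 "real q ^ 2"] C by simp
  have n2: "near_one (2 * C) \<delta> f2"
    unfolding near_one_def
  proof (intro conjI allI)
    fix s t
    have "norm (f2 t) = \<bar>1 + deriv \<alpha> t / real q ^ 2\<bar>" unfolding f2_def by (rule norm_of_real)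
    then show "norm (f2 t) \<le> 2 * C" using div1[OF \<alpha>(2)[of t]] C by linarith
    have "norm (f2 t - 1) = \<bar>deriv \<alpha> t / real q ^ 2\<bar>"
      unfolding f2_def by (simp add: norm_divide norm_power)
    also have "\<dots> \<le> C * \<delta>" using divle[of "deriv \<alpha> t" 1] \<alpha>(2)[of t] by simp
    also have "\<dots> \<le> 2 * C * \<delta>" using C \<delta> by simp
    finally show "norm (f2 t - 1) \<le> 2 * C * \<delta>" .
    have "f2 s - f2 t = complex_of_real ((deriv \<alpha> s - deriv \<alpha> t) / real q ^ 2)"
      by (simp add: f2_def diff_divide_distrib)
    then have "norm (f2 s - f2 t) = \<bar>(deriv \<alpha> s - deriv \<alpha> t) / real q ^ 2\<bar>" by (simp only: norm_of_real)
    also have "\<dots> \<le> C * \<delta> * \<bar>s - t\<bar>" by (rule divle[OF \<alpha>(4)]) simp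
    also have "\<dots> \<le> 2 * C * \<delta> * \<bar>s - t\<bar>" using C \<delta> by (intro mult_right_mono) auto
    finally show "norm (f2 s - f2 t) \<le> 2 * C * \<delta> * \<bar>s - t\<bar>" .
  qed
  have n3: "near_one (3 * C) \<delta> f3"
    unfolding near_one_def
  proof (intro conjI allI)
    fix s t
    have SC: "\<bar>Sq \<mu> q t\<bar> \<le> C" using order_trans[OF S(1)[of t]] div1[of C] C by simp
    have "norm (f3 t) = \<bar>1 + \<beta> t / real q ^ 2 + Sq \<mu> q t\<bar>" unfolding f3_def by (rule norm_of_real)
    then show "norm (f3 t) \<le> 3 * C" using div1[OF \<beta>(1)[of t]] SC C by linarith
    have "f3 t - 1 = complex_of_real (\<beta> t / real q ^ 2 + Sq \<mu> q t)" by (simp add: f3_def)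
    then have "norm (f3 t - 1) = \<bar>\<beta> t / real q ^ 2 + Sq \<mu> q t\<bar>" by (simp only: norm_of_real)
    also have "\<dots> \<le> C * \<delta> + C * \<delta>"
      using divle[of "\<beta> t" 1] \<beta>(1)[of t] order_trans[OF S(1)[of t] leC\<delta>]
      by (intro order_trans[OF abs_triangle_ineq] add_mono) simp_all
    also have "\<dots> \<le> 3 * C * \<delta>" using C \<delta> by simp
    finally show "norm (f3 t - 1) \<le> 3 * C * \<delta>" .
    have "f3 s - f3 t = complex_of_real ((\<beta> s - \<beta> t) / real q ^ 2 + (Sq \<mu> q s - Sq \<mu> q t))"
      by (simp add: f3_def diff_divide_distrib)
    then have "norm (f3 s - f3 t) = \<bar>(\<beta> s - \<beta> t) / real q ^ 2 + (Sq \<mu> q s - Sq \<mu> q t)\<bar>"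
      by (simp only: norm_of_real)
    also have "\<dots> \<le> C * \<delta> * \<bar>s - t\<bar> + C * \<delta> * \<bar>s - t\<bar>"
      using divle[OF \<beta>(3)[of s t]] order_trans[OF S(3)[of s t] mult_right_mono[OF leC\<delta>]]
      by (intro order_trans[OF abs_triangle_ineq] add_mono) simp_all
    also have "\<dots> \<le> 3 * C * \<delta> * \<bar>s - t\<bar>" using C \<delta> by (simp add: mult_ac)
    finally show "norm (f3 s - f3 t) \<le> 3 * C * \<delta> * \<bar>s - t\<bar>" .
  qed
  have "near_one (3 * (3 * (8 * C) * (2 * C)) * (3 * C)) \<delta> (\<lambda>t. f1 t * f2 t * f3 t)"
    using C \<delta> by (intro near_one_mult n1 n2 n3) auto
  then have n123: "near_one (432 * C ^ 3) \<delta> (\<lambda>t. f1 t * f2 t * f3 t)"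
    by (simp add: power3_eq_cube mult_ac)

  define y where "y k = x + real k / real q" for k
  \<comment> \<open>The full phase factor and weights, with the terms of order $q^{-4}$.\<close>
  define g1 where "g1 k = cis (2 * pi * real p * (\<alpha> (y k) / real q ^ 2 + ga q k x / real q ^ 4))" for k
  define r2 where "r2 k = 1 + deriv \<alpha> (y k) / real q ^ 2 + deriv (ga q k) x / real q ^ 4" for k
  define r3 where "r3 k = 1 + \<beta> (y k) / real q ^ 2 + Sq \<mu> q (y k) + gc q k x / real q ^ 4" for k
  have pert: "norm (g1 k * complex_of_real (r2 k) * complex_of_real (r3 k) - f1 (y k) * f2 (y k) * f3 (y k))
      \<le> 103 * C ^ 3 * \<eta>" if k: "k < q" for k
  proof -
    have small: "\<bar>a / real q ^ 4\<bar> \<le> C * \<epsilon>" if "\<bar>a\<bar> \<le> C" for a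
      using that leC\<epsilon> divide_right_mono[OF that, of "real q ^ 4"] by simp
    have \<epsilon>le: "C * \<epsilon> \<le> C" "\<epsilon> \<ge> 0" using C by (auto simp: \<epsilon>_def mult_left_le)
    have "norm (g1 k - f1 (y k)) \<le> 8 * C * \<epsilon>"
    proof (cases "real p / real q ^ 4 \<le> 1")
      case True
      have "2 * pi * real p * (\<alpha> (y k) / real q ^ 2 + ga q k x / real q ^ 4) - 2 * pi * real p * (\<alpha> (y k) / real q ^ 2)
          = (2 * pi) * (real p / real q ^ 4 * ga q k x)" by (simp add: algebra_simps)
      then have "norm (g1 k - f1 (y k)) \<le> (2 * pi) * (real p / real q ^ 4 * \<bar>ga q k x\<bar>)"
        unfolding g1_def f1_def by (intro order_trans[OF norm_cis_diff_le]) (simp add: abs_mult)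
      also have "\<dots> \<le> 8 * (real p / real q ^ 4 * C)"
        using pi_less_4 ga(1)[OF k] by (intro mult_mono) auto
      finally show ?thesis using True by (simp add: \<epsilon>_def mult_ac)
    next
      case False
      have "norm (g1 k - f1 (y k)) \<le> norm (g1 k) + norm (f1 (y k))" by (rule norm_triangle_ineq4)
      also have "\<dots> \<le> 8 * C" using C by (simp add: g1_def f1_def)
      finally show ?thesis using False by (simp add: \<epsilon>_def)
    qed
    moreover have "norm (complex_of_real (r2 k) - f2 (y k)) \<le> C * \<epsilon>"
    proof -
      have "complex_of_real (r2 k) - f2 (y k) = complex_of_real (deriv (ga q k) x / real q ^ 4)"
        by (simp add: r2_def f2_def)
      then show ?thesis using small[OF ga(2)[OF k]] by (simp only: norm_of_real)
    qed
    moreover have "norm (complex_of_real (r3 k) - f3 (y k)) \<le> C * \<epsilon>"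
    proof -
      have "complex_of_real (r3 k) - f3 (y k) = complex_of_real (gc q k x / real q ^ 4)"
        by (simp add: r3_def f3_def)
      then show ?thesis using small[OF gc(1)[OF k]] by (simp only: norm_of_real)
    qed
    moreover have "norm (f2 (y k)) \<le> 3 * C" "norm (f3 (y k)) \<le> 3 * C"
      using n2 n3 C unfolding near_one_def by (auto intro: order_trans)
    moreover from calculation have "norm (complex_of_real (r2 k)) \<le> 3 * C" "norm (complex_of_real (r3 k)) \<le> 4 * C"
    proof -
      have "norm (f2 (y k)) \<le> 2 * C" using n2 unfolding near_one_def by blast
      with \<open>norm (complex_of_real (r2 k) - f2 (y k)) \<le> C * \<epsilon>\<close> \<epsilon>le
      show "norm (complex_of_real (r2 k)) \<le> 3 * C"
        using norm_triangle_sub[of "complex_of_real (r2 k)" "f2 (y k)"] by linarith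
      show "norm (complex_of_real (r3 k)) \<le> 4 * C"
        using \<open>norm (complex_of_real (r3 k) - f3 (y k)) \<le> C * \<epsilon>\<close> \<open>norm (f3 (y k)) \<le> 3 * C\<close> \<epsilon>le
          norm_triangle_sub[of "complex_of_real (r3 k)" "f3 (y k)"] by linarith
    qed
    moreover have "norm (f1 (y k)) \<le> 1" by (simp add: f1_def)
    ultimately have "norm (g1 k * complex_of_real (r2 k) * complex_of_real (r3 k) - f1 (y k) * f2 (y k) * f3 (y k))
        \<le> 8 * C * \<epsilon> * (3 * C) * (4 * C) + C * \<epsilon> * (4 * C) + 3 * C * (C * \<epsilon>)"
      by (intro product_perturbation)
    also have "\<dots> = (96 * C ^ 3 + 7 * (C * C)) * \<epsilon>" by (simp add: power3_eq_cube algebra_simps)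
    also have "\<dots> \<le> (103 * C ^ 3) * \<eta>"
      using CC C \<epsilon>\<eta> \<epsilon>le(2) by (intro mult_mono) auto
    finally show ?thesis .
  qed

  define z where "z = cis (2 * pi * real p / real q)"
  have nz: "norm (z ^ k * w) = norm w" for k w by (simp add: z_def norm_mult norm_power)
  have cisy: "cis (2 * pi * real p * y k) = cis (2 * pi * real p * x) * z ^ k" for k
    by (simp add: y_def z_def Complex.DeMoivre cis_mult algebra_simps)
  \<comment> \<open>The difference between the perturbed and the equidistant exponential sum, which splits into
      an oscillatory sum and the contribution of the terms of order $q^{-4}$.\<close>
  define W where "W = (\<Sum>k<q. cis (2 * pi * real p * orbit_x \<alpha> ga q k x) * complex_of_real (r2 k * r3 k)
      - cis (2 * pi * real p * y k))"
  have cisorb: "cis (2 * pi * real p * orbit_x \<alpha> ga q k x) = cis (2 * pi * real p * y k) * g1 k" for k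
    unfolding orbit_x_def g1_def y_def cis_mult by (simp add: algebra_simps)
  have "W = cis (2 * pi * real p * x) * (\<Sum>k<q. z ^ k * (g1 k * complex_of_real (r2 k) * complex_of_real (r3 k) - 1))"
    unfolding W_def cisorb cisy sum_distrib_left by (intro sum.cong) (auto simp: algebra_simps)
  then have "norm W = norm (\<Sum>k<q. z ^ k * (g1 k * complex_of_real (r2 k) * complex_of_real (r3 k) - 1))"
    by (simp add: norm_mult)
  also have "(\<Sum>k<q. z ^ k * (g1 k * complex_of_real (r2 k) * complex_of_real (r3 k) - 1))
      = (\<Sum>k<q. z ^ k * (f1 (y k) * f2 (y k) * f3 (y k) - 1))
        + (\<Sum>k<q. z ^ k * (g1 k * complex_of_real (r2 k) * complex_of_real (r3 k) - f1 (y k) * f2 (y k) * f3 (y k)))"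
    unfolding sum.distrib[symmetric] by (intro sum.cong) (auto simp: algebra_simps)
  also have "norm \<dots> \<le> 2 * real q * (432 * C ^ 3 + 1) * \<eta> + real q * (103 * C ^ 3 * \<eta>)"
  proof (rule norm_triangle_le, rule add_mono)
    show "norm (\<Sum>k<q. z ^ k * (f1 (y k) * f2 (y k) * f3 (y k) - 1)) \<le> 2 * real q * (432 * C ^ 3 + 1) * \<eta>"
      using oscillatory_sum_bound[OF n123 q \<delta>(1), where p=p and x=x] by (simp add: y_def z_def \<eta>_def D_def)
    have "norm (\<Sum>k<q. z ^ k * (g1 k * complex_of_real (r2 k) * complex_of_real (r3 k) - f1 (y k) * f2 (y k) * f3 (y k)))
       \<le> (\<Sum>k<q. 103 * C ^ 3 * \<eta>)"
      by (rule sum_norm_le) (simp add: nz pert)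
    then show "norm (\<Sum>k<q. z ^ k * (g1 k * complex_of_real (r2 k) * complex_of_real (r3 k) - f1 (y k) * f2 (y k) * f3 (y k)))
       \<le> real q * (103 * C ^ 3 * \<eta>)" by simp
  qed
  also have "\<dots> = real q * ((967 * C ^ 3 + 2) * \<eta>)" by (simp add: algebra_simps)
  finally have nW: "norm W \<le> real q * ((967 * C ^ 3 + 2) * \<eta>)" .

  obtain \<phi> where \<phi>: "linear \<phi>" "\<And>z. \<bar>\<phi> z\<bar> \<le> norm z"
    "\<And>y. trig' m y = 2 * pi * real (freq m) * \<phi> (cis (2 * pi * real (freq m) * y))"
    by (rule trig'_cis[of m]) (rule that)
  have lin: "\<phi> (a - b) = \<phi> a - \<phi> b" "\<phi> (w * complex_of_real r) = r * \<phi> w" for a b w r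
    using linear_diff[OF \<phi>(1)] linear_scale[OF \<phi>(1), of r w] by (auto simp: scaleR_conv_of_real mult.commute)
  have "L1_op \<mu> \<alpha> \<beta> ga gc q (trig m) x - 1 / (2 * pi * real q ^ 2) * (\<Sum>k<q. trig' m (x + real k / real q))
      = 1 / (2 * pi * real q ^ 2) * (\<Sum>k<q. trig' m (orbit_x \<alpha> ga q k x) * r2 k * r3 k - trig' m (y k))"
    by (simp add: L1_op_def derivtrig r2_def r3_def y_def right_diff_distrib sum_subtractf)
  also have "(\<Sum>k<q. trig' m (orbit_x \<alpha> ga q k x) * r2 k * r3 k - trig' m (y k)) = 2 * pi * real p * \<phi> W"
    unfolding W_def linear_sum[OF \<phi>(1)] lin \<phi>(3) p_def[symmetric] sum_distrib_left
    by (intro sum.cong) (auto simp: algebra_simps)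
  also have "1 / (2 * pi * real q ^ 2) * (2 * pi * real p * \<phi> W) = \<delta> * \<phi> W"
    by (simp add: \<delta>_def)
  finally have "\<bar>L1_op \<mu> \<alpha> \<beta> ga gc q (trig m) x - 1 / (2 * pi * real q ^ 2) * (\<Sum>k<q. trig' m (x + real k / real q))\<bar>
      = \<delta> * \<bar>\<phi> W\<bar>" using \<delta> by (simp add: abs_mult)
  also have "\<dots> \<le> \<delta> * (real q * ((967 * C ^ 3 + 2) * \<eta>))"
    using order_trans[OF \<phi>(2) nW] \<delta> by (intro mult_left_mono)
  also have "\<dots> = (967 * C ^ 3 + 2) * osc_err q p"
    unfolding err \<delta>_def using q by (simp add: power2_eq_square)
  finally have L1: "\<bar>L1_op \<mu> \<alpha> \<beta> ga gc q (trig m) x - 1 / (2 * pi * real q ^ 2) * (\<Sum>k<q. trig' m (x + real k / real q))\<bar>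
      \<le> (967 * C ^ 3 + 2) * osc_err q p" .
  have "1 / real q ^ 3 \<le> osc_err q p"
  proof (cases "\<delta> / D \<le> 1")
    case True
    have "1 * D \<le> real p * real p" using p Dp D1 by (intro mult_mono) auto
    then have "1 / real q ^ 3 \<le> real p * real p / (real q ^ 3 * D)"
      using q D1 by (simp add: field_simps)
    also have "\<dots> = osc_err q p" unfolding err using True by (simp add: \<eta>_def \<delta>_def eval_nat_numeral)
    finally show ?thesis .
  next
    case False
    have "1 / real q ^ 3 \<le> real p / real q"
      using p q power_increasing[of 1 3 "real q"] by (intro frac_le) auto
    then show ?thesis unfolding err using False by (simp add: \<eta>_def)
  qed
  then have "C / real q ^ 3 \<le> C * osc_err q p" using mult_left_mono[of "1 / real q ^ 3" "osc_err q p" C] C by simp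
  with L1 L2[of m] have "\<bar>L_op \<mu> \<alpha> \<beta> ga gc q (trig m) x
      - 1 / (2 * pi * real q ^ 2) * (\<Sum>k<q. trig' m (x + real k / real q))\<bar>
      \<le> (967 * C ^ 3 + 2) * osc_err q p + C * osc_err q p"
    unfolding L_op_def by linarith
  also have "\<dots> \<le> 970 * C ^ 3 * osc_err q p"
  proof -
    have "osc_err q p \<ge> 0" unfolding err using \<eta>0 by simp
    moreover have "967 * C ^ 3 + 2 + C \<le> 970 * C ^ 3" using CC by linarith
    ultimately show ?thesis unfolding distrib_right[symmetric] by (intro mult_right_mono)
  qed
  finally show "\<bar>L_op \<mu> \<alpha> \<beta> ga gc q (trig m) x
           - 1 / (2 * pi * real q ^ 2) * (\<Sum>k<q. trig' m (x + real k / real q))\<bar>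
         \<le> 970 * C ^ 3 * osc_err q (freq m)" by (simp only: p_def)
qed

section \<open>Summing the errors over all frequencies\<close>

text \<open>If $\gamma_0$ were at most $13/5$, comparing the series with the integral of
  $x^{-8/5}$ over $[2,\infty)$ would make its sum at least $\frac{5}{3} 2^{-3/5}$, which is larger
  than $0.9$ because $0.54^5 < 1/8$.\<close>
lemma gamma0_gt:
  assumes s: "(\<lambda>k. real (k + 2) powr (- (\<gamma>0 - 1))) sums (9 / 10)"
  shows "\<gamma>0 > 13 / 5"
proof (rule ccontr)
  assume "\<not> \<gamma>0 > 13 / 5"
  then have \<gamma>0: "\<gamma>0 \<le> 13 / 5" by simp
  define F where "F x = - (5 / 3) * x powr (- 3 / 5)" for x :: real
  have dF: "(F has_real_derivative x powr (- 8 / 5)) (at x)" if "x > 0" for x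
    unfolding F_def using that by (auto intro!: derivative_eq_intros)
  have step: "F (real (k + 3)) - F (real (k + 2)) \<le> real (k + 2) powr (- (\<gamma>0 - 1))" for k
  proof -
    have "\<exists>z. real (k + 2) < z \<and> z < real (k + 3) \<and>
        F (real (k + 3)) - F (real (k + 2)) = (real (k + 3) - real (k + 2)) * z powr (- 8 / 5)"
    proof (rule MVT2)
      show "(F has_real_derivative t powr (- 8 / 5)) (at t)" if "real (k + 2) \<le> t" for t
        using that by (intro dF) linarith
    qed simp
    then obtain z where z: "real (k + 2) < z" "F (real (k + 3)) - F (real (k + 2)) = z powr (- 8 / 5)"
      by (auto simp del: minus_divide_left)
    note z(2)
    also have "z powr (- 8 / 5) \<le> real (k + 2) powr (- 8 / 5)" using z by (intro powr_mono2') auto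
    also have "\<dots> \<le> real (k + 2) powr (- (\<gamma>0 - 1))" using \<gamma>0 by (intro powr_mono) auto
    finally show ?thesis .
  qed
  have le: "F (real (n + 2)) - F 2 \<le> 9 / 10" for n
  proof -
    have "F (real (n + 2)) - F 2 = (\<Sum>k<n. F (real (Suc k + 2)) - F (real (k + 2)))"
      by (subst sum_lessThan_telescope) simp
    also have "\<dots> \<le> (\<Sum>k<n. real (k + 2) powr (- (\<gamma>0 - 1)))"
      using step by (intro sum_mono) (simp add: eval_nat_numeral)
    also have "\<dots> \<le> 9 / 10" using s by (subst sums_unique[OF s]) (intro sum_le_suminf, auto simp: sums_iff)
    finally show ?thesis .
  qed
  have "(\<lambda>n. F (real (n + 2)) - F 2) \<longlonglongrightarrow> 0 - F 2"
    unfolding F_def by real_asymp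
  then have "- F 2 \<le> 9 / 10" using LIMSEQ_le_const2[of _ "0 - F 2" "9 / 10"] le by auto
  then have a: "2 powr (- 3 / 5) \<le> (27 / 50 :: real)" by (simp add: F_def)
  have "(1 / 8 :: real) = 2 powr (- 3)" by (simp add: powr_minus)
  also have "\<dots> = (2 powr (- 3 / 5)) powr 5" by (simp add: powr_powr)
  also have "\<dots> \<le> (27 / 50) powr 5" using a by (intro powr_mono2) auto
  also have "\<dots> = (27 / 50) ^ 5" by (simp add: powr_numeral)
  finally show False by (simp add: power_divide)
qed

lemma harmonic_tail_le:
  assumes s: "(\<lambda>k. real (k + 2) powr (- (\<gamma>0 - 1))) sums (9 / 10)" and \<gamma>: "\<gamma>0 \<le> \<gamma>"
  shows "(\<Sum>j\<in>{2..<N}. real j powr (1 - \<gamma>)) \<le> 9 / 10"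
proof -
  have "(\<Sum>j\<in>{2..<N}. real j powr (1 - \<gamma>)) = (\<Sum>k<N - 2. real (k + 2) powr (1 - \<gamma>))"
    by (rule sum.reindex_bij_witness[of _ "\<lambda>k. k + 2" "\<lambda>j. j - 2"]) auto
  also have "\<dots> \<le> (\<Sum>k<N - 2. real (k + 2) powr (- (\<gamma>0 - 1)))"
    using \<gamma> by (intro sum_mono powr_mono) auto
  also have "\<dots> \<le> 9 / 10" by (subst sums_unique[OF s]) (intro sum_le_suminf, use s in \<open>auto simp: sums_iff\<close>)
  finally show ?thesis .
qed

lemma sum_inverse_sqrt_le: "(\<Sum>r\<in>{1..n}. 1 / sqrt (real r)) \<le> 2 * sqrt (real n)"
proof (induction n)
  case (Suc n)
  let ?a = "sqrt (real n)" and ?b = "sqrt (real (Suc n))"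
  have b: "?b > 0" by simp
  have "2 * ?a * ?b \<le> ?a ^ 2 + ?b ^ 2" by (rule sum_squares_bound)
  also have "\<dots> = 2 * ?b ^ 2 - 1" by simp
  finally have le: "2 * ?a * ?b + 1 \<le> 2 * ?b ^ 2" by simp
  have "(2 * ?a + 1 / ?b) * ?b = 2 * ?a * ?b + 1" using b by (simp add: distrib_right)
  also note le
  also have "2 * ?b ^ 2 = (2 * ?b) * ?b" by (simp only: power2_eq_square mult.assoc)
  finally have "(2 * ?a + 1 / ?b) * ?b \<le> (2 * ?b) * ?b" .
  then have "2 * ?a + 1 / ?b \<le> 2 * ?b" using b by (simp only: mult_le_cancel_right_pos)
  with Suc show ?case by simp
qed simp

lemma mult_dist_block:
  assumes "r < q"
  shows "mult_dist q (j * q + r) = max 1 (min r (q - r))"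
  using assms by (simp add: mult_dist_def)

lemma sum_reflect_block: "(\<Sum>r\<in>{1..<q}. f (q - r)) = (\<Sum>r\<in>{1..<q}. f r)" for f :: "nat \<Rightarrow> real"
  by (rule sum.reindex_bij_witness[of _ "\<lambda>r. q - r" "\<lambda>r. q - r"]) auto

lemma sum_inverse_sqrt_dist_le:
  assumes q: "q \<ge> 1"
  shows "(\<Sum>r<q. 1 / sqrt (real (max 1 (min r (q - r))))) \<le> 5 * sqrt (real q)"
proof -
  have "{..<q} = insert 0 {1..<q}" using q by auto
  then have "(\<Sum>r<q. 1 / sqrt (real (max 1 (min r (q - r)))))
      = 1 + (\<Sum>r\<in>{1..<q}. 1 / sqrt (real (max 1 (min r (q - r)))))" by simp
  also have "(\<Sum>r\<in>{1..<q}. 1 / sqrt (real (max 1 (min r (q - r)))))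
      \<le> (\<Sum>r\<in>{1..<q}. 1 / sqrt (real r) + 1 / sqrt (real (q - r)))"
    by (intro sum_mono) (auto simp: min_def max_def)
  also have "\<dots> = 2 * (\<Sum>r\<in>{1..<q}. 1 / sqrt (real r))"
    using sum_reflect_block[of "\<lambda>r. 1 / sqrt (real r)" q] by (simp add: sum.distrib)
  also have "(\<Sum>r\<in>{1..<q}. 1 / sqrt (real r)) \<le> (\<Sum>r\<in>{1..q}. 1 / sqrt (real r))" by (rule sum_mono2) auto
  also have "\<dots> \<le> 2 * sqrt (real q)" by (rule sum_inverse_sqrt_le)
  finally have "(\<Sum>r<q. 1 / sqrt (real (max 1 (min r (q - r))))) \<le> 1 + 4 * sqrt (real q)" by simp
  moreover have "1 \<le> sqrt (real q)" using q by simp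
  ultimately show ?thesis by linarith
qed

text \<open>Below \<open>q\<close> the distance from the multiples of \<open>q\<close> is
  \<open>min p (q - p)\<close>, so its inverse is bounded by $1/p + 1/(q-p)$. Since $p^{2-\gamma}
  \le 1$, two harmonic sums remain.\<close>
lemma osc_err_first_block:
  assumes \<gamma>: "\<gamma> > 2" and q: "q \<ge> 1"
  shows "(\<Sum>p<q. real p powr (- \<gamma>) * osc_err q p) \<le> 2 * (1 + ln (real q)) / real q ^ 3"
proof -
  have "{..<q} = insert 0 {1..<q}" using q by auto
  then have "(\<Sum>p<q. real p powr (- \<gamma>) * osc_err q p) = (\<Sum>p\<in>{1..<q}. real p powr (- \<gamma>) * osc_err q p)"
    by simp
  also have "\<dots> \<le> (\<Sum>p\<in>{1..<q}. (1 / real p + 1 / real (q - p)) / real q ^ 3)"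
  proof (rule sum_mono)
    fix p assume "p \<in> {1..<q}"
    then have p: "1 \<le> p" "p < q" by auto
    define D where "D = real (mult_dist q p)"
    have D: "1 / D \<le> 1 / real p + 1 / real (q - p)" "D \<ge> 1"
      using p by (auto simp: D_def mult_dist_def min_def max_def)
    have "real p powr (- \<gamma>) * osc_err q p \<le> real p powr (- \<gamma>) * (real p / real q * (real p / (real q ^ 2 * D)))"
      unfolding osc_err_def D_def by (intro mult_left_mono min.cobounded2) auto
    also have "\<dots> = real p powr (2 - \<gamma>) * (1 / D / real q ^ 3)"
    proof -
      have "real p powr (2 - \<gamma>) = real p powr (- \<gamma>) * real p ^ 2"
        using p powr_add[of "real p" "- \<gamma>" 2] by (simp add: powr_numeral)
      then show ?thesis by (simp add: power2_eq_square power3_eq_cube)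
    qed
    also have "\<dots> \<le> 1 * ((1 / real p + 1 / real (q - p)) / real q ^ 3)"
    proof (intro mult_mono divide_right_mono D)
      show "real p powr (2 - \<gamma>) \<le> 1" using p \<gamma> powr_mono[of "2 - \<gamma>" 0 "real p"] by simp
    qed (use D(2) in auto)
    finally show "real p powr (- \<gamma>) * osc_err q p \<le> (1 / real p + 1 / real (q - p)) / real q ^ 3" by simp
  qed
  also have "\<dots> = 2 * (\<Sum>p\<in>{1..<q}. 1 / real p) / real q ^ 3"
    using sum_reflect_block[of "\<lambda>r. 1 / real r" q] by (simp add: sum.distrib flip: sum_divide_distrib)
  also have "\<dots> \<le> 2 * (1 + ln (real q)) / real q ^ 3"
  proof (intro divide_right_mono mult_left_mono)
    have "(\<Sum>p\<in>{1..<q}. 1 / real p) \<le> (\<Sum>p\<in>{1..q}. 1 / real p)" by (rule sum_mono2) auto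
    also have "\<dots> = harm q" by (simp add: harm_def inverse_eq_divide)
    also have "\<dots> \<le> 1 + ln (real q)"
      using euler_mascheroni_sequence_decreasing[of 1 q] q by (simp add: harm_expand)
    finally show "(\<Sum>p\<in>{1..<q}. 1 / real p) \<le> 1 + ln (real q)" by simp
  qed auto
  finally show ?thesis .
qed

text \<open>Interpolation between the two bounds in the minimum, $\min(1,y) \le y^\theta$ with
  $\theta = 3/5$. The exponent has to exceed $1/2$, because $D^{-\theta} \le D^{-1/2}$ sums to
  $O(\sqrt q)$ over a block of length $q$ and $q^{1/2-\theta}$ has to tend to zero; and it has to
  be less than $\gamma - 2$, because $j^{1-\gamma+\theta}$ has to be summable over the
  blocks.\<close>
lemma osc_err_block:
  assumes \<gamma>: "\<gamma> > 13 / 5" and q: "q \<ge> 1" and j: "j \<ge> 1"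
  shows "(\<Sum>p\<in>{j * q..<j * q + q}. real p powr (- \<gamma>) * osc_err q p)
    \<le> 5 * real j powr (8 / 5 - \<gamma>) * (real q powr (- \<gamma>) * real q powr (- 1 / 10))"
proof -
  have "(\<Sum>p\<in>{j * q..<j * q + q}. real p powr (- \<gamma>) * osc_err q p)
      = (\<Sum>r<q. real (j * q + r) powr (- \<gamma>) * osc_err q (j * q + r))"
    by (rule sum.reindex_bij_witness[of _ "\<lambda>r. j * q + r" "\<lambda>p. p - j * q"]) auto
  also have "\<dots> \<le> (\<Sum>r<q. real j powr (8 / 5 - \<gamma>) * (real q powr (- \<gamma>) * real q powr (- 3 / 5))
        * (1 / sqrt (real (max 1 (min r (q - r))))))"
  proof (rule sum_mono)
    fix r assume "r \<in> {..<q}"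
    then have r: "r < q" by simp
    define p where "p = j * q + r"
    define D where "D = real (max 1 (min r (q - r)))"
    have D: "real (mult_dist q p) = D" "D \<ge> 1" unfolding p_def D_def by (auto simp: mult_dist_block[OF r])
    have "real j * real q > 0" using j q by simp
    then have pj: "real p \<ge> real j * real q" "real p > 0" unfolding p_def by simp_all
    define y where "y = real p / (real q ^ 2 * D)"
    have y: "y > 0" using pj q D by (simp add: y_def)
    have "min 1 y \<le> y powr (3 / 5)"
    proof (cases "y \<le> 1")
      case True
      then have "y powr 1 \<le> y powr (3 / 5)" using y by (intro powr_mono') auto
      then show ?thesis using y True by simp
    next
      case False
      then have "1 \<le> y powr (3 / 5)" by (intro ge_one_powr_ge_zero) auto
      then show ?thesis by simp
    qed
    also have "y powr (3 / 5) = real p powr (3 / 5) * real q powr (- 6 / 5) * D powr (- 3 / 5)"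
    proof -
      have "y = real p * real q powr (- 2) * D powr (- 1)"
        unfolding y_def using q D(2) by (simp add: powr_minus powr_numeral divide_inverse)
      then have "y powr (3 / 5) = real p powr (3 / 5) * (real q powr (- 2)) powr (3 / 5) * (D powr (- 1)) powr (3 / 5)"
        by (simp only: powr_mult)
      then show ?thesis by (simp only: powr_powr) simp
    qed
    also have "\<dots> \<le> real p powr (3 / 5) * real q powr (- 6 / 5) * (1 / sqrt D)"
    proof (intro mult_left_mono)
      have "D powr (- 3 / 5) \<le> D powr (- (1 / 2))" using D(2) by (intro powr_mono) auto
      also have "\<dots> = 1 / sqrt D" using D(2) by (simp only: powr_minus powr_half_sqrt) (simp add: inverse_eq_divide)
      finally show "D powr (- 3 / 5) \<le> 1 / sqrt D" .
    qed auto
    finally have "real p powr (- \<gamma>) * osc_err q p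
        \<le> real p powr (- \<gamma>) * (real p / real q * (real p powr (3 / 5) * real q powr (- 6 / 5) * (1 / sqrt D)))"
      unfolding osc_err_def D(1) y_def by (intro mult_left_mono) auto
    also have "\<dots> = real p powr (8 / 5 - \<gamma>) * (real q powr (- 11 / 5) * (1 / sqrt D))"
    proof -
      have "real p powr (8 / 5 - \<gamma>) = real p powr (- \<gamma>) * (real p * real p powr (3 / 5))"
        using pj(2) powr_add[of "real p" "- \<gamma>" "8 / 5"] powr_add[of "real p" 1 "3 / 5"] by simp
      moreover have "real q powr (- 11 / 5) = real q powr (- 6 / 5) / real q"
        using q powr_diff[of "real q" "- 6 / 5" 1] by simp
      ultimately show ?thesis by simp
    qed
    also have "\<dots> \<le> (real j * real q) powr (8 / 5 - \<gamma>) * (real q powr (- 11 / 5) * (1 / sqrt D))"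
      using pj j q \<gamma> D by (intro mult_right_mono powr_mono2') auto
    also have "\<dots> = real j powr (8 / 5 - \<gamma>) * (real q powr (- \<gamma>) * real q powr (- 3 / 5)) * (1 / sqrt D)"
    proof -
      have "real q powr (8 / 5 - \<gamma>) * real q powr (- 11 / 5) = real q powr (- \<gamma>) * real q powr (- 3 / 5)"
        unfolding powr_add[symmetric] by (rule arg_cong[of _ _ "(powr) (real q)"]) simp
      then show ?thesis by (simp add: powr_mult)
    qed
    finally show "real (j * q + r) powr (- \<gamma>) * osc_err q (j * q + r)
      \<le> real j powr (8 / 5 - \<gamma>) * (real q powr (- \<gamma>) * real q powr (- 3 / 5))
        * (1 / sqrt (real (max 1 (min r (q - r)))))" unfolding p_def D_def .
  qed
  also have "\<dots> = real j powr (8 / 5 - \<gamma>) * (real q powr (- \<gamma>) * real q powr (- 3 / 5))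
      * (\<Sum>r<q. 1 / sqrt (real (max 1 (min r (q - r)))))" by (rule sum_distrib_left[symmetric])
  also have "\<dots> \<le> real j powr (8 / 5 - \<gamma>) * (real q powr (- \<gamma>) * real q powr (- 3 / 5)) * (5 * sqrt (real q))"
    by (intro mult_left_mono sum_inverse_sqrt_dist_le q) auto
  also have "\<dots> = 5 * real j powr (8 / 5 - \<gamma>) * (real q powr (- \<gamma>) * (real q powr (- 3 / 5) * real q powr (1 / 2)))"
    by (simp add: powr_half_sqrt)
  also have "real q powr (- 3 / 5) * real q powr (1 / 2) = real q powr (- 1 / 10)"
    by (simp add: powr_add[symmetric])
  finally show ?thesis .
qed

text \<open>The sum is cut into blocks of length \<open>q\<close>. Partial sums over whole blocks
  suffice, since all terms are nonnegative.\<close>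
lemma osc_err_row_small:
  assumes \<gamma>: "13 / 5 < \<gamma>" "\<gamma> < 3"
  obtains \<epsilon> :: "nat \<Rightarrow> real" where "\<epsilon> \<longlonglongrightarrow> 0"
    and "\<And>q N. q \<ge> 1 \<Longrightarrow> (\<Sum>p<N * q. real p powr (- \<gamma>) * osc_err q p) \<le> \<epsilon> q * real q powr (- \<gamma>)"
proof -
  have sZ: "summable (\<lambda>j. real j powr (8 / 5 - \<gamma>))" using \<gamma> by (simp add: summable_real_powr_iff)
  define Z where "Z = (\<Sum>j. real j powr (8 / 5 - \<gamma>))"
  define \<epsilon> where "\<epsilon> q = 2 * (1 + ln (real q)) * real q powr (\<gamma> - 3) + 5 * Z * real q powr (- 1 / 10)" for q :: nat
  have "\<epsilon> \<longlonglongrightarrow> 0"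
  proof -
    define s where "s = 3 - \<gamma>"
    have s: "s > 0" using \<gamma> by (simp add: s_def)
    have "(\<lambda>q::nat. 2 * (1 + ln (real q)) * real q powr (- s)) \<longlonglongrightarrow> 0" using s by real_asymp
    moreover have "(\<lambda>q::nat. 5 * Z * real q powr (- 1 / 10)) \<longlonglongrightarrow> 5 * Z * 0"
      by (intro tendsto_mult tendsto_const) real_asymp
    ultimately have "(\<lambda>q::nat. 2 * (1 + ln (real q)) * real q powr (- s) + 5 * Z * real q powr (- 1 / 10)) \<longlonglongrightarrow> 0 + 5 * Z * 0"
      by (rule tendsto_add)
    then show ?thesis by (simp add: \<epsilon>_def[abs_def] s_def)
  qed
  moreover have "(\<Sum>p<N * q. real p powr (- \<gamma>) * osc_err q p) \<le> \<epsilon> q * real q powr (- \<gamma>)" if q: "q \<ge> 1" for q N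
  proof -
    let ?f = "\<lambda>p. real p powr (- \<gamma>) * osc_err q p"
    have f0: "?f p \<ge> 0" for p by (simp add: osc_err_def)
    have c: "5 * (real q powr (- \<gamma>) * real q powr (- 1 / 10)) \<ge> 0" by simp
    have "(\<Sum>p<N * q. ?f p) \<le> (\<Sum>p<Suc N * q. ?f p)" by (rule sum_mono2) (auto simp: f0)
    also have "\<dots> = (\<Sum>j<Suc N. sum ?f {j * q..<j * q + q})" by (rule sum.nat_group[symmetric])
    also have "\<dots> = sum ?f {..<q} + (\<Sum>j<N. sum ?f {Suc j * q..<Suc j * q + q})"
      by (subst sum.lessThan_Suc_shift) (simp add: lessThan_atLeast0)
    also have "\<dots> \<le> 2 * (1 + ln (real q)) / real q ^ 3
        + (\<Sum>j<N. 5 * real (Suc j) powr (8 / 5 - \<gamma>) * (real q powr (- \<gamma>) * real q powr (- 1 / 10)))"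
      using \<gamma> q by (intro add_mono sum_mono osc_err_first_block osc_err_block) auto
    also have "(\<Sum>j<N. 5 * real (Suc j) powr (8 / 5 - \<gamma>) * (real q powr (- \<gamma>) * real q powr (- 1 / 10)))
        = 5 * (real q powr (- \<gamma>) * real q powr (- 1 / 10)) * (\<Sum>j<N. real (Suc j) powr (8 / 5 - \<gamma>))"
      by (simp add: sum_distrib_left mult_ac)
    also have "\<dots> \<le> 5 * (real q powr (- \<gamma>) * real q powr (- 1 / 10)) * Z"
    proof (rule mult_left_mono[OF _ c])
      have "(\<Sum>j<N. real (Suc j) powr (8 / 5 - \<gamma>)) = (\<Sum>j<Suc N. real j powr (8 / 5 - \<gamma>))"
        by (subst sum.lessThan_Suc_shift) simp
      also have "\<dots> \<le> Z" unfolding Z_def by (rule sum_le_suminf[OF sZ]) auto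
      finally show "(\<Sum>j<N. real (Suc j) powr (8 / 5 - \<gamma>)) \<le> Z" .
    qed
    also have "2 * (1 + ln (real q)) / real q ^ 3 = 2 * (1 + ln (real q)) * real q powr (\<gamma> - 3) * real q powr (- \<gamma>)"
    proof -
      have "real q powr (\<gamma> - 3) * real q powr (- \<gamma>) = real q powr (- 3)" by (simp add: powr_add[symmetric])
      also have "\<dots> = 1 / real q ^ 3" using q by (simp add: powr_minus powr_numeral inverse_eq_divide)
      finally show ?thesis by (metis mult.assoc mult.right_neutral times_divide_eq_right)
    qed
    finally show ?thesis by (simp add: \<epsilon>_def algebra_simps)
  qed
  ultimately show ?thesis by (rule that)
qed

text \<open>The frequency \<open>p = q\<close> is excluded because it carries the diagonal place;
  there the unperturbed matrix agrees with the identity.\<close>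
lemma multiples_sum:
  assumes q: "q \<ge> 1"
  shows "(\<Sum>p<N * q. real p powr (- \<gamma>) * (if q dvd p \<and> p \<noteq> 0 \<and> p \<noteq> q then real p / real q else 0))
    = real q powr (- \<gamma>) * (\<Sum>j\<in>{2..<N}. real j powr (1 - \<gamma>))"
proof -
  let ?f = "\<lambda>p. real p powr (- \<gamma>) * (if q dvd p \<and> p \<noteq> 0 \<and> p \<noteq> q then real p / real q else 0)"
  have inj: "inj_on (\<lambda>j. j * q) {2..<N}" using q by (auto simp: inj_on_def)
  have "(\<Sum>p<N * q. ?f p) = (\<Sum>p\<in>(\<lambda>j. j * q) ` {2..<N}. ?f p)"
  proof (rule sum.mono_neutral_right)
    show "(\<lambda>j. j * q) ` {2..<N} \<subseteq> {..<N * q}" using q by auto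
    show "\<forall>p\<in>{..<N * q} - (\<lambda>j. j * q) ` {2..<N}. ?f p = 0"
    proof
      fix p assume p: "p \<in> {..<N * q} - (\<lambda>j. j * q) ` {2..<N}"
      have False if "q dvd p" "p \<noteq> 0" "p \<noteq> q"
      proof -
        obtain j where j: "p = j * q" using \<open>q dvd p\<close> by (metis dvd_def mult.commute)
        with that have "j \<noteq> 0" "j \<noteq> 1" by auto
        moreover have "j < N" using p j q by simp
        ultimately show False using p j by auto
      qed
      then show "?f p = 0" by auto
    qed
  qed simp
  also have "\<dots> = (\<Sum>j\<in>{2..<N}. ?f (j * q))" by (rule sum.reindex[OF inj, unfolded o_def])
  also have "\<dots> = (\<Sum>j\<in>{2..<N}. real q powr (- \<gamma>) * real j powr (1 - \<gamma>))"
  proof (rule sum.cong[OF refl])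
    fix j assume "j \<in> {2..<N}"
    moreover from this have "real j powr (1 - \<gamma>) = real j powr (- \<gamma>) * real j"
      using powr_add[of "real j" "- \<gamma>" 1] by simp
    ultimately show "?f (j * q) = real q powr (- \<gamma>) * real j powr (1 - \<gamma>)"
      using q by (simp add: powr_mult)
  qed
  finally show ?thesis by (simp add: sum_distrib_left)
qed

section \<open>The matrix of the operator\<close>

lemma fcoef_trig: "fcoef (trig m) n = of_bool (m = n)"
  by (simp add: fcoef_def trig_orthogonal)

text \<open>The operator evaluates \<open>f\<close> and its derivative at finitely many points,
  and both have pointwise convergent expansions.\<close>
lemma L_op_expansion:
  assumes \<gamma>: "\<gamma> > 2" and f: "f \<in> X_space \<gamma>"
  shows "(\<lambda>m. fcoef f m * L_op \<mu> \<alpha> \<beta> ga gc q (trig m) x) sums L_op \<mu> \<alpha> \<beta> ga gc q f x"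
proof -
  let ?c = "fcoef f"
  have h: "?c \<in> h_space \<gamma>" using f by (simp add: X_space_iff)
  note ser = trig_series[OF \<gamma> h_spaceD[OF h]]
  have fe: "f = (\<lambda>x. \<Sum>n. ?c n * trig n x)" by (rule X_space_expansion[OF \<gamma> f])
  have "(f has_field_derivative (\<Sum>n. ?c n * trig' n y)) (at y)" for y
    by (subst fe) (rule ser(3))
  then have df: "deriv f y = (\<Sum>n. ?c n * trig' n y)" for y by (rule DERIV_imp_deriv)
  have s0: "(\<lambda>m. ?c m * trig m y) sums f y" for y
    using summable_sums[OF ser(1)[of y]] fun_cong[OF fe, of y] by simp
  have s1: "(\<lambda>m. ?c m * deriv (trig m) y) sums deriv f y" for y
    using summable_sums[OF ser(2)[of y]] by (simp add: df DERIV_imp_deriv[OF trig_has_derivative])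
  define Y where "Y k = orbit_x \<alpha> ga q k x" for k
  define A where "A k = (1 + deriv \<alpha> (x + real k / real q) / real q ^ 2 + deriv (ga q k) x / real q ^ 4) *
        (1 + \<beta> (x + real k / real q) / real q ^ 2 + Sq \<mu> q (x + real k / real q) + gc q k x / real q ^ 4)" for k
  define B where "B k = deriv \<beta> (x + real k / real q) / real q ^ 2 + deriv (Sq \<mu> q) (x + real k / real q)
           + deriv (gc q k) x / real q ^ 4" for k
  have L: "L_op \<mu> \<alpha> \<beta> ga gc q g x
      = 1 / (2 * pi * real q ^ 2) * ((\<Sum>k<q. deriv g (Y k) * A k) + (\<Sum>k<q. g (Y k) * B k))" for g
  proof -
    have "L1_op \<mu> \<alpha> \<beta> ga gc q g x = 1 / (2 * pi * real q ^ 2) * (\<Sum>k<q. deriv g (Y k) * A k)"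
      by (simp only: L1_op_def Y_def A_def mult.assoc)
    moreover have "L2_op \<mu> \<alpha> \<beta> ga gc q g x = 1 / (2 * pi * real q ^ 2) * (\<Sum>k<q. g (Y k) * B k)"
      by (simp only: L2_op_def Y_def B_def)
    ultimately show ?thesis by (simp only: L_op_def distrib_left)
  qed
  have "(\<lambda>m. 1 / (2 * pi * real q ^ 2) * ((\<Sum>k<q. (?c m * deriv (trig m) (Y k)) * A k) + (\<Sum>k<q. (?c m * trig m (Y k)) * B k)))
      sums L_op \<mu> \<alpha> \<beta> ga gc q f x"
    unfolding L by (intro sums_mult sums_add sums_sum sums_mult2 s0 s1)
  moreover have "1 / (2 * pi * real q ^ 2) * ((\<Sum>k<q. (?c m * deriv (trig m) (Y k)) * A k) + (\<Sum>k<q. (?c m * trig m (Y k)) * B k))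
      = ?c m * L_op \<mu> \<alpha> \<beta> ga gc q (trig m) x" for m
    unfolding L by (simp add: sum_distrib_left sum_divide_distrib distrib_left mult_ac)
  ultimately show ?thesis by simp
qed

lemma I_op_eq:
  "I_op \<mu> \<alpha> \<beta> ga gc qbar f n = (if freq n < qbar \<or> n = 0 then fcoef f n
     else L_op \<mu> \<alpha> \<beta> ga gc (freq n) f (if odd n then 3 / (4 * real (freq n)) else 0))"
proof (cases "n = 0")
  case True
  then show ?thesis by (simp add: I_op_def fcoef_def fourier_a_def trig_def)
next
  case False
  then have "freq n \<noteq> 0" by simp
  then have "fourier_a f (freq n) = fcoef f n" if "odd n"
    using that False by (simp add: fourier_a_def fcoef_def trig_def)
  moreover have "fourier_b f (freq n) = fcoef f n" if "even n"
    using that False by (simp add: fourier_b_def fcoef_def trig_def)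
  ultimately show ?thesis using False by (auto simp: I_op_def Let_def freq_def)
qed

text \<open>The numbers \<open>I_op \<mu> \<alpha> \<beta> ga gc qbar (trig m) n\<close> are thus
  the entries of the matrix of the operator in terms of Fourier coefficients.\<close>
lemma I_op_expansion:
  assumes \<gamma>: "\<gamma> > 2" and f: "f \<in> X_space \<gamma>"
  shows "(\<lambda>m. fcoef f m * I_op \<mu> \<alpha> \<beta> ga gc qbar (trig m) n) sums I_op \<mu> \<alpha> \<beta> ga gc qbar f n"
proof (cases "freq n < qbar \<or> n = 0")
  case True
  have "(\<lambda>m. if m = n then fcoef f m else 0) sums fcoef f n" by (rule sums_single)
  moreover have "(\<lambda>m. if m = n then fcoef f m else 0) = (\<lambda>m. fcoef f m * of_bool (m = n))" by auto
  ultimately show ?thesis using True by (simp add: I_op_eq fcoef_trig)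
next
  case False
  then have "I_op \<mu> \<alpha> \<beta> ga gc qbar g n
      = L_op \<mu> \<alpha> \<beta> ga gc (freq n) g (if odd n then 3 / (4 * real (freq n)) else 0)" for g
    unfolding I_op_eq by (rule if_not_P)
  then show ?thesis using L_op_expansion[OF assms] by simp
qed

text \<open>The powers of a root of unity other than 1 sum to zero; at a multiple of
  \<open>q\<close> all summands agree.\<close>
lemma sum_trig'_equidistant:
  assumes q: "q \<ge> 1"
  shows "(\<Sum>k<q. trig' m (x + real k / real q)) = (if q dvd freq m then real q * trig' m x else 0)"
proof -
  define p where "p = freq m"
  define z where "z = cis (2 * pi * real p / real q)"
  obtain \<phi> where \<phi>': "linear \<phi>"
    "\<And>y. trig' m y = 2 * pi * real (freq m) * \<phi> (cis (2 * pi * real (freq m) * y))"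
    by (rule trig'_cis[of m]) (rule that)
  note \<phi> = \<phi>'[folded p_def]
  have "cis (2 * pi * real p * (x + real k / real q)) = cis (2 * pi * real p * x) * z ^ k" for k
    by (simp add: z_def Complex.DeMoivre cis_mult algebra_simps)
  then have sum: "(\<Sum>k<q. trig' m (x + real k / real q))
      = 2 * pi * real p * \<phi> (cis (2 * pi * real p * x) * (\<Sum>k<q. z ^ k))"
    by (simp add: \<phi>(2) linear_sum[OF \<phi>(1)] sum_distrib_left)
  have zq: "z ^ q = 1"
  proof -
    have "z ^ q = cis (real q * (2 * pi * real p / real q))" unfolding z_def by (rule Complex.DeMoivre)
    also have "\<dots> = cis (2 * pi * real p)" using q by simp
    also have "\<dots> = 1" by (rule cis_multiple_2pi) simp
    finally show ?thesis .
  qed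
  show ?thesis
  proof (cases "q dvd p")
    case True
    then obtain j where "p = q * j" by blast
    then have "2 * pi * real p / real q = 2 * pi * real j" using q by simp
    then have "z = 1" unfolding z_def by (simp only:) (rule cis_multiple_2pi, simp)
    then have "(\<Sum>k<q. z ^ k) = of_nat q" by simp
    moreover have "\<phi> (w * of_nat q) = real q * \<phi> w" for w
      using linear_scale[OF \<phi>(1), of "real q" w] by (simp add: scaleR_conv_of_real mult.commute)
    ultimately have "(\<Sum>k<q. trig' m (x + real k / real q)) = real q * trig' m x"
      by (simp only: sum) (simp add: \<phi>(2))
    then show ?thesis using True by (simp add: p_def)
  next
    case False
    have "z \<noteq> 1"
    proof
      assume "z = 1"
      then have "cos (2 * pi * real p / real q) = 1" unfolding z_def by (simp add: complex_eq_iff)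
      then obtain i :: int where "2 * pi * real p / real q = of_int i * 2 * pi"
        unfolding cos_one_2pi_int by blast
      then have "real p = of_int i * real q" using q by (simp add: field_simps)
      then have "int p = i * int q" by (metis of_int_eq_iff of_int_mult of_int_of_nat_eq)
      then have "int q dvd int p" by simp
      with False show False by simp
    qed
    then have "(\<Sum>k<q. z ^ k) = 0" using zq by (simp add: geometric_sum)
    then show ?thesis using False sum linear_0[OF \<phi>(1)] by (simp add: p_def)
  qed
qed

text \<open>For $p = jq$ and the phase $\theta = 2 \pi p x$, the two entries are $-j \sin\theta$
  and $j \cos\theta$. The evaluation points are chosen such that $\theta$ is $0$ or $3\pi j/2$, a
  multiple of a right angle, so one of the two entries vanishes; for $j = 1$ the other one is $+1$
  and belongs to the position \<open>n\<close> itself.\<close>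
lemma unperturbed_row:
  assumes n: "n \<noteq> 0" and q: "q = freq n" and p: "p \<ge> 1"
    and x: "x = (if odd n then 3 / (4 * real q) else 0)"
    and L: "\<And>m. L m = 1 / (2 * pi * real q ^ 2) * (\<Sum>k<q. trig' m (x + real k / real q))"
  shows "\<bar>L (2 * p - 1) - of_bool (2 * p - 1 = n)\<bar> + \<bar>L (2 * p) - of_bool (2 * p = n)\<bar>
    \<le> (if q dvd p \<and> p \<noteq> 0 \<and> p \<noteq> q then real p / real q else 0)"
proof -
  have q1: "q \<ge> 1" using n freq_eq_0[of n] unfolding q by linarith
  have fr: "freq (2 * p - 1) = p" "freq (2 * p) = p" using p by simp_all
  have Lm: "L m = (if q dvd freq m then 1 / (2 * pi * real q) * trig' m x else 0)" for m
    unfolding L sum_trig'_equidistant[OF q1] using q1 by (simp add: power2_eq_square)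
  show ?thesis
  proof (cases "q dvd p")
    case False
    then have "p \<noteq> q" by auto
    then have "2 * p - 1 \<noteq> n" "2 * p \<noteq> n" using fr q by metis+
    then show ?thesis using False p by (simp add: Lm fr)
  next
    case True
    then obtain j where pj: "p = q * j" by blast
    have j: "j \<ge> 1" using p pj by (cases j) auto
    define \<theta> where "\<theta> = 2 * pi * real p * x"
    have L1: "L (2 * p - 1) = - (real j * sin \<theta>)" and L2: "L (2 * p) = real j * cos \<theta>"
      using True p q1 by (simp_all add: Lm fr trig'_def \<theta>_def pj)
    have \<theta>: "\<theta> = (if odd n then real j * (3 / 2 * pi) else 0)" using q1 by (simp add: \<theta>_def x pj)
    have sc: "\<bar>sin \<theta>\<bar> + \<bar>cos \<theta>\<bar> \<le> 1"
    proof (cases "odd n")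
      case True
      have "2 * (sin \<theta> * cos \<theta>) = sin (2 * \<theta>)" by (simp add: sin_double)
      also have "2 * \<theta> = real (3 * j) * pi" using True by (simp add: \<theta>)
      also have "sin \<dots> = 0" by (rule sin_npi)
      finally have "sin \<theta> = 0 \<or> cos \<theta> = 0" by simp
      then show ?thesis by auto
    qed (simp add: \<theta>)
    show ?thesis
    proof (cases "p = q")
      case True
      then have "j = 1" using pj q1 by simp
      have n2: "n = (if odd n then 2 * p - 1 else 2 * p)"
        using True n unfolding q freq_def by presburger
      show ?thesis
      proof (cases "odd n")
        case odd: True
        then have "2 * p - 1 = n" "2 * p \<noteq> n" using n2 p by auto
        moreover have "sin \<theta> = - 1" "cos \<theta> = 0" using odd \<open>j = 1\<close> sin_3over2_pi cos_3over2_pi by (simp_all add: \<theta>)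
        ultimately show ?thesis unfolding L1 L2 using \<open>j = 1\<close> True by simp
      next
        case even: False
        then have "2 * p - 1 \<noteq> n" "2 * p = n" using n2 p by auto
        then show ?thesis unfolding L1 L2 using \<open>j = 1\<close> True even by (simp add: \<theta>)
      qed
    next
      case False
      then have "2 * p - 1 \<noteq> n" "2 * p \<noteq> n" using fr q by metis+
      then have "\<bar>L (2 * p - 1) - of_bool (2 * p - 1 = n)\<bar> + \<bar>L (2 * p) - of_bool (2 * p = n)\<bar>
          = real j * (\<bar>sin \<theta>\<bar> + \<bar>cos \<theta>\<bar>)"
        unfolding L1 L2 by (simp add: abs_mult distrib_left)
      also have "\<dots> \<le> real j * 1" by (intro mult_left_mono sc) simp
      also have "real j * 1 = real p / real q" using pj q1 by simp
      finally show ?thesis using True False p by simp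
    qed
  qed
qed

lemma sum_pairs: "(\<Sum>m<2 * M + 1. a m) = a 0 + (\<Sum>p\<in>{1..M}. a (2 * p - 1) + a (2 * p))" for a :: "nat \<Rightarrow> real"
  by (induction M) (auto simp: algebra_simps)

text \<open>The two positions of each frequency are grouped, so that the bound of an unperturbed
  row can be used for their sum rather than for each of them; bounding them separately would
  double $\tau$ and spoil the contraction.\<close>
lemma weighted_row_bound:
  assumes \<gamma>: "\<gamma> > 2" and q: "q \<ge> 1" and K: "K \<ge> 0"
    and a0: "\<bar>a 0\<bar> \<le> a'"
    and a: "\<And>p. p \<ge> 1 \<Longrightarrow> \<bar>a (2 * p - 1)\<bar> + \<bar>a (2 * p)\<bar>
      \<le> (if q dvd p \<and> p \<noteq> 0 \<and> p \<noteq> q then real p / real q else 0) + K * osc_err q p"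
    and t: "\<And>N. (\<Sum>j\<in>{2..<N}. real j powr (1 - \<gamma>)) \<le> \<tau>"
    and e: "\<And>N. (\<Sum>p<N * q. real p powr (- \<gamma>) * osc_err q p) \<le> \<epsilon> * real q powr (- \<gamma>)"
  shows "summable (\<lambda>m. \<bar>a m\<bar> / weight \<gamma> m)"
    and "real q powr \<gamma> * (\<Sum>m. \<bar>a m\<bar> / weight \<gamma> m) \<le> a' * real q powr \<gamma> + \<tau> + K * \<epsilon>"
proof -
  let ?S = "a' + real q powr (- \<gamma>) * \<tau> + K * (\<epsilon> * real q powr (- \<gamma>))"
  let ?g = "\<lambda>p. if q dvd p \<and> p \<noteq> 0 \<and> p \<noteq> q then real p / real q else 0"
  have nn: "\<bar>a m\<bar> / weight \<gamma> m \<ge> 0" for m using weight_pos[of \<gamma> m] by simp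
  have part: "(\<Sum>m<2 * M + 1. \<bar>a m\<bar> / weight \<gamma> m) \<le> ?S" for M
  proof -
    have "(\<Sum>m<2 * M + 1. \<bar>a m\<bar> / weight \<gamma> m) = \<bar>a 0\<bar> / weight \<gamma> 0
        + (\<Sum>p\<in>{1..M}. \<bar>a (2 * p - 1)\<bar> / weight \<gamma> (2 * p - 1) + \<bar>a (2 * p)\<bar> / weight \<gamma> (2 * p))"
      by (rule sum_pairs)
    also have "\<dots> \<le> a' + (\<Sum>p\<in>{1..M}. real p powr (- \<gamma>) * ?g p + K * (real p powr (- \<gamma>) * osc_err q p))"
    proof (rule add_mono[OF _ sum_mono])
      show "\<bar>a 0\<bar> / weight \<gamma> 0 \<le> a'" using a0 by (simp add: weight_def)
      fix p assume "p \<in> {1..M}"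
      then have p: "p \<ge> 1" by simp
      then have "weight \<gamma> (2 * p - 1) = real p powr \<gamma>" "weight \<gamma> (2 * p) = real p powr \<gamma>"
        by (simp_all add: weight_def)
      then have "\<bar>a (2 * p - 1)\<bar> / weight \<gamma> (2 * p - 1) + \<bar>a (2 * p)\<bar> / weight \<gamma> (2 * p)
          = real p powr (- \<gamma>) * (\<bar>a (2 * p - 1)\<bar> + \<bar>a (2 * p)\<bar>)"
        by (simp add: powr_minus_divide add_divide_distrib)
      also have "\<dots> \<le> real p powr (- \<gamma>) * (?g p + K * osc_err q p)"
        by (intro mult_left_mono a p) simp
      finally show "\<bar>a (2 * p - 1)\<bar> / weight \<gamma> (2 * p - 1) + \<bar>a (2 * p)\<bar> / weight \<gamma> (2 * p)
          \<le> real p powr (- \<gamma>) * ?g p + K * (real p powr (- \<gamma>) * osc_err q p)"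
        by (simp only: distrib_left mult.left_commute)
    qed
    also have "(\<Sum>p\<in>{1..M}. real p powr (- \<gamma>) * ?g p + K * (real p powr (- \<gamma>) * osc_err q p))
        \<le> (\<Sum>p<(M + 1) * q. real p powr (- \<gamma>) * ?g p + K * (real p powr (- \<gamma>) * osc_err q p))"
    proof (rule sum_mono2)
      show "{1..M} \<subseteq> {..<(M + 1) * q}"
      proof
        fix p assume "p \<in> {1..M}"
        then have "p < (M + 1) * 1" by simp
        also have "\<dots> \<le> (M + 1) * q" using q by (rule mult_left_mono) simp
        finally show "p \<in> {..<(M + 1) * q}" by simp
      qed
      show "0 \<le> real p powr (- \<gamma>) * ?g p + K * (real p powr (- \<gamma>) * osc_err q p)" for p
        using K by (intro add_nonneg_nonneg mult_nonneg_nonneg) (auto simp: osc_err_def)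
    qed simp
    also have "\<dots> = (\<Sum>p<(M + 1) * q. real p powr (- \<gamma>) * ?g p)
        + K * (\<Sum>p<(M + 1) * q. real p powr (- \<gamma>) * osc_err q p)"
      by (simp only: sum.distrib sum_distrib_left)
    also have "\<dots> \<le> real q powr (- \<gamma>) * \<tau> + K * (\<epsilon> * real q powr (- \<gamma>))"
      unfolding multiples_sum[OF q] by (intro add_mono mult_left_mono t e K) simp
    finally show ?thesis by simp
  qed
  have le: "(\<Sum>m<n. \<bar>a m\<bar> / weight \<gamma> m) \<le> ?S" for n
    by (rule order_trans[OF sum_mono2 part[of n]]) (auto simp: nn)
  show s: "summable (\<lambda>m. \<bar>a m\<bar> / weight \<gamma> m)" by (rule summableI_nonneg_bounded[OF nn le])
  have "(\<Sum>m. \<bar>a m\<bar> / weight \<gamma> m) \<le> ?S" by (rule suminf_le_const[OF s le])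
  then have "real q powr \<gamma> * (\<Sum>m. \<bar>a m\<bar> / weight \<gamma> m) \<le> real q powr \<gamma> * ?S"
    by (rule mult_left_mono) simp
  also have "\<dots> = a' * real q powr \<gamma> + \<tau> + K * \<epsilon>"
    using q by (simp add: powr_minus algebra_simps)
  finally show "real q powr \<gamma> * (\<Sum>m. \<bar>a m\<bar> / weight \<gamma> m) \<le> a' * real q powr \<gamma> + \<tau> + K * \<epsilon>" .
qed

section \<open>Invertibility\<close>

lemma fcoef_add:
  assumes "continuous_on UNIV f" "continuous_on UNIV g"
  shows "fcoef (\<lambda>x. f x + g x) n = fcoef f n + fcoef g n"
proof -
  have "integral {0..1} (\<lambda>x. (f x + g x) * trig n x)
      = integral {0..1} (\<lambda>x. f x * trig n x) + integral {0..1} (\<lambda>x. g x * trig n x)"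
    unfolding distrib_right
    by (intro integral_add integrable_continuous_real continuous_on_mult continuous_on_trig
        continuous_on_subset[OF assms(1)] continuous_on_subset[OF assms(2)]) auto
  then show ?thesis by (simp only: fcoef_def distrib_left)
qed

lemma fcoef_scale: "fcoef (\<lambda>x. a * f x) n = a * fcoef f n"
  by (simp add: fcoef_def mult.assoc)

lemma h_space_add:
  assumes "c \<in> h_space \<gamma>" "d \<in> h_space \<gamma>"
  shows "(\<lambda>n. c n + d n) \<in> h_space \<gamma>"
proof (rule h_spaceI(1))
  fix n
  have "weight \<gamma> n * \<bar>c n + d n\<bar> \<le> weight \<gamma> n * (\<bar>c n\<bar> + \<bar>d n\<bar>)"
    using weight_pos[of \<gamma> n] by (intro mult_left_mono) auto
  then show "weight \<gamma> n * \<bar>c n + d n\<bar> \<le> h_norm \<gamma> c + h_norm \<gamma> d"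
    using h_spaceD[OF assms(1), of n] h_spaceD[OF assms(2), of n] by (simp add: distrib_left)
qed

lemma h_space_scale:
  assumes "c \<in> h_space \<gamma>"
  shows "(\<lambda>n. a * c n) \<in> h_space \<gamma>"
proof (rule h_spaceI(1))
  show "weight \<gamma> n * \<bar>a * c n\<bar> \<le> \<bar>a\<bar> * h_norm \<gamma> c" for n
    using mult_left_mono[OF h_spaceD[OF assms, of n], of "\<bar>a\<bar>"] by (simp add: abs_mult mult_ac)
qed

lemma X_space_add:
  assumes "f \<in> X_space \<gamma>" "g \<in> X_space \<gamma>"
  shows "(\<lambda>x. f x + g x) \<in> X_space \<gamma>"
proof -
  have "fcoef (\<lambda>x. f x + g x) = (\<lambda>n. fcoef f n + fcoef g n)"
    using assms by (auto simp: X_space_iff fcoef_add)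
  then show ?thesis using assms
    by (auto simp: X_space_iff periodic_fun_simple_def h_space_add intro!: continuous_intros)
qed

lemma X_space_scale:
  assumes "f \<in> X_space \<gamma>"
  shows "(\<lambda>x. a * f x) \<in> X_space \<gamma>"
proof -
  have "fcoef (\<lambda>x. a * f x) = (\<lambda>n. a * fcoef f n)" by (auto simp: fcoef_scale)
  then show ?thesis using assms
    by (auto simp: X_space_iff periodic_fun_simple_def h_space_scale intro!: continuous_intros)
qed

text \<open>Transport of the Neumann series to the function space: Fourier coefficients are an
  isometry of the function space onto the sequence space, with trigonometric series as
  inverse.\<close>
lemma near_identity_invertible_operator:
  assumes \<gamma>: "\<gamma> > 2"
    and T: "\<And>f n. f \<in> X_space \<gamma> \<Longrightarrow> (\<lambda>m. fcoef f m * T (trig m) n) sums T f n"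
    and sm: "\<And>n. summable (\<lambda>m. \<bar>T (trig m) n - of_bool (m = n)\<bar> / weight \<gamma> m)"
    and bd: "\<And>n. weight \<gamma> n * (\<Sum>m. \<bar>T (trig m) n - of_bool (m = n)\<bar> / weight \<gamma> m) \<le> \<kappa>"
    and \<kappa>: "\<kappa> < 1"
  shows "invertible_operator (X_space \<gamma>) (X_norm \<gamma>) (h_space \<gamma>) (h_norm \<gamma>) T"
proof -
  define A where "A n m = T (trig m) n - of_bool (m = n)" for n m
  note smA = sm[folded A_def] and bdA = bd[folded A_def]
  note rows = weighted_rows[OF weight_pos smA bdA]
  have hX: "fcoef f \<in> h_space \<gamma>" if "f \<in> X_space \<gamma>" for f using that by (simp add: X_space_iff)
  have TA: "T f n = fcoef f n + (\<Sum>m. A n m * fcoef f m)" if f: "f \<in> X_space \<gamma>" for f n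
  proof -
    have "(\<lambda>m. fcoef f m * of_bool (m = n)) sums fcoef f n"
      using sums_single[of n "fcoef f"] by (simp add: of_bool_def if_distrib cong: if_cong)
    from sums_diff[OF T[OF f] this]
    have "(\<lambda>m. A n m * fcoef f m) sums (T f n - fcoef f n)" by (simp add: A_def algebra_simps)
    then show ?thesis by (simp add: sums_iff)
  qed
  have bound: "weight \<gamma> n * \<bar>T f n\<bar> \<le> (1 + \<kappa>) * X_norm \<gamma> f" if f: "f \<in> X_space \<gamma>" for f n
  proof -
    have "weight \<gamma> n * \<bar>T f n\<bar> \<le> weight \<gamma> n * (\<bar>fcoef f n\<bar> + \<bar>\<Sum>m. A n m * fcoef f m\<bar>)"
      unfolding TA[OF f] using weight_pos[of \<gamma> n] by (intro mult_left_mono) auto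
    also have "\<dots> \<le> X_norm \<gamma> f + \<kappa> * X_norm \<gamma> f"
      unfolding X_norm_eq distrib_left
      by (intro add_mono h_spaceD[OF hX[OF f]] rows(2)[OF h_spaceD[OF hX[OF f]]])
    finally show ?thesis by (simp add: algebra_simps)
  qed
  have blm: "bounded_linear_map (X_space \<gamma>) (X_norm \<gamma>) (h_space \<gamma>) (h_norm \<gamma>) T"
    unfolding bounded_linear_map_def
  proof (intro conjI ballI allI exI)
    show "T f \<in> h_space \<gamma>" "h_norm \<gamma> (T f) \<le> (1 + \<kappa>) * X_norm \<gamma> f" if "f \<in> X_space \<gamma>" for f
      using h_spaceI[OF bound[OF that]] by auto
    show "T (\<lambda>i. f i + g i) = (\<lambda>j. T f j + T g j)" if f: "f \<in> X_space \<gamma>" and g: "g \<in> X_space \<gamma>" for f g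
    proof
      fix n
      have "fcoef (\<lambda>i. f i + g i) m = fcoef f m + fcoef g m" for m
        using f g by (intro fcoef_add) (auto simp: X_space_iff)
      then show "T (\<lambda>i. f i + g i) n = T f n + T g n"
        using sums_unique2[OF T[OF X_space_add[OF f g]], of n "T f n + T g n"]
          sums_add[OF T[OF f, of n] T[OF g, of n]] by (simp add: distrib_right)
    qed
    show "T (\<lambda>i. a * f i) = (\<lambda>j. a * T f j)" if f: "f \<in> X_space \<gamma>" for a f
    proof
      fix n
      show "T (\<lambda>i. a * f i) n = a * T f n"
        using sums_unique2[OF T[OF X_space_scale[OF f]], of a n "a * T f n"]
          sums_mult[OF T[OF f, of n], of a] by (simp add: fcoef_scale mult.assoc)
    qed
  qed
  show ?thesis
  proof (rule invertible_operatorI[OF blm X_space_add X_space_scale h_space_add h_space_scale])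
    show "f = g" if f: "f \<in> X_space \<gamma>" and g: "g \<in> X_space \<gamma>" and eq: "T f = T g" for f g
    proof -
      define c where "c m = fcoef f m - fcoef g m" for m
      have "weight \<gamma> n * \<bar>c n\<bar> \<le> h_norm \<gamma> (fcoef f) + h_norm \<gamma> (fcoef g)" for n
      proof -
        have "weight \<gamma> n * \<bar>c n\<bar> \<le> weight \<gamma> n * (\<bar>fcoef f n\<bar> + \<bar>fcoef g n\<bar>)"
          unfolding c_def using weight_pos[of \<gamma> n] by (intro mult_left_mono) auto
        then show ?thesis
          using h_spaceD[OF hX[OF f], of n] h_spaceD[OF hX[OF g], of n] by (simp add: distrib_left)
      qed
      moreover have "c n + (\<Sum>m. A n m * c m) = 0" for n
      proof -
        have "(\<Sum>m. A n m * c m) = (\<Sum>m. A n m * fcoef f m) - (\<Sum>m. A n m * fcoef g m)"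
          unfolding c_def right_diff_distrib
          by (intro suminf_diff[symmetric] rows(1)[OF h_spaceD[OF hX]] f g)
        then show ?thesis using TA[OF f, of n] TA[OF g, of n] eq by (simp add: c_def)
      qed
      ultimately have "c n = 0" for n by (rule near_identity_injective[OF weight_pos smA bdA \<kappa>])
      then have "fcoef f = fcoef g" by (auto simp: c_def fun_eq_iff)
      then show "f = g" using X_space_expansion[OF \<gamma> f] X_space_expansion[OF \<gamma> g] by simp
    qed
    show "\<exists>f\<in>X_space \<gamma>. T f = d \<and> X_norm \<gamma> f \<le> 1 / (1 - \<kappa>) * h_norm \<gamma> d" if d: "d \<in> h_space \<gamma>" for d
    proof -
      obtain c where c: "\<And>n. weight \<gamma> n * \<bar>c n\<bar> \<le> h_norm \<gamma> d / (1 - \<kappa>)"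
        "\<And>n. c n + (\<Sum>m. A n m * c m) = d n"
        using near_identity_solvable[OF weight_pos smA bdA \<kappa> h_spaceD[OF d]] by blast
      note ch = h_spaceI[OF c(1)]
      let ?f = "\<lambda>x. \<Sum>n. c n * trig n x"
      note f = synthesis_in_X_space[OF \<gamma> ch(1)]
      have "T ?f = d" using TA[OF f(1)] c(2) by (auto simp: f(2))
      moreover have "X_norm \<gamma> ?f \<le> 1 / (1 - \<kappa>) * h_norm \<gamma> d" using ch(2) by (simp add: X_norm_eq f(2))
      ultimately show ?thesis using f(1) by blast
    qed
  qed
qed

theorem theorem2p5:
  fixes r qs :: nat
    and \<Omega> :: "(real^2) set" and len :: real and \<sigma> :: "real \<Rightarrow> real^2"
    and C :: real and \<alpha> \<beta> :: "real \<Rightarrow> real"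
    and ga gb gc :: "nat \<Rightarrow> nat \<Rightarrow> real \<Rightarrow> real"
    and \<gamma>0 \<gamma> :: real
  assumes "r \<ge> 8" and "qs \<ge> 2"
    and "strictly_convex_domain \<Omega>" and "arclength_boundary r \<Omega> len \<sigma>"
    and "rationally_integrable \<Omega> len \<sigma> qs"
    and "periodic_orbit_expansions r \<Omega> len \<sigma> qs C \<alpha> \<beta> ga gb gc"
    and "(\<lambda>k. real (k + 2) powr (- (\<gamma>0 - 1))) sums (9 / 10)"
    and "\<gamma>0 \<le> \<gamma>" and "\<gamma> < 3"
  shows "\<exists>q0>qs. \<forall>qbar\<ge>q0.
           invertible_operator (X_space \<gamma>) (X_norm \<gamma>) (h_space \<gamma>) (h_norm \<gamma>)
             (I_op (lazutkin_mu len \<sigma>) \<alpha> \<beta> ga gc qbar)"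
proof -
  have \<gamma>: "13 / 5 < \<gamma>" using gamma0_gt[OF assms(7)] assms(8) by linarith
  have r: "r - 4 \<ge> 2" "r - 6 \<ge> 1" "r - 4 \<ge> 1" "r \<ge> 4" using assms(1) by auto
  let ?\<mu> = "lazutkin_mu len \<sigma>"
  obtain M where M: "\<And>x. 0 < ?\<mu> x" "\<And>x. ?\<mu> x \<le> M"
    "\<And>x. \<exists>D. (?\<mu> has_real_derivative D) (at x) \<and> \<bar>D\<bar> \<le> M"
    by (rule lazutkin_mu_bounds[OF assms(4) r(4)]) (rule that)
  have ex: "Cn_norm_le (r - 4) \<alpha> C" "Cn_norm_le (r - 4) \<beta> C"
    "\<And>q k. q > qs \<Longrightarrow> k < q \<Longrightarrow> Cn_norm_le (r - 6) (ga q k) C \<and> Cn_norm_le (r - 6) (gc q k) C"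
    using assms(6) unfolding periodic_orbit_expansions_def by auto
  \<comment> \<open>One constant at least 1 for all the functions that enter.\<close>
  define C' where "C' = max 1 (max C (M\<^sup>2))"
  have C': "C' \<ge> 1" "C \<le> C'" "M\<^sup>2 \<le> C'" by (auto simp: C'_def)
  have up: "t \<le> C' * h" if "t \<le> C * h" "h \<ge> 0" for t h
    using that mult_right_mono[OF C'(2), of h] by linarith
  note \<alpha> = Cn_norm_leD[OF ex(1)] and \<beta> = Cn_norm_leD[OF ex(2)]
  note approx = L_op_trig_approx[where \<mu>="?\<mu>" and \<alpha>=\<alpha> and \<beta>=\<beta> and ga=ga and gc=gc and C=C']
  have ap0: "\<bar>L_op ?\<mu> \<alpha> \<beta> ga gc q (trig 0) x\<bar> \<le> C' / real q ^ 3"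
    and ap: "m \<ge> 1 \<Longrightarrow> \<bar>L_op ?\<mu> \<alpha> \<beta> ga gc q (trig m) x
           - 1 / (2 * pi * real q ^ 2) * (\<Sum>k<q. trig' m (x + real k / real q))\<bar>
         \<le> 970 * C' ^ 3 * osc_err q (freq m)" if q: "q > qs" for q m x
  proof -
    have q1: "q \<ge> 1" using q by simp
    have S: "\<bar>Sq ?\<mu> q t\<bar> \<le> C' / real q ^ 2" for t
      using Sq_bounds(1)[OF M q1, of t] divide_right_mono[OF C'(3), of "real q ^ 2"] by simp
    have dS: "(Sq ?\<mu> q has_real_derivative deriv (Sq ?\<mu> q) t) (at t)" "\<bar>deriv (Sq ?\<mu> q) t\<bar> \<le> C' / real q ^ 2" for t
    proof -
      obtain D where "(Sq ?\<mu> q has_real_derivative D) (at t)" "\<bar>D\<bar> \<le> M\<^sup>2 / real q ^ 2"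
        using Sq_bounds(2)[OF M q1, of t] by blast
      then show "(Sq ?\<mu> q has_real_derivative deriv (Sq ?\<mu> q) t) (at t)" "\<bar>deriv (Sq ?\<mu> q) t\<bar> \<le> C' / real q ^ 2"
        using DERIV_imp_deriv divide_right_mono[OF C'(3), of "real q ^ 2"] by fastforce+
    qed
    have lS: "\<bar>Sq ?\<mu> q s - Sq ?\<mu> q t\<bar> \<le> C' / real q ^ 2 * \<bar>s - t\<bar>" for s t
      using field_differentiable_bound[of UNIV "Sq ?\<mu> q" "deriv (Sq ?\<mu> q)" "C' / real q ^ 2" s t] dS by simp
    have g: "\<bar>ga q k t\<bar> \<le> C'" "\<bar>deriv (ga q k) t\<bar> \<le> C'" "\<bar>gc q k t\<bar> \<le> C'" "\<bar>deriv (gc q k) t\<bar> \<le> C'" if "k < q" for k t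
      using Cn_norm_leD(1,2)[OF conjunct1[OF ex(3)[OF q that]], of t]
        Cn_norm_leD(1,2)[OF conjunct2[OF ex(3)[OF q that]], of t] r C'(2) by linarith+
    have ab: "\<bar>\<alpha> t\<bar> \<le> C'" "\<bar>deriv \<alpha> t\<bar> \<le> C'" "\<bar>\<beta> t\<bar> \<le> C'" "\<bar>deriv \<beta> t\<bar> \<le> C'" for t
      using \<alpha>(1,2)[of t] \<beta>(1,2)[of t] r C'(2) by linarith+
    note L = approx[OF q1 C'(1) ab(1,2) up[OF \<alpha>(3)[OF r(3)]] up[OF \<alpha>(4)[OF r(1)]]
        ab(3,4) up[OF \<beta>(3)[OF r(3)]] S dS(2) lS g, simplified]
    show "\<bar>L_op ?\<mu> \<alpha> \<beta> ga gc q (trig 0) x\<bar> \<le> C' / real q ^ 3" by (rule L(1))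
    show "\<bar>L_op ?\<mu> \<alpha> \<beta> ga gc q (trig m) x
           - 1 / (2 * pi * real q ^ 2) * (\<Sum>k<q. trig' m (x + real k / real q))\<bar>
         \<le> 970 * C' ^ 3 * osc_err q (freq m)" if "m \<ge> 1" using L(2)[of m x] that by simp
  qed
  obtain \<epsilon> where \<epsilon>: "\<epsilon> \<longlonglongrightarrow> 0" "\<And>q N. q \<ge> 1 \<Longrightarrow>
      (\<Sum>p<N * q. real p powr (- \<gamma>) * osc_err q p) \<le> \<epsilon> q * real q powr (- \<gamma>)"
    by (rule osc_err_row_small[OF \<gamma> assms(9)]) (rule that)
  define K where "K = 1940 * C' ^ 3"
  have K: "K \<ge> 0" using C'(1) by (simp add: K_def)
  \<comment> \<open>The bound for the weighted distance of row \<open>q\<close> from the identity: constant function,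
      unperturbed part, and perturbation. The factor 1940 in \<open>K\<close> counts both positions of
      each frequency.\<close>
  define R where "R q = C' / real q ^ 3 * real q powr \<gamma> + 9 / 10 + K * \<epsilon> q" for q :: nat
  have "R \<longlonglongrightarrow> 0 + 9 / 10 + K * 0"
    unfolding R_def
  proof (intro tendsto_add tendsto_mult tendsto_const \<epsilon>(1))
    define s where "s = 3 - \<gamma>"
    have s: "s > 0" "\<gamma> = 3 - s" using assms(9) by (auto simp: s_def)
    show "(\<lambda>q. C' / real q ^ 3 * real q powr \<gamma>) \<longlonglongrightarrow> 0" unfolding s(2) using s(1) by real_asymp
  qed
  then have "eventually (\<lambda>q. R q < 19 / 20) sequentially" by (rule order_tendstoD) simp
  then obtain Q where Q: "\<And>q. q \<ge> Q \<Longrightarrow> R q < 19 / 20" unfolding eventually_sequentially by blast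
  show ?thesis
  proof (intro exI[of _ "max Q (Suc qs)"] conjI allI impI)
    show "qs < max Q (Suc qs)" by simp
    fix qbar assume qbar: "max Q (Suc qs) \<le> qbar"
    let ?T = "I_op ?\<mu> \<alpha> \<beta> ga gc qbar"
    have row: "summable (\<lambda>m. \<bar>?T (trig m) n - of_bool (m = n)\<bar> / weight \<gamma> m) \<and>
        weight \<gamma> n * (\<Sum>m. \<bar>?T (trig m) n - of_bool (m = n)\<bar> / weight \<gamma> m) \<le> 19 / 20" for n
    proof (cases "freq n < qbar \<or> n = 0")
      case True
      then have "?T (trig m) n - of_bool (m = n) = 0" for m by (simp add: I_op_eq fcoef_trig)
      then show ?thesis by simp
    next
      case False
      define q where "q = freq n"
      define x where "x = (if odd n then 3 / (4 * real q) else 0)"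
      have q: "q > qs" "q \<ge> Q" "q \<ge> 1" using False qbar by (auto simp: q_def)
      define a where "a m = ?T (trig m) n - of_bool (m = n)" for m
      define L0 where "L0 m = 1 / (2 * pi * real q ^ 2) * (\<Sum>k<q. trig' m (x + real k / real q))" for m
      have aL: "a m = L_op ?\<mu> \<alpha> \<beta> ga gc q (trig m) x - of_bool (m = n)" for m
        using False by (simp add: a_def I_op_eq q_def x_def)
      have a0: "\<bar>a 0\<bar> \<le> C' / real q ^ 3" using ap0[OF q(1), of x] False by (simp add: aL)
      have ap': "\<bar>a m\<bar> \<le> \<bar>L0 m - of_bool (m = n)\<bar> + 970 * C' ^ 3 * osc_err q (freq m)" if "m \<ge> 1" for m
        using ap[OF q(1) that, of x] unfolding aL L0_def by linarith
      have a: "\<bar>a (2 * p - 1)\<bar> + \<bar>a (2 * p)\<bar>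
          \<le> (if q dvd p \<and> p \<noteq> 0 \<and> p \<noteq> q then real p / real q else 0) + K * osc_err q p" if p: "p \<ge> 1" for p
      proof -
        have "\<bar>L0 (2 * p - 1) - of_bool (2 * p - 1 = n)\<bar> + \<bar>L0 (2 * p) - of_bool (2 * p = n)\<bar>
            \<le> (if q dvd p \<and> p \<noteq> 0 \<and> p \<noteq> q then real p / real q else 0)"
          using False by (intro unperturbed_row[OF _ q_def p x_def L0_def]) auto
        moreover have "\<bar>a (2 * p - 1)\<bar> \<le> \<bar>L0 (2 * p - 1) - of_bool (2 * p - 1 = n)\<bar> + 970 * C' ^ 3 * osc_err q p"
          using ap'[of "2 * p - 1"] p by simp
        moreover have "\<bar>a (2 * p)\<bar> \<le> \<bar>L0 (2 * p) - of_bool (2 * p = n)\<bar> + 970 * C' ^ 3 * osc_err q p"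
          using ap'[of "2 * p"] p by simp
        ultimately show ?thesis unfolding K_def by linarith
      qed
      have \<gamma>2: "\<gamma> > 2" using \<gamma> by simp
      note W = weighted_row_bound[where \<gamma>=\<gamma> and a=a, OF \<gamma>2 q(3) K a0 _
          harmonic_tail_le[OF assms(7,8)] \<epsilon>(2)[OF q(3)]]
      have Ws: "summable (\<lambda>m. \<bar>a m\<bar> / weight \<gamma> m)" by (rule W(1)) (erule a)
      have Wb: "real q powr \<gamma> * (\<Sum>m. \<bar>a m\<bar> / weight \<gamma> m) \<le> R q"
        unfolding R_def by (rule W(2)) (erule a)
      have "weight \<gamma> n = real q powr \<gamma>" using False by (simp add: weight_def q_def)
      then have "weight \<gamma> n * (\<Sum>m. \<bar>a m\<bar> / weight \<gamma> m) \<le> 19 / 20"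
        using Wb Q[OF q(2)] by simp
      with Ws show ?thesis unfolding a_def by blast
    qed
    have "\<gamma> > 2" using \<gamma> by simp
    then show "invertible_operator (X_space \<gamma>) (X_norm \<gamma>) (h_space \<gamma>) (h_norm \<gamma>) ?T"
      by (intro near_identity_invertible_operator[where \<kappa> = "19 / 20"] I_op_expansion) (use row in auto)
  qed
qed

end
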